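(* Let $m_0,n_0,d\ge1$ and $l\ge2$ be integers with $n_0\ge2$, put $m=dm_0$, $n=dn_0$, $g=\gcd(m_0,n_0)$, let $1\le\tau_l\le n_0-1$, and let $$\tau=\left(n-1,(n_0-1)^{l-2},\tau_l\right)\vdash N,\qquad \mu=\left((m+(l-2)m_0)^{\tau_l},(m+(l-3)m_0)^{n_0-1},\dots,m^{n_0-1},0^{n-1}\right).$$ Let $(q,t)=\left(zu^{-n_0/g},u^{m_0/g}\right)$, where $u$ is an indeterminate and $z\in\mathbb C$ is such that $z^{m_0/g}$ is a primitive $g$-th root of unity (so $q^mt^n=1$). Suppose that the nonsymmetric Macdonald polynomial $M_\mu$ is singular at this specialization. Then, at this specialization, $M_\mu$ is of isotype $\tau$ (it lies in a space of polynomials of isotype $\tau$ for $\mathcal H_N(t)$), and $\{M_{\alpha(S)}:S\in\mathrm{Tab}_\tau\}$, where $\alpha(S)$ is the reverse lattice permutation associated to $S$, is a basis for a space of polynomials of isotype $\tau$ for $\mathcal H_N(t)$.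
   Context: Tableaux. For a partition $\tau$ of $N$, the Ferrers diagram is the set of boxes $(i,j)$ (row $i$, column $j$), $1\le i\le \ell(\tau)$, $1\le j\le\tau_i$. $\mathrm{Tab}_\tau$ is the set of reverse standard Young tableaux of shape $\tau$: fillings of the boxes by $1,\dots,N$, each used once, decreasing along each row (as $j$ increases) and along each column (as $i$ increases). For $S\in\mathrm{Tab}_\tau$ the entry $k$ is in box $(\mathrm{row}_S[k],\mathrm{col}_S[k])$ and its content is $c_S[k]=\mathrm{col}_S[k]-\mathrm{row}_S[k]$. $S^{(i)}$ is obtained from $S$ by exchanging $i$ and $i+1$. The reverse lattice permutation of $S$ is $\alpha(S)\in\mathbb N_0^N$, $\alpha(S)_i=v(\mathrm{row}_S[i])$, with $v(1)=0$ and $v(j)=m+(j-2)m_0$ for $2\le j\le\ell(\tau)$. Exponents in partitions denote repetitions. Operators act on the right on $\mathcal P=\mathbb F[x_1,\dots,x_N]$, where $\mathbb F\supseteq\mathbb C(q,t)$ (or $\mathbb F\supseteq\mathbb C(u)$ after specialization): $pT_i=(1-t)x_{i+1}\frac{p(x)-p(xs_i)}{x_i-x_{i+1}}+t\,p(xs_i)$, $1\le i<N$, where $xs_i$ exchanges $x_i,x_{i+1}$ (this is an action of the Hecke algebra $\mathcal H_N(t)$, with $(T_i+1)(T_i-t)=0$ and the braid relations); $f\omega^q=f(qx_N,x_1,\dots,x_{N-1})$; $\xi_i=t^{i-1}T_{i-1}^{-1}\cdots T_1^{-1}\omega^qT_{N-1}\cdots T_i$; $f\mathcal D_N^{q,t}=(f-f\xi_N)/x_N$,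 $\mathcal D_i^{q,t}=\frac1tT_i\mathcal D_{i+1}^{q,t}T_i$. A polynomial $p$ is singular at a specialization of $(q,t)$ if $p\mathcal D_i^{q,t}=0$ for all $i$ at that specialization. Nonsymmetric Macdonald polynomials: for $\alpha\in\mathbb N_0^N$ let $\alpha^+$ be its nonincreasing rearrangement, $r(\alpha,i)=\#\{j:\alpha_j>\alpha_i\}+\#\{j\le i:\alpha_j=\alpha_i\}$. Write $\alpha\succ\beta$ if $\alpha\ne\beta$ and all partial sums satisfy $\sum_{i\le j}\alpha_i\ge\sum_{i\le j}\beta_i$; $\alpha\rhd\beta$ if $|\alpha|=|\beta|$ and either $\alpha^+\succ\beta^+$, or $\alpha^+=\beta^+$ and $\alpha\succ\beta$. For generic $(q,t)$, $M_\alpha$ is the simultaneous eigenfunction $M_\alpha\xi_i=\zeta_\alpha(i)M_\alpha$, $\zeta_\alpha(i)=q^{\alpha_i}t^{N-r(\alpha,i)}$, with $\rhd$-leading term a power of $t$ times $x^\alpha$, normalized so that $M_\alpha T_i=M_{\alpha s_i}-\frac{1-t}{1-\zeta_\alpha(i+1)/\zeta_\alpha(i)}M_\alpha$ whenever $\alpha_i<\alpha_{i+1}$ (here $\alpha s_i$ exchanges $\alpha_i,\alpha_{i+1}$). Speaking of $M_\mu$ at the specialization presupposes its coefficients have no pole there. A basis $\{g_S:S\in\mathrm{Tab}_\tau\}$ of an $\mathcal H_N(t)$-invariant space of polynomials is a basis for a space of polynomials of isotype $\tau$ for $\mathcal H_N(t)$ if, with $b=c_S[i]-c_S[i+1]$: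 $g_ST_i=tg_S$ if $\mathrm{row}_S[i]=\mathrm{row}_S[i+1]$; $g_ST_i=-g_S$ if $\mathrm{col}_S[i]=\mathrm{col}_S[i+1]$; $g_ST_i=g_{S^{(i)}}+\frac{t-1}{1-t^{-b}}g_S$ if $\mathrm{row}_S[i]<\mathrm{row}_S[i+1]$ and $\mathrm{col}_S[i]>\mathrm{col}_S[i+1]$; $g_ST_i=\frac{t(t^{b+1}-1)(t^{b-1}-1)}{(t^b-1)^2}g_{S^{(i)}}+\frac{t^b(t-1)}{t^b-1}g_S$ if $b\le-2$. *)

theory Defs
  imports
    Complex_Main
    "HOL-Library.Poly_Mapping"
    "HOL-Computational_Algebra.Polynomial"
    "HOL-Computational_Algebra.Fraction_Field"
    "HOL-Combinatorics.Transposition"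
begin

section \<open>Polynomials and compositions\<close>

text \<open>
  The exponent of the monomial \<open>x\<^sub>1\<^sup>a \<cdots> x\<^sub>N\<^sup>z\<close> and the compositions in \<open>\<nat>\<^sub>0\<^sup>N\<close> are both finitely
  supported functions on the positions \<open>1, \<dots>, N\<close> (the value at every other position is \<open>0\<close>).
  A polynomial is a finitely supported function from exponents to coefficients; multiplication of
  type \<open>'a mpol\<close> is the convolution product of \<^theory>\<open>HOL-Library.Poly_Mapping\<close>.
\<close>

type_synonym composition = "nat \<Rightarrow>\<^sub>0 nat"
type_synonym 'a mpol = "composition \<Rightarrow>\<^sub>0 'a"

definition comps :: "nat \<Rightarrow> composition set" where
  "comps N = {\<alpha>. Poly_Mapping.keys \<alpha> \<subseteq> {1..N}}"

definition comp_of :: "nat \<Rightarrow> (nat \<Rightarrow> nat) \<Rightarrow> composition" where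
  "comp_of N f = (\<Sum>i = 1..N. Poly_Mapping.single i (f i))"

definition comp_of_list :: "nat list \<Rightarrow> composition" where
  "comp_of_list as = comp_of (length as) (\<lambda>i. as ! (i - 1))"

definition polys :: "nat \<Rightarrow> 'a::zero mpol set" where
  "polys N = {p. Poly_Mapping.keys p \<subseteq> comps N}"

definition const :: "'a::zero \<Rightarrow> 'a mpol" where
  "const c = Poly_Mapping.single 0 c"

definition var :: "nat \<Rightarrow> 'a::zero_neq_one mpol" where
  "var i = Poly_Mapping.single (Poly_Mapping.single i 1) 1"

definition scale :: "'a::comm_semiring_1 \<Rightarrow> 'a mpol \<Rightarrow> 'a mpol" where
  "scale c p = const c * p"

definition subst :: "(nat \<Rightarrow> 'a::comm_ring_1 mpol) \<Rightarrow> 'a mpol \<Rightarrow> 'a mpol" where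
  "subst f p = (\<Sum>e\<in>Poly_Mapping.keys p.
     scale (Poly_Mapping.lookup p e)
       (\<Prod>k\<in>Poly_Mapping.keys e. f k ^ Poly_Mapping.lookup e k))"

text \<open>Used only where \<open>b\<close> is nonzero and divides \<open>a\<close>.\<close>

definition exact_quot :: "'a::idom mpol \<Rightarrow> 'a mpol \<Rightarrow> 'a mpol" where
  "exact_quot a b = (THE c. a = b * c)"

interpretation mpol: vector_space "scale :: 'a::field \<Rightarrow> 'a mpol \<Rightarrow> 'a mpol"
  by unfold_locales
    (simp_all add: scale_def const_def single_add mult_single algebra_simps
      flip: single_one mult.assoc)


section \<open>Hecke algebra action and Dunkl operators\<close>

text \<open>
  Operators act on the right in the source, so \<open>p A B\<close> is \<open>B (A p)\<close> here; \<open>fold\<close> over a list of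
  indices applies the operator with the first index of the list first.
\<close>

definition swap_vars :: "nat \<Rightarrow> 'a::comm_ring_1 mpol \<Rightarrow> 'a mpol" where
  "swap_vars i = subst (\<lambda>k. var (transpose i (i + 1) k))"

definition hecke :: "'a::field \<Rightarrow> nat \<Rightarrow> 'a mpol \<Rightarrow> 'a mpol" where
  "hecke t i p =
     scale (1 - t) (var (i + 1) * exact_quot (p - swap_vars i p) (var i - var (i + 1)))
     + scale t (swap_vars i p)"

definition omega :: "'a::field \<Rightarrow> nat \<Rightarrow> 'a mpol \<Rightarrow> 'a mpol" where
  "omega q N = subst (\<lambda>k. if k = 1 then scale q (var N) else var (k - 1))"

definition cherednik :: "'a::field \<Rightarrow> 'a \<Rightarrow> nat \<Rightarrow> nat \<Rightarrow> 'a mpol \<Rightarrow> 'a mpol" where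
  "cherednik q t N i p =
     scale (t ^ (i - 1))
       (fold (hecke t) (rev [i..<N])
         (omega q N
           (fold (\<lambda>j. inv (hecke t j)) (rev [1..<i]) p)))"

function dunkl :: "'a::field \<Rightarrow> 'a \<Rightarrow> nat \<Rightarrow> nat \<Rightarrow> 'a mpol \<Rightarrow> 'a mpol" where
  "dunkl q t N i p =
     (if i < N then scale (1 / t) (hecke t i (dunkl q t N (i + 1) (hecke t i p)))
      else exact_quot (p - cherednik q t N N p) (var N))"
  by pat_completeness auto
termination
  by (relation "measure (\<lambda>(q, t, N, i, p). N - i)") auto

definition singular :: "'a::field \<Rightarrow> 'a \<Rightarrow> nat \<Rightarrow> 'a mpol \<Rightarrow> bool" where
  "singular q t N p \<longleftrightarrow> (\<forall>i\<in>{1..N}. dunkl q t N i p = 0)"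


section \<open>Nonsymmetric Macdonald polynomials\<close>

definition rank :: "composition \<Rightarrow> nat \<Rightarrow> nat \<Rightarrow> nat" where
  "rank \<alpha> N i =
     card {j\<in>{1..N}. Poly_Mapping.lookup \<alpha> j > Poly_Mapping.lookup \<alpha> i}
     + card {j\<in>{1..i}. Poly_Mapping.lookup \<alpha> j = Poly_Mapping.lookup \<alpha> i}"

definition spectral :: "'a::field \<Rightarrow> 'a \<Rightarrow> nat \<Rightarrow> composition \<Rightarrow> nat \<Rightarrow> 'a" where
  "spectral q t N \<alpha> i = q ^ Poly_Mapping.lookup \<alpha> i * t ^ (N - rank \<alpha> N i)"

definition decreasing_rearrangement :: "nat \<Rightarrow> composition \<Rightarrow> composition" where
  "decreasing_rearrangement N \<alpha> =
     comp_of_list (rev (sort (map (Poly_Mapping.lookup \<alpha>) [1..<N + 1])))"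

definition dominates :: "nat \<Rightarrow> composition \<Rightarrow> composition \<Rightarrow> bool" where
  "dominates N \<alpha> \<beta> \<longleftrightarrow> \<alpha> \<noteq> \<beta> \<and>
     (\<forall>j\<in>{1..N}. (\<Sum>i = 1..j. Poly_Mapping.lookup \<alpha> i) \<ge> (\<Sum>i = 1..j. Poly_Mapping.lookup \<beta> i))"

definition above :: "nat \<Rightarrow> composition \<Rightarrow> composition \<Rightarrow> bool" where
  "above N \<alpha> \<beta> \<longleftrightarrow>
     (\<Sum>i = 1..N. Poly_Mapping.lookup \<alpha> i) = (\<Sum>i = 1..N. Poly_Mapping.lookup \<beta> i) \<and>
     (dominates N (decreasing_rearrangement N \<alpha>) (decreasing_rearrangement N \<beta>) \<or>
      decreasing_rearrangement N \<alpha> = decreasing_rearrangement N \<beta> \<and> dominates N \<alpha> \<beta>)"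

definition swap_comp :: "nat \<Rightarrow> nat \<Rightarrow> composition \<Rightarrow> composition" where
  "swap_comp N i \<alpha> = comp_of N (\<lambda>k. Poly_Mapping.lookup \<alpha> (transpose i (i + 1) k))"

text \<open>The field \<open>\<complex>(q,t)\<close>: the outer polynomial variable is \<open>q\<close>, the inner one is \<open>t\<close>.\<close>

type_synonym ratfun = "complex poly poly fract"

definition gen_q :: ratfun where "gen_q = Fract [:0, 1:] 1"
definition gen_t :: ratfun where "gen_t = Fract [:[:0, 1:]:] 1"

text \<open>
  The conditions determine the family up to one power of \<open>t\<close> for each orbit of compositions under
  permutation of the entries, so statements about "the" polynomials \<open>M \<alpha>\<close> are made for every family
  that satisfies them.
\<close>

definition macdonald_family :: "nat \<Rightarrow> (composition \<Rightarrow> ratfun mpol) \<Rightarrow> bool" where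
  "macdonald_family N M \<longleftrightarrow> (\<forall>\<alpha>\<in>comps N.
     M \<alpha> \<in> polys N \<and>
     (\<forall>i\<in>{1..N}. cherednik gen_q gen_t N i (M \<alpha>) = scale (spectral gen_q gen_t N \<alpha> i) (M \<alpha>)) \<and>
     (\<exists>k::int. Poly_Mapping.lookup (M \<alpha>) \<alpha> = gen_t powi k) \<and>
     (\<forall>\<beta>\<in>Poly_Mapping.keys (M \<alpha>). \<beta> = \<alpha> \<or> above N \<alpha> \<beta>) \<and>
     (\<forall>i\<in>{1..<N}. Poly_Mapping.lookup \<alpha> i < Poly_Mapping.lookup \<alpha> (i + 1) \<longrightarrow>
        hecke gen_t i (M \<alpha>) =
          M (swap_comp N i \<alpha>)
          - scale ((1 - gen_t) / (1 - spectral gen_q gen_t N \<alpha> (i + 1) / spectral gen_q gen_t N \<alpha> i))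
              (M \<alpha>)))"


section \<open>Specialization of the parameters\<close>

text \<open>
  A pair \<open>(\<iota>, u)\<close> as follows is the same as an embedding of \<open>\<complex>(u)\<close>, with \<open>u\<close> an indeterminate,
  into the field \<open>'a\<close>.
\<close>

definition extends_C_u :: "(complex \<Rightarrow> 'a::field) \<Rightarrow> 'a \<Rightarrow> bool" where
  "extends_C_u \<iota> u \<longleftrightarrow>
     \<iota> 1 = 1 \<and> (\<forall>a b. \<iota> (a + b) = \<iota> a + \<iota> b) \<and> (\<forall>a b. \<iota> (a * b) = \<iota> a * \<iota> b) \<and>
     (\<forall>p. p \<noteq> 0 \<longrightarrow> poly (map_poly \<iota> p) u \<noteq> 0)"

definition eval_qt :: "(complex \<Rightarrow> 'a::field) \<Rightarrow> 'a \<Rightarrow> 'a \<Rightarrow> complex poly poly \<Rightarrow> 'a" where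
  "eval_qt \<iota> q t P = poly (map_poly (\<lambda>c. poly (map_poly \<iota> c) t) P) q"

definition coeff_specializes ::
    "(complex \<Rightarrow> 'a::field) \<Rightarrow> 'a \<Rightarrow> 'a \<Rightarrow> ratfun \<Rightarrow> 'a \<Rightarrow> bool" where
  "coeff_specializes \<iota> q t c v \<longleftrightarrow>
     (\<exists>P Q. c = Fract P Q \<and> eval_qt \<iota> q t Q \<noteq> 0 \<and> v = eval_qt \<iota> q t P / eval_qt \<iota> q t Q)"

definition no_pole :: "(complex \<Rightarrow> 'a::field) \<Rightarrow> 'a \<Rightarrow> 'a \<Rightarrow> ratfun mpol \<Rightarrow> bool" where
  "no_pole \<iota> q t p \<longleftrightarrow>
     (\<forall>e. \<exists>v. coeff_specializes \<iota> q t (Poly_Mapping.lookup p e) v)"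

definition specialize :: "(complex \<Rightarrow> 'a::field) \<Rightarrow> 'a \<Rightarrow> 'a \<Rightarrow> ratfun mpol \<Rightarrow> 'a mpol" where
  "specialize \<iota> q t p = Poly_Mapping.map (\<lambda>c. THE v. coeff_specializes \<iota> q t c v) p"


section \<open>Reverse standard Young tableaux and isotype\<close>

text \<open>
  A partition is the list of its parts. A tableau is a function on all pairs that is \<open>0\<close> outside
  the diagram, so that each filling is represented exactly once.
\<close>

definition diagram :: "nat list \<Rightarrow> (nat \<times> nat) set" where
  "diagram \<tau> = {(i, j). 1 \<le> i \<and> i \<le> length \<tau> \<and> 1 \<le> j \<and> j \<le> \<tau> ! (i - 1)}"

definition Tab :: "nat list \<Rightarrow> (nat \<times> nat \<Rightarrow> nat) set" where
  "Tab \<tau> = {S.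
     bij_betw S (diagram \<tau>) {1..sum_list \<tau>} \<and> (\<forall>b. b \<notin> diagram \<tau> \<longrightarrow> S b = 0) \<and>
     (\<forall>i j j'. (i, j) \<in> diagram \<tau> \<and> (i, j') \<in> diagram \<tau> \<and> j < j' \<longrightarrow> S (i, j) > S (i, j')) \<and>
     (\<forall>i i' j. (i, j) \<in> diagram \<tau> \<and> (i', j) \<in> diagram \<tau> \<and> i < i' \<longrightarrow> S (i, j) > S (i', j))}"

definition row :: "(nat \<times> nat \<Rightarrow> nat) \<Rightarrow> nat \<Rightarrow> nat" where
  "row S k = fst (THE b. S b = k)"

definition col :: "(nat \<times> nat \<Rightarrow> nat) \<Rightarrow> nat \<Rightarrow> nat" where
  "col S k = snd (THE b. S b = k)"

definition tab_content :: "(nat \<times> nat \<Rightarrow> nat) \<Rightarrow> nat \<Rightarrow> int" where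
  "tab_content S k = int (col S k) - int (row S k)"

definition swap_entries :: "nat \<Rightarrow> (nat \<times> nat \<Rightarrow> nat) \<Rightarrow> (nat \<times> nat \<Rightarrow> nat)" where
  "swap_entries i S = transpose i (i + 1) \<circ> S"

definition reverse_lattice_perm ::
    "nat \<Rightarrow> nat \<Rightarrow> nat \<Rightarrow> (nat \<times> nat \<Rightarrow> nat) \<Rightarrow> composition" where
  "reverse_lattice_perm N m m0 S =
     comp_of N (\<lambda>i. if row S i = 1 then 0 else m + (row S i - 2) * m0)"

definition isotype_basis ::
    "'a::field \<Rightarrow> nat \<Rightarrow> nat list \<Rightarrow> ((nat \<times> nat \<Rightarrow> nat) \<Rightarrow> 'a mpol) \<Rightarrow> bool" where
  "isotype_basis t N \<tau> g \<longleftrightarrow>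
     g ` Tab \<tau> \<subseteq> polys N \<and> inj_on g (Tab \<tau>) \<and> mpol.independent (g ` Tab \<tau>) \<and>
     (\<forall>i\<in>{1..<N}. \<forall>p\<in>mpol.span (g ` Tab \<tau>). hecke t i p \<in> mpol.span (g ` Tab \<tau>)) \<and>
     (\<forall>S\<in>Tab \<tau>. \<forall>i\<in>{1..<N}. let b = tab_content S i - tab_content S (i + 1) in
        (row S i = row S (i + 1) \<longrightarrow> hecke t i (g S) = scale t (g S)) \<and>
        (col S i = col S (i + 1) \<longrightarrow> hecke t i (g S) = - g S) \<and>
        (row S i < row S (i + 1) \<and> col S i > col S (i + 1) \<longrightarrow>
           hecke t i (g S) =
             g (swap_entries i S) + scale ((t - 1) / (1 - t powi (- b))) (g S)) \<and>
        (b \<le> - 2 \<longrightarrow>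
           hecke t i (g S) =
             scale (t * (t powi (b + 1) - 1) * (t powi (b - 1) - 1) / (t powi b - 1)\<^sup>2)
               (g (swap_entries i S))
             + scale (t powi b * (t - 1) / (t powi b - 1)) (g S)))"

definition of_isotype :: "'a::field \<Rightarrow> nat \<Rightarrow> nat list \<Rightarrow> 'a mpol \<Rightarrow> bool" where
  "of_isotype t N \<tau> p \<longleftrightarrow> (\<exists>g. isotype_basis t N \<tau> g \<and> p \<in> mpol.span (g ` Tab \<tau>))"

end

theory Submission
  imports Defs "HOL-Library.Multiset"
begin

text \<open>
  A singular polynomial satisfies \<open>p \<xi>\<^sub>i = p \<phi>\<^sub>i\<close> for the Jucys-Murphy elements
  \<open>\<phi>\<^sub>i = t\<^sup>i\<^sup>-\<^sup>N T\<^sub>i \<cdots> T\<^sub>N\<^sub>-\<^sub>1 T\<^sub>N\<^sub>-\<^sub>1 \<cdots> T\<^sub>i\<close>. As \<open>q\<^sup>m t\<^sup>n = q\<^sup>m\<^sup>0 t\<^sup>n\<^sup>0 = 1\<close>, the spectral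
  vector of \<open>M\<^sub>\<alpha>\<^sub>(\<^sub>S\<^sub>)\<close> specializes to the powers \<open>t\<^sup>c\<close> of the contents of \<open>S\<close>, and \<open>\<mu> = \<alpha>(S)\<close> for
  one tableau. Every other tableau is reached from it by exchanging \<open>i\<close> and \<open>i + 1\<close> where the contents
  differ by at least \<open>2\<close>; there the step between the Macdonald polynomials is invertible
  without poles, and it moves Jucys-Murphy eigenvectors to Jucys-Murphy eigenvectors. What remains is
  \<open>M\<^sub>\<alpha>\<^sub>(\<^sub>S\<^sub>) T\<^sub>i\<close> for \<open>i\<close>, \<open>i + 1\<close> adjacent in a row or a column of \<open>S\<close>. If it were not a multiple of
  \<open>M\<^sub>\<alpha>\<^sub>(\<^sub>S\<^sub>)\<close>, the intertwiner would produce an eigenvector whose eigenvalues are not the contents of any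
  tableau, which the argument of Okounkov and Vershik excludes because \<open>t\<close> is not a root of unity.
\<close>

text \<open>Singularity is known for \<open>M \<mu>\<close> alone, and \<open>\<mu>\<close> is
  nonincreasing, so every maximal chain of Macdonald steps
  \<open>M_\<alpha> T_i = M_(\<alpha> s_i) - ...\<close> through the \<open>\<alpha>(S)\<close> ends
  there. Each step therefore has to be run backwards over C(q,t), dividing by a scalar built from
  spectral values; its specialization is nonzero because the exchanged contents differ by at least
  2. It is not shown that the other \<open>M_\<alpha>(S)\<close> are singular: what travels along
  the chain is the absence of poles together with the Jucys-Murphy eigenvector equations. The
  Okounkov-Vershik argument usually starts from diagonalizable Jucys-Murphy elements. Here only
  simultaneous eigenvectors with eigenvalues \<open>t^b\<close> are at hand, and the Jordan blocks
  that the argument could meet are excluded directly. That exclusion is part of one strong induction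
  on the length of the eigenvalue sequence, which explains the hypotheses \<open>P\<close> about
  shorter sequences in the preparatory lemmas.\<close>

section \<open>Content vectors and Jucys-Murphy elements\<close>

text \<open>The Okounkov-Vershik description of the content vectors of standard tableaux.\<close>

definition content_vector :: "nat \<Rightarrow> (nat \<Rightarrow> int) \<Rightarrow> bool" where
  "content_vector n b \<longleftrightarrow> (\<forall>q\<in>{1..n}. (q = 1 \<longrightarrow> b q = 0) \<and>
     (q > 1 \<longrightarrow> (\<exists>p\<in>{1..<q}. \<bar>b p - b q\<bar> = 1)) \<and>
     (\<forall>p\<in>{1..<q}. b p = b q \<longrightarrow>
        (\<exists>r\<in>{p<..<q}. b r = b q + 1) \<and> (\<exists>r\<in>{p<..<q}. b r = b q - 1)))"

lemma content_vectorD: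
  assumes "content_vector n b" "1 \<le> q" "q \<le> n"
  shows "q = 1 \<Longrightarrow> b q = 0"
    and "q > 1 \<Longrightarrow> \<exists>p\<in>{1..<q}. \<bar>b p - b q\<bar> = 1"
    and "p \<in> {1..<q} \<Longrightarrow> b p = b q \<Longrightarrow> \<exists>r\<in>{p<..<q}. b r = b q + 1"
    and "p \<in> {1..<q} \<Longrightarrow> b p = b q \<Longrightarrow> \<exists>r\<in>{p<..<q}. b r = b q - 1"
  using assms unfolding content_vector_def by (auto simp: Ball_def)

text \<open>Following neighbours of \<open>b q\<close> to earlier and earlier positions ends at
  \<open>b 1 = 0\<close>, and a path with steps of size 1 cannot jump over an integer.\<close>

lemma content_vector_interval:
  assumes "content_vector n b" "1 \<le> q" "q \<le> n" "0 \<le> x \<and> x \<le> b q \<or> b q \<le> x \<and> x \<le> 0"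
  shows "\<exists>p\<in>{1..q}. b p = x"
  using assms(2-)
proof (induction q rule: less_induct)
  case (less q)
  show ?case
  proof (cases "q = 1 \<or> x = b q")
    case True
    then show ?thesis using content_vectorD(1)[OF assms(1) less.prems(1,2)] less.prems by auto
  next
    case False
    then obtain p where p: "p \<in> {1..<q}" "\<bar>b p - b q\<bar> = 1"
      using content_vectorD(2)[OF assms(1) less.prems(1,2)] less.prems by auto
    then have "\<exists>p'\<in>{1..p}. b p' = x"
      using less.prems False by (intro less.IH) auto
    then show ?thesis using p by force
  qed
qed

text \<open>
  A content can be appended to a content vector only directly after both of its neighbours, so two
  neighbouring contents never compete for the same place.
\<close>

lemma content_vector_extensions_not_adjacent:
  assumes b: "content_vector k b" and b': "content_vector k b'" and "1 \<le> k"
    and eq: "\<And>j. 1 \<le> j \<Longrightarrow> j < k \<Longrightarrow> b' j = b j"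
    and adj: "b' k = b k + 1"
  shows False
proof -
  define R where "R = b ` {1..<k}"
  have R': "b' ` {1..<k} = R" using eq by (force simp: R_def)
  have k1: "k > 1"
    using content_vectorD(1)[OF b] content_vectorD(1)[OF b'] adj \<open>1 \<le> k\<close>
    by (metis add_0 le_refl le_neq_implies_less zero_neq_one)
  have near: "b k - 1 \<in> R \<or> b k + 1 \<in> R"
    using content_vectorD(2)[OF b _ _ k1] \<open>1 \<le> k\<close> unfolding R_def
    by (smt (verit, best) image_eqI le_refl)
  have near': "b k \<in> R \<or> b k + 2 \<in> R"
    using content_vectorD(2)[OF b' _ _ k1] \<open>1 \<le> k\<close> adj unfolding R'[symmetric]
    by (smt (verit, best) image_eqI le_refl)
  have up: "\<exists>r\<in>{p<..<k}. b r = b k + 1" if "p \<in> {1..<k}" "b p = b k" for p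
    using content_vectorD(3)[OF b _ _ that] \<open>1 \<le> k\<close> by auto
  have down: "\<exists>r\<in>{p<..<k}. b r = b k" if "p \<in> {1..<k}" "b p = b k + 1" for p
    using content_vectorD(4)[OF b' _ _ that(1)] \<open>1 \<le> k\<close> that adj eq by force
  \<comment> \<open>\<open>up\<close> and \<open>down\<close> alternate: an occurrence of
    \<open>b k\<close> or \<open>b k + 1\<close> before \<open>k\<close> forces a later one that is
    still before \<open>k\<close>, which cannot go on.\<close>
  have no_top: False if "p \<in> {1..<k}" "b p = b k \<or> b p = b k + 1" for p
    using that
  proof (induction "k - p" arbitrary: p rule: less_induct)
    case less
    from less.prems obtain r where "r \<in> {p<..<k}" "b r = b k \<or> b r = b k + 1"
      using up down by blast
    then show False using less.prems by (intro less.hyps[of r]) auto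
  qed
  then have notin: "b k \<notin> R" "b k + 1 \<notin> R" unfolding R_def by force+
  then obtain p p' where p: "p \<in> {1..<k}" "b p = b k - 1" "p' \<in> {1..<k}" "b p' = b k + 2"
    using near near' unfolding R_def by auto
  \<comment> \<open>Only \<open>b k - 1\<close> and \<open>b k + 2\<close> remain as neighbours. The
    path from 0 to one of them has to pass through \<open>b k\<close> or \<open>b k + 1\<close>,
    which were excluded.\<close>
  show False
  proof (cases "0 \<le> b k")
    case True
    then obtain j where "j \<in> {1..p'}" "b j = b k"
      using content_vector_interval[OF b, of p' "b k"] p by auto
    then have "b k \<in> b ` {1..<k}" using p by (intro image_eqI[of _ _ j]) auto
    then show False using notin by (simp add: R_def)
  next
    case False
    then obtain j where "j \<in> {1..p}" "b j = b k + 1"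
      using content_vector_interval[OF b, of p "b k + 1"] p by auto
    then have "b k + 1 \<in> b ` {1..<k}" using p by (intro image_eqI[of _ _ j]) auto
    then show False using notin by (simp add: R_def)
  qed
qed

text \<open>Kept abstract because it is used twice: for polynomials over the specialized field with
  \<open>t\<close>, and over C(q,t) with \<open>gen_t\<close>. The quadratic relation is
  \<open>(s_k + 1)(s_k - t) = 0\<close>.\<close>

locale hecke_module = vector_space smul
  for smul :: "'k::field \<Rightarrow> 'v::ab_group_add \<Rightarrow> 'v" (infixr \<open>*s\<close> 75) +
  fixes t :: 'k and s :: "nat \<Rightarrow> 'v \<Rightarrow> 'v" and N :: nat
  assumes t_nonzero: "t \<noteq> 0" and t_not_root: "\<And>k::nat. 0 < k \<Longrightarrow> t ^ k \<noteq> 1"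
    and s_add: "s k (v + w) = s k v + s k w" and s_smul: "s k (a *s v) = a *s s k v"
    and s_quad: "s k (s k v) = (t - 1) *s s k v + t *s v"
    and braid: "0 < k \<Longrightarrow> Suc k < N \<Longrightarrow> s k (s (Suc k) (s k v)) = s (Suc k) (s k (s (Suc k) v))"
    and far_comm: "0 < j \<Longrightarrow> j + 2 \<le> k \<Longrightarrow> k < N \<Longrightarrow> s j (s k v) = s k (s j v)"
begin

text \<open>With \<open>s k = T_(N-k)\<close>, \<open>jm (N + 1 - i)\<close> is the element
  \<open>\<phi>_i\<close>, and \<open>jm 1\<close> is the identity. The value at index 0 is a dummy;
  eigenvalue conditions start at 1.\<close>

primrec jm :: "nat \<Rightarrow> 'v \<Rightarrow> 'v" where
  "jm 0 v = v"
| "jm (Suc k) v = (if k = 0 then v else (1 / t) *s s k (jm k (s k v)))"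

lemma jm_Suc: "1 \<le> k \<Longrightarrow> jm (Suc k) v = (1 / t) *s s k (jm k (s k v))"
  by simp

declare jm.simps(2) [simp del]

lemma jm_1 [simp]: "jm 1 v = v" "jm (Suc 0) v = v"
  by (simp_all add: jm.simps(2))

lemma jm_add: "jm k (v + w) = jm k v + jm k w"
  by (induction k arbitrary: v w) (simp_all add: jm.simps(2) s_add scale_right_distrib)

lemma jm_smul: "jm k (a *s v) = a *s jm k v"
  by (induction k arbitrary: v) (simp_all add: jm.simps(2) s_smul scale_left_commute)

lemmas lin = s_add s_smul jm_add jm_smul

lemma jm_comm_above: "1 \<le> k \<Longrightarrow> k < j \<Longrightarrow> j < N \<Longrightarrow> jm k (s j v) = s j (jm k v)"
proof (induction k arbitrary: v)
  case (Suc k)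
  show ?case
  proof (cases "k = 0")
    case False
    then have "s k (s j w) = s j (s k w)" for w
      using Suc.prems by (intro far_comm) auto
    then show ?thesis using False Suc by (simp add: jm.simps(2) s_smul)
  qed simp
qed simp

lemma jm_comm_below: "1 \<le> j \<Longrightarrow> j + 2 \<le> k \<Longrightarrow> k \<le> N \<Longrightarrow> jm k (s j v) = s j (jm k v)"
proof (induction k arbitrary: v)
  case (Suc k)
  show ?case
  proof (cases "Suc k = j + 2")
    \<comment> \<open>Here \<open>s j\<close> is not far from the outer factors. Two levels of
      \<open>jm\<close> are unfolded; \<open>s j\<close> passes by one braid relation on each side,
      and the innermost \<open>jm j\<close> commutes with \<open>s (Suc j)\<close>.\<close>
    case True
    have E: "jm (Suc k) w = ((1 / t) * (1 / t)) *s s (Suc j) (s j (jm j (s j (s (Suc j) w))))" for w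
      using True Suc.prems by (simp add: jm.simps(2) s_smul)
    have B: "s j (s (Suc j) (s j w)) = s (Suc j) (s j (s (Suc j) w))" for w
      using Suc.prems True by (intro braid) auto
    have C: "jm j (s (Suc j) w) = s (Suc j) (jm j w)" for w
      using Suc.prems True by (intro jm_comm_above) auto
    show ?thesis unfolding E s_smul by (simp add: B C)
  next
    case False
    have "s k (s j w) = s j (s k w)" for w
      using Suc.prems False by (intro far_comm[symmetric]) auto
    then show ?thesis using False Suc by (simp add: jm.simps(2) s_smul)
  qed
qed simp

section \<open>Powers of \<open>t\<close> and intertwiners\<close>

lemma powi_inj: "t powi i = t powi j \<longleftrightarrow> i = j"
proof -
  have "i = j" if "t powi i = t powi j" "i \<le> j" for i j
  proof (rule ccontr)
    assume "i \<noteq> j"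
    have "t powi (j - i) = 1" using that t_nonzero by (simp add: power_int_diff)
    then have "t ^ nat (j - i) = 1" using \<open>i \<le> j\<close>
      by (simp add: power_int_def)
    then show False using t_not_root[of "nat (j - i)"] \<open>i \<noteq> j\<close> \<open>i \<le> j\<close> by auto
  qed
  then show ?thesis by (metis linear)
qed

lemma t_ne_1: "t \<noteq> 1" and t_ne_m1: "1 + t \<noteq> 0"
proof -
  show "t \<noteq> 1" using t_not_root[of 1] by simp
  have "t ^ 2 \<noteq> 1" using t_not_root[of 2] by simp
  then show "1 + t \<noteq> 0"
    by (metis add.commute add_diff_cancel_left' diff_0 power2_minus power_one)
qed

text \<open>Solve \<open>jm (Suc k) v = t^(-1) s_k jm_k s_k v\<close> for the inner term, using
  \<open>t s_k^(-1) = s_k + 1 - t\<close>. The error term \<open>z\<close> serves generalized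
  eigenvectors.\<close>

lemma jm_s:
  assumes "1 \<le> k" "jm (Suc k) v = y *s v + z"
  shows "jm k (s k v) = y *s (s k v + (1 - t) *s v) + s k z + (1 - t) *s z"
proof -
  let ?w = "jm k (s k v)"
  have "s k ?w = t *s (y *s v + z)"
    using assms jm_Suc[OF assms(1), of v] t_nonzero by (metis nonzero_eq_divide_eq scale_one scale_scale mult.commute times_divide_eq_left)
  then have "s k (s k ?w) = (t * y) *s s k v + t *s s k z"
    by (simp add: lin scale_right_distrib)
  moreover have "s k (s k ?w) = (t - 1) *s (t *s (y *s v + z)) + t *s ?w"
    using s_quad[of k ?w] \<open>s k ?w = t *s (y *s v + z)\<close> by simp
  ultimately have "t *s ?w = (t * y) *s s k v + t *s s k z - (t - 1) *s (t *s (y *s v + z))"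
    by (simp add: algebra_simps)
  also have "\<dots> = t *s (y *s (s k v + (1 - t) *s v) + s k z + (1 - t) *s z)"
    by (simp add: scale_right_distrib scale_left_distrib algebra_simps)
  finally show ?thesis using t_nonzero by simp
qed

text \<open>By \<open>jm_s\<close>, \<open>jm k (s k v)\<close> is
  \<open>y (s k v + (1 - t) v)\<close>; adding \<open>c v\<close> gives an eigenvector for
  \<open>y\<close> when \<open>y (1 - t) + c x = y c\<close>, which fixes \<open>c\<close>.\<close>

lemma jm_intertwine:
  assumes "1 \<le> k" "jm k v = x *s v" "jm (Suc k) v = y *s v" "x \<noteq> y" "c = (1 - t) * y / (y - x)"
  shows "jm k (s k v + c *s v) = y *s (s k v + c *s v)"
    and "jm (Suc k) (s k v + c *s v) = x *s (s k v + c *s v)"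
proof -
  have c: "y * (1 - t) + c * x = y * c" using assms(4,5) by (simp add: field_simps)
  have 1: "jm k (s k v) = y *s (s k v + (1 - t) *s v)"
    using jm_s[OF assms(1), of v y 0] assms(3) s_smul[of k 0 0] by simp
  then have "jm k (s k v + c *s v) = y *s s k v + (y * (1 - t) + c * x) *s v"
    by (simp add: lin assms(2) scale_right_distrib scale_left_distrib)
  then show "jm k (s k v + c *s v) = y *s (s k v + c *s v)"
    by (simp only: c scale_right_distrib scale_scale)
  have "s k (jm k (s k (s k v))) = s k ((t - 1) *s jm k (s k v) + (t * x) *s v)"
    by (simp add: s_quad[of k v] lin assms(2))
  also have "\<dots> = (t - 1) *s (y *s (s k (s k v) + (1 - t) *s s k v)) + (t * x) *s s k v"
    by (simp add: lin 1)
  also have "\<dots> = t *s (((t - 1) * y) *s v + x *s s k v)"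
    by (simp add: s_quad[of k v] scale_right_distrib scale_left_distrib scale_left_diff_distrib
        scale_right_diff_distrib algebra_simps)
  finally have "jm (Suc k) (s k v) = ((t - 1) * y) *s v + x *s s k v"
    using jm_Suc[OF assms(1)] t_nonzero by simp
  then have "jm (Suc k) (s k v + c *s v) = x *s s k v + ((t - 1) * y + c * y) *s v"
    by (simp add: lin assms(3) scale_right_distrib scale_left_distrib algebra_simps)
  also have "(t - 1) * y + c * y = x * c" using c by (simp add: algebra_simps)
  finally show "jm (Suc k) (s k v + c *s v) = x *s (s k v + c *s v)"
    by (simp only: scale_right_distrib scale_scale)
qed

text \<open>\<open>1 - t - c\<close> is the intertwiner coefficient with \<open>x\<close> and
  \<open>y\<close> exchanged, so this is the product of two opposite intertwiners. The scalar
  vanishes only for \<open>x = t y\<close> or \<open>y = t x\<close>, that is, for contents at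
  distance 1.\<close>

lemma intertwine_inverse:
  assumes "x \<noteq> y" "c = (1 - t) * y / (y - x)"
  shows "s k (s k v + c *s v) + (1 - t - c) *s (s k v + c *s v)
    = ((t * y - x) * (y - t * x) / (y - x)\<^sup>2) *s v"
proof -
  have "s k (s k v + c *s v) + (1 - t - c) *s (s k v + c *s v) = (t + (1 - t - c) * c) *s v"
    by (simp add: s_quad[of k v] lin scale_right_distrib scale_left_distrib scale_left_diff_distrib
        scale_right_diff_distrib algebra_simps)
  also have "t + (1 - t - c) * c = (t * y - x) * (y - t * x) / (y - x)\<^sup>2"
  proof -
    have c: "c * (y - x) = (1 - t) * y" using assms by simp
    have "(t + (1 - t - c) * c) * (y - x)\<^sup>2
        = t * (y - x)\<^sup>2 + ((1 - t) * (y - x) - c * (y - x)) * (c * (y - x))"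
      by (simp add: algebra_simps power2_eq_square)
    also have "\<dots> = (t * y - x) * (y - t * x)"
      unfolding c by (simp add: algebra_simps power2_eq_square)
    finally show ?thesis using assms(1) by (simp add: eq_divide_eq)
  qed
  finally show ?thesis .
qed

definition jm_vector :: "nat \<Rightarrow> (nat \<Rightarrow> int) \<Rightarrow> 'v \<Rightarrow> bool" where
  "jm_vector n b v \<longleftrightarrow> v \<noteq> 0 \<and> n \<le> N \<and> (\<forall>j\<in>{1..n}. jm j v = (t powi b j) *s v)"

lemma jm_vectorD:
  "jm_vector n b v \<Longrightarrow> 1 \<le> j \<Longrightarrow> j \<le> n \<Longrightarrow> jm j v = (t powi b j) *s v"
  "jm_vector n b v \<Longrightarrow> v \<noteq> 0" "jm_vector n b v \<Longrightarrow> n \<le> N"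
  by (auto simp: jm_vector_def)

lemma jm_vector_mono: "jm_vector n b v \<Longrightarrow> n' \<le> n \<Longrightarrow> jm_vector n' b v"
  by (auto simp: jm_vector_def)

definition swap_coeff :: "int \<Rightarrow> int \<Rightarrow> 'k" where
  "swap_coeff x y = (1 - t) * t powi y / (t powi y - t powi x)"

lemma jm_vector_swap:
  assumes v: "jm_vector n b v" and k: "1 \<le> k" "k < n" and ne: "b k \<noteq> b (Suc k)"
    and nz: "s k v + swap_coeff (b k) (b (Suc k)) *s v \<noteq> 0"
  shows "jm_vector n (b \<circ> transpose k (Suc k)) (s k v + swap_coeff (b k) (b (Suc k)) *s v)"
proof -
  let ?c = "swap_coeff (b k) (b (Suc k))" let ?v = "s k v + ?c *s v"
  have "jm j ?v = t powi (b \<circ> transpose k (Suc k)) j *s ?v" if "j \<in> {1..n}" for j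
  proof -
    consider "j = k" | "j = Suc k" | "j < k" | "k + 2 \<le> j" by linarith
    then show ?thesis
    proof cases
      case 1
      then show ?thesis
        using jm_intertwine(1)[OF k(1) jm_vectorD(1)[OF v] jm_vectorD(1)[OF v], of ?c] k ne
        by (simp add: powi_inj swap_coeff_def)
    next
      case 2
      then show ?thesis
        using jm_intertwine(2)[OF k(1) jm_vectorD(1)[OF v] jm_vectorD(1)[OF v], of ?c] k ne
        by (simp add: powi_inj swap_coeff_def)
    next
      case 3
      then have "jm j (s k v) = s k (jm j v)"
        using k that jm_vectorD(3)[OF v] by (intro jm_comm_above) auto
      then show ?thesis
        using 3 that jm_vectorD(1)[OF v, of j]
        by (simp add: lin scale_right_distrib transpose_def mult.commute)
    next
      case 4
      then have "jm j (s k v) = s k (jm j v)"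
        using k that jm_vectorD(3)[OF v] by (intro jm_comm_below) auto
      then show ?thesis
        using 4 that jm_vectorD(1)[OF v, of j]
        by (simp add: lin scale_right_distrib transpose_def mult.commute)
    qed
  qed
  then show ?thesis using nz v by (auto simp: jm_vector_def)
qed

lemma swap_nonzero:
  assumes "v \<noteq> 0" "2 \<le> \<bar>x - y\<bar>"
  shows "s k v + swap_coeff x y *s v \<noteq> 0"
proof
  assume 0: "s k v + swap_coeff x y *s v = 0"
  have ne: "t powi x \<noteq> t powi y" using assms by (auto simp: powi_inj)
  have "((t * t powi y - t powi x) * (t powi y - t * t powi x) / (t powi y - t powi x)\<^sup>2) *s v = 0"
    using intertwine_inverse[OF ne, of "swap_coeff x y" k v] 0 s_smul[of k 0 0]
    by (simp add: swap_coeff_def)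
  moreover have "t * t powi y = t powi (y + 1)" "t * t powi x = t powi (x + 1)"
    using t_nonzero by (simp_all add: power_int_add)
  ultimately show False using assms ne by (auto simp: powi_inj)
qed

lemma swap_coeff_adjacent: "swap_coeff x (x + 1) = - t" "swap_coeff x (x - 1) = 1"
  using t_nonzero t_ne_1 by (auto simp: swap_coeff_def power_int_add power_int_diff field_simps)

text \<open>A nonzero intertwined vector would carry \<open>b\<close> with positions
  \<open>k\<close> and \<open>Suc k\<close> exchanged. Cut at length \<open>k\<close>, it and
  \<open>v\<close> would give content vectors that agree before \<open>k\<close> and have adjacent
  contents at \<open>k\<close>.\<close>

lemma swap_adjacent_zero:
  assumes P: "\<And>b v. jm_vector k b v \<Longrightarrow> content_vector k b"
    and v: "jm_vector (Suc k) b v" and k: "1 \<le> k" and adj: "\<bar>b k - b (Suc k)\<bar> = 1"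
  shows "s k v + swap_coeff (b k) (b (Suc k)) *s v = 0"
proof (rule ccontr)
  let ?b = "b \<circ> transpose k (Suc k)"
  assume "s k v + swap_coeff (b k) (b (Suc k)) *s v \<noteq> 0"
  from jm_vector_swap[OF v k _ _ this] adj
  have "jm_vector (Suc k) ?b (s k v + swap_coeff (b k) (b (Suc k)) *s v)" by auto
  then have "content_vector k ?b" using P jm_vector_mono by (metis le_SucI le_refl)
  moreover have "content_vector k b" using P[OF jm_vector_mono[OF v]] by auto
  moreover have "?b j = b j" if "j < k" for j using that by (simp add: transpose_def)
  moreover have "?b k = b (Suc k)" by simp
  ultimately show False
    using content_vector_extensions_not_adjacent[of k b ?b]
      content_vector_extensions_not_adjacent[of k ?b b] k adj
    by (smt (verit, best))
qed

text \<open>A vanishing intertwined vector reads \<open>s k v = - c v\<close>, and the coefficient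
  \<open>c\<close> is \<open>- t\<close> or \<open>1\<close>. The hypothesis on content vectors
  makes this usable inside the induction; \<open>adjacent_jm_eigen\<close> is the unconditional
  form.\<close>

lemma adjacent_eigen:
  assumes "\<And>b v. jm_vector k b v \<Longrightarrow> content_vector k b"
    and "jm_vector (Suc k) b v" and "1 \<le> k"
  shows "b (Suc k) = b k + 1 \<Longrightarrow> s k v = t *s v" and "b (Suc k) = b k - 1 \<Longrightarrow> s k v = - v"
proof -
  show "s k v = t *s v" if "b (Suc k) = b k + 1"
    using swap_adjacent_zero[OF assms] that by (simp add: swap_coeff_adjacent)
  show "s k v = - v" if "b (Suc k) = b k - 1"
    using swap_adjacent_zero[OF assms] that by (simp add: swap_coeff_adjacent eq_neg_iff_add_eq_0)
qed

section \<open>Jordan blocks and forbidden content patterns\<close>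

lemma s_uminus: "s k (- v) = - s k v" and s_diff: "s k (v - w) = s k v - s k w"
  using s_smul[of k "-1" v] s_smul[of k "-1" w] s_add[of k v "- w"] by simp_all

text \<open>On the span of \<open>v\<close> and \<open>w\<close>, \<open>s k\<close> is the root
  \<open>- c\<close> of the quadratic relation plus a nilpotent map with coefficient
  \<open>- e\<close>. Inserting this into the relation leaves the derivative at the root times the
  nilpotent part.\<close>

lemma quad_jordan:
  assumes v: "s k v = - (c *s v)" and w: "s k w = - (c *s w) - e *s v"
    and c: "c * c = t - (t - 1) * c"
  shows "((2 * c + (t - 1)) * e) *s v = 0"
proof -
  have "s k (s k w) = (c * c) *s w + ((c * e) *s v + (c * e) *s v)"
    by (simp add: v w s_uminus s_diff lin scale_right_diff_distrib mult.commute)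
  moreover have "s k (s k w) = (c * c) *s w - ((t - 1) * e) *s v"
    unfolding s_quad[of k w] c
    by (simp add: w scale_left_diff_distrib scale_right_diff_distrib algebra_simps)
  ultimately have "(c * e) *s v + (c * e) *s v + ((t - 1) * e) *s v = 0" by (simp add: algebra_simps)
  moreover have "(2 * c + (t - 1)) * e = c * e + c * e + (t - 1) * e" by (simp add: algebra_simps)
  ultimately show ?thesis by (simp only: scale_left_distrib)
qed

text \<open>
  This replaces the semisimplicity of the Hecke algebra: the intertwiners would move a Jordan block
  down to \<^term>\<open>jm 1\<close>, which is the identity.
\<close>

lemma no_jordan_block:
  assumes P: "\<And>j b v. j \<le> k \<Longrightarrow> jm_vector j b v \<Longrightarrow> content_vector j b"
    and "jm_vector k b v" "1 \<le> k" "\<kappa> \<noteq> 0"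
    and "\<And>j. 1 \<le> j \<Longrightarrow> j < k \<Longrightarrow> jm j w = (t powi b j) *s w"
    and "jm k w = (t powi b k) *s w + \<kappa> *s v"
  shows False
  using assms
proof (induction k arbitrary: b v w)
  case (Suc k)
  note v = Suc.prems(2) and w = Suc.prems(5,6) and P = Suc.prems(1)
  show ?case
  proof (cases "k = 0")
    case True
    have "v = (t powi b 1) *s v" using jm_vectorD(1)[OF v, of 1] by simp
    then have "(1 - t powi b 1) *s v = 0" by (simp add: scale_left_diff_distrib)
    then have "t powi b 1 = 1" using jm_vectorD(2)[OF v] by simp
    then show False using w(2) True jm_vectorD(2)[OF v] Suc.prems(4) by simp
  next
    case False
    then have k: "1 \<le> k" by simp
    let ?x = "t powi b k" and ?y = "t powi b (Suc k)"
    let ?c = "swap_coeff (b k) (b (Suc k))"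
    \<comment> \<open>Forced by the wish \<open>jm k w1 = ?y w1 + \<kappa> v1\<close>: comparing
      coefficients of \<open>v\<close> gives
      \<open>(1 - t) \<kappa> + ?e ?x = \<kappa> ?c + ?y ?e\<close>.\<close>
    let ?e = "\<kappa> * (1 - t - ?c) / (?y - ?x)"
    define v1 where "v1 = s k v + ?c *s v"
    define w1 where "w1 = s k w + ?c *s w + ?e *s v"
    have Pk: "\<And>b v. jm_vector k b v \<Longrightarrow> content_vector k b" using P by auto
    have "content_vector (Suc k) b" using P v by blast
    then have ne: "b k \<noteq> b (Suc k)"
      using content_vectorD(3)[of "Suc k" b "Suc k" k] k by auto
    then have xy: "?x \<noteq> ?y" by (simp add: powi_inj)
    have c: "?y * (1 - t) + ?c * ?x = ?y * ?c"
      using xy by (simp add: swap_coeff_def field_simps)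
    have jv: "jm k v = ?x *s v" "jm (Suc k) v = ?y *s v"
      using jm_vectorD(1)[OF v] k by auto
    have jv1: "jm k v1 = ?y *s v1"
      unfolding v1_def using xy by (intro jm_intertwine(1)[OF k jv]) (auto simp: swap_coeff_def)
    have "jm k (s k w) = ?y *s (s k w + (1 - t) *s w) + \<kappa> *s s k v + (1 - t) *s \<kappa> *s v"
      using jm_s[OF k w(2)] by (simp add: lin)
    then have "jm k w1 = ?y *s s k w + (?y * (1 - t) + ?c * ?x) *s w
        + \<kappa> *s s k v + ((1 - t) * \<kappa> + ?e * ?x) *s v"
      using w(1)[of k] k by (simp add: w1_def lin jv scale_right_distrib scale_left_distrib)
    also have "(1 - t) * \<kappa> + ?e * ?x = \<kappa> * ?c + ?y * ?e"
      using xy by (simp add: divide_simps) (simp add: algebra_simps)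
    finally have jw1: "jm k w1 = ?y *s w1 + \<kappa> *s v1"
      unfolding c by (simp add: w1_def v1_def scale_right_distrib scale_left_distrib)
    have kN: "k < N" using jm_vectorD(3)[OF v] by simp
    have low: "jm j w1 = (t powi b j) *s w1" "jm j v1 = (t powi b j) *s v1" if "1 \<le> j" "j < k" for j
      using that w(1)[of j] jm_vectorD(1)[OF v, of j] kN
      by (simp_all add: v1_def w1_def lin jm_comm_above scale_right_distrib mult.commute)
    let ?b = "b(k := b (Suc k))"
    \<comment> \<open>For contents at distance at least 2 the block moves from
      \<open>jm (Suc k)\<close> down to \<open>jm k\<close>. For adjacent contents both
      \<open>v1\<close> and \<open>w1\<close> vanish, so \<open>s k\<close> itself has a Jordan
      block, which its distinct roots \<open>t\<close> and \<open>-1\<close> forbid.\<close>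
    show False
    proof (cases "2 \<le> \<bar>b k - b (Suc k)\<bar>")
      case True
      then have "v1 \<noteq> 0" unfolding v1_def using swap_nonzero jm_vectorD(2)[OF v] by simp
      then have v1: "jm_vector k ?b v1" using jv1 low kN by (auto simp: jm_vector_def)
      show False
        by (rule Suc.IH[OF _ v1 k Suc.prems(4), of w1]) (use P low jw1 in auto)
    next
      case False
      with ne have adj: "\<bar>b k - b (Suc k)\<bar> = 1" by linarith
      then have v1: "v1 = 0" unfolding v1_def using swap_adjacent_zero[OF Pk v k] by simp
      have "w1 = 0"
      proof (rule ccontr)
        assume "w1 \<noteq> 0"
        then have "jm_vector k ?b w1" using jw1 v1 low kN by (auto simp: jm_vector_def)
        from Pk[OF this] have "content_vector k ?b" .
        moreover have "content_vector k b" using Pk jm_vector_mono[OF v, of k] by simp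
        ultimately show False
          using content_vector_extensions_not_adjacent[of k b ?b]
            content_vector_extensions_not_adjacent[of k ?b b] k adj
          by (smt (verit, best) fun_upd_other fun_upd_same less_irrefl)
      qed
      then have sw: "s k w = - (?c *s w) - ?e *s v"
        by (simp add: w1_def add_eq_0_iff2 algebra_simps)
      have sv: "s k v = - (?c *s v)" using v1 by (simp add: v1_def eq_neg_iff_add_eq_0)
      have c: "?c = - t \<or> ?c = 1"
        using adj swap_coeff_adjacent[of "b k"] by (smt (verit))
      have "((2 * ?c + (t - 1)) * ?e) *s v = 0"
        using c by (intro quad_jordan[OF sv sw]) (auto simp: algebra_simps)
      moreover have "2 * ?c + (t - 1) \<noteq> 0" using c t_ne_m1
        by (auto simp: algebra_simps) (metis add.commute add_eq_0_iff neg_eq_iff_add_eq_0)+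
      moreover have "?e \<noteq> 0" using c xy Suc.prems(4) t_ne_m1 t_nonzero by auto
      ultimately show False using jm_vectorD(2)[OF v] by simp
    qed
  qed
qed simp

text \<open>With equal eigenvalues \<open>jm_s\<close> makes \<open>s k v\<close> a generalized
  eigenvector of \<open>jm k\<close> above \<open>v\<close>, with the nonzero off-diagonal
  coefficient \<open>t^(b k) (1 - t)\<close>.\<close>

lemma jm_vector_no_repeat:
  assumes P: "\<And>j b v. j \<le> k \<Longrightarrow> jm_vector j b v \<Longrightarrow> content_vector j b"
    and v: "jm_vector (Suc k) b v" and k: "1 \<le> k"
  shows "b k \<noteq> b (Suc k)"
proof
  assume eq: "b k = b (Suc k)"
  have kN: "k < N" using jm_vectorD(3)[OF v] by simp
  have top: "jm k (s k v) = (t powi b k) *s s k v + (t powi b k * (1 - t)) *s v"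
    using jm_s[OF k, of v "t powi b k" 0] jm_vectorD(1)[OF v, of "Suc k"] eq k s_smul[of k 0 0]
    by (simp add: scale_right_distrib)
  have low: "jm j (s k v) = (t powi b j) *s s k v" if "1 \<le> j" "j < k" for j
    using that jm_vectorD(1)[OF v, of j] kN by (simp add: jm_comm_above lin)
  have nz: "t powi b k * (1 - t) \<noteq> 0" using t_nonzero t_ne_1 by simp
  show False
    by (rule no_jordan_block[OF _ _ k nz low top]) (use P jm_vector_mono[OF v] in auto)
qed

text \<open>The pattern \<open>a, a + 1, a\<close> or \<open>a, a - 1, a\<close> makes
  \<open>s k\<close> and \<open>s (Suc k)\<close> act on \<open>v\<close> by the two different roots
  \<open>t\<close> and \<open>-1\<close>; the braid relation then says \<open>- t^2 = t\<close> on
  \<open>v\<close>.\<close>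

lemma jm_vector_no_aba:
  assumes P: "\<And>b v. jm_vector k b v \<Longrightarrow> content_vector k b"
      "\<And>b v. jm_vector (Suc k) b v \<Longrightarrow> content_vector (Suc k) b"
    and v: "jm_vector (Suc (Suc k)) b v" and k: "1 \<le> k"
    and eq: "b (Suc (Suc k)) = b k" and adj: "\<bar>b (Suc k) - b k\<bar> = 1"
  shows False
proof -
  note A = adjacent_eigen[OF P(1) jm_vector_mono[OF v] k]
    and B = adjacent_eigen[OF P(2) v]
  have N: "Suc k < N" using jm_vectorD(3)[OF v] by simp
  have "(t * (1 + t)) *s v = 0"
  proof (cases "b (Suc k) = b k + 1")
    case True
    have "s k v = t *s v" "s (Suc k) v = - v" using A(1) B(2) True eq by auto
    then have "- ((t * t) *s v) = t *s v"
      using braid[of k v] k N by (simp add: lin s_uminus)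
    then show ?thesis by (simp add: distrib_left scale_left_distrib) (metis add.left_inverse)
  next
    case False
    then have "b (Suc k) = b k - 1" using adj by linarith
    then have "s k v = - v" "s (Suc k) v = t *s v" using A(2) B(1) eq by auto
    then have "- ((t * t) *s v) = t *s v"
      using braid[of k v] k N by (simp add: lin s_uminus)
    then show ?thesis by (simp add: distrib_left scale_left_distrib) (metis add.left_inverse)
  qed
  then show False using t_nonzero t_ne_m1 jm_vectorD(2)[OF v] by simp
qed

text \<open>Passing a content at distance at least 2 uses an invertible intertwiner, so the vector
  stays nonzero; positions outside \<open>p\<close> to \<open>q\<close> are not touched.\<close>

lemma jm_vector_move_down:
  assumes "jm_vector n b v" "1 \<le> p" "p \<le> q" "q \<le> n"
    and "\<And>r. p \<le> r \<Longrightarrow> r < q \<Longrightarrow> 2 \<le> \<bar>b r - b q\<bar>"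
  shows "\<exists>b' v'. jm_vector n b' v' \<and> b' p = b q \<and> (\<forall>j<p. b' j = b j)"
  using assms
proof (induction "q - p" arbitrary: b v q)
  case (Suc d)
  then obtain q' where q: "q = Suc q'" by (metis diff_0_eq_0 nat.distinct(1) not0_implies_Suc)
  let ?b = "b \<circ> transpose q' (Suc q')"
  have "p \<le> q'" using Suc.hyps(2) q by simp
  then have far: "2 \<le> \<bar>b q' - b (Suc q')\<bar>" using Suc.prems(5)[of q'] q by simp
  then have ne: "b q' \<noteq> b (Suc q')" by auto
  have v': "jm_vector n ?b (s q' v + swap_coeff (b q') (b (Suc q')) *s v)"
    by (rule jm_vector_swap[OF Suc.prems(1) _ _ _ swap_nonzero[OF jm_vectorD(2)[OF Suc.prems(1)] far]])
      (use \<open>p \<le> q'\<close> ne Suc.prems(2-4) q in auto)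
  have far': "2 \<le> \<bar>?b r - ?b q'\<bar>" if "p \<le> r" "r < q'" for r
    using that Suc.prems(5)[of r] q by (simp add: transpose_def)
  have d: "d = q' - p" "q' \<le> n" using Suc.hyps(2) Suc.prems(4) q by auto
  obtain b' v' where "jm_vector n b' v'" "b' p = ?b q'" "\<forall>j<p. b' j = ?b j"
    using Suc.hyps(1)[OF d(1) v' Suc.prems(2) \<open>p \<le> q'\<close> d(2) far'] by auto
  moreover have "?b j = b j" if "j < p" for j
    using that \<open>p \<le> q'\<close> by (simp add: transpose_def)
  ultimately show ?case using q by auto
qed auto

lemma jm_vector_move_up:
  assumes "jm_vector n b v" "1 \<le> p" "p \<le> q" "q \<le> n"
    and "\<And>r. p < r \<Longrightarrow> r \<le> q \<Longrightarrow> 2 \<le> \<bar>b r - b p\<bar>"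
  shows "\<exists>b' v'. jm_vector n b' v' \<and> b' q = b p \<and> (\<forall>j>q. b' j = b j)"
  using assms
proof (induction "q - p" arbitrary: b v p)
  case (Suc d)
  let ?b = "b \<circ> transpose p (Suc p)"
  have "Suc p \<le> q" using Suc.hyps(2) by simp
  then have far: "2 \<le> \<bar>b p - b (Suc p)\<bar>"
    using Suc.prems(5)[of "Suc p"] by (simp add: abs_minus_commute)
  then have ne: "b p \<noteq> b (Suc p)" by auto
  have d: "d = q - Suc p" using Suc.hyps(2) by simp
  have v': "jm_vector n ?b (s p v + swap_coeff (b p) (b (Suc p)) *s v)"
    by (rule jm_vector_swap[OF Suc.prems(1) _ _ _ swap_nonzero[OF jm_vectorD(2)[OF Suc.prems(1)] far]])
      (use \<open>Suc p \<le> q\<close> ne Suc.prems(2-4) in auto)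
  have far': "2 \<le> \<bar>?b r - ?b (Suc p)\<bar>" if "Suc p < r" "r \<le> q" for r
    using that Suc.prems(5)[of r] by (simp add: transpose_def)
  obtain b' v' where "jm_vector n b' v'" "b' q = ?b (Suc p)" "\<forall>j>q. b' j = ?b j"
    using Suc.hyps(1)[OF d v' _ \<open>Suc p \<le> q\<close> Suc.prems(4) far'] by auto
  moreover have "?b j = b j" if "j > q" for j
    using that \<open>Suc p \<le> q\<close> by (simp add: transpose_def)
  ultimately show ?case by auto
qed auto

lemma content_vector_step:
  assumes P: "\<And>j b v. j < n \<Longrightarrow> jm_vector j b v \<Longrightarrow> content_vector j b"
    and v: "jm_vector n b v" and n: "1 < n"
  shows content_vector_step_repeat:
      "p \<in> {1..<n} \<Longrightarrow> b p = b n \<Longrightarrow> \<bar>\<sigma>\<bar> = 1 \<Longrightarrow> \<exists>r\<in>{p<..<n}. b r = b n - \<sigma>"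
    and content_vector_step_neighbour: "\<exists>p\<in>{1..<n}. \<bar>b p - b n\<bar> = 1"
proof -
  have C: "content_vector (n - 1) b" using P[of "n - 1" b v] jm_vector_mono[OF v] n by simp
  \<comment> \<open>If only distant contents separate \<open>p\<close> from \<open>n\<close>,
    \<open>b n\<close> can be moved to the position right after \<open>p\<close>, against
    \<open>jm_vector_no_repeat\<close>.\<close>
  have far: False if p: "p \<in> {1..<n}" "b p = b n" "\<And>r. r \<in> {p<..<n} \<Longrightarrow> 2 \<le> \<bar>b r - b n\<bar>" for p
  proof -
    obtain b' v' where *: "jm_vector n b' v'" "b' (Suc p) = b n" "\<forall>j<Suc p. b' j = b j"
      using jm_vector_move_down[OF v, of "Suc p" n] p by auto
    have "jm_vector (Suc p) b' v'" by (rule jm_vector_mono[OF *(1)]) (use p in auto)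
    from jm_vector_no_repeat[OF _ this] have "b' p \<noteq> b' (Suc p)" using P p by auto
    then show False using * p by simp
  qed
  \<comment> \<open>\<open>p\<close> is the last earlier occurrence of \<open>b n\<close>, and
    \<open>b n - \<sigma>\<close> is missing after it; the sign \<open>\<sigma>\<close> treats both
    neighbours at once. Then \<open>b n + \<sigma>\<close> occurs in between at most once, as two
    occurrences would enclose another \<open>b n\<close>.\<close>
  have last: False if p: "p \<in> {1..<n}" "b p = b n" and \<sigma>: "\<bar>\<sigma>\<bar> = 1"
    and max: "\<And>r. r \<in> {p<..<n} \<Longrightarrow> b r \<noteq> b n" and no: "\<And>r. r \<in> {p<..<n} \<Longrightarrow> b r \<noteq> b n - \<sigma>" for p \<sigma>
  proof (cases "\<exists>r\<in>{p<..<n}. b r = b n + \<sigma>")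
    case False
    have "2 \<le> \<bar>b r - b n\<bar>" if "r \<in> {p<..<n}" for r
      using max[OF that] no[OF that] False that \<sigma> by (smt (verit, best))
    then show False using far[OF p] by blast
  next
    case True
    then obtain r where r: "r \<in> {p<..<n}" "b r = b n + \<sigma>" by blast
    have uniq: False if "x \<in> {p<..<n}" "y \<in> {p<..<n}" "x < y" "b x = b n + \<sigma>" "b y = b n + \<sigma>" for x y
    proof -
      have "\<exists>r\<in>{x<..<y}. b r = b n"
      proof (cases "\<sigma> = 1")
        case True
        then show ?thesis using content_vectorD(4)[OF C, of y x] that p by auto
      next
        case False
        then have "\<sigma> = - 1" using \<sigma> by linarith
        then show ?thesis using content_vectorD(3)[OF C, of y x] that p by auto
      qed
      then show False using max that by force
    qed
    have other: "2 \<le> \<bar>b x - b n\<bar>" if "x \<in> {p<..<n}" "x \<noteq> r" for x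
      using max[OF that(1)] no[OF that(1)] uniq[of x r] uniq[of r x] r that \<sigma>
      by (smt (verit, best) nat_neq_iff)
    \<comment> \<open>Apart from position \<open>r\<close>, everything between \<open>p\<close> and
      \<open>n\<close> is distant from \<open>b n\<close>, so both copies of this content can be
      moved next to \<open>r\<close>; positions \<open>r - 1, r, r + 1\<close> then show the pattern
      excluded by \<open>jm_vector_no_aba\<close>.\<close>
    obtain b1 v1 where b1: "jm_vector n b1 v1" "b1 (Suc r) = b n" "\<forall>j<Suc r. b1 j = b j"
      using jm_vector_move_down[OF v, of "Suc r" n] r other by auto
    obtain k where k: "r = Suc k" using r by (cases r) auto
    obtain b2 v2 where b2: "jm_vector n b2 v2" "b2 k = b1 p" "\<forall>j>k. b2 j = b1 j"
      using jm_vector_move_up[OF b1(1), of p k] r other p b1(3) k by auto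
    have "jm_vector (Suc (Suc k)) b2 v2" by (rule jm_vector_mono[OF b2(1)]) (use r k in auto)
    from jm_vector_no_aba[OF _ _ this] show False
      using P p r k b1 b2 \<sigma> by auto
  qed
  have ex_last: "\<exists>p'\<ge>p. p' \<in> {1..<n} \<and> b p' = b n \<and> (\<forall>r\<in>{p'<..<n}. b r \<noteq> b n)"
    if "p \<in> {1..<n}" "b p = b n" for p
  proof -
    define m where "m = Max {p' \<in> {p..<n}. b p' = b n}"
    have "m \<in> {p' \<in> {p..<n}. b p' = b n}" unfolding m_def using that by (intro Max_in) auto
    then have m: "p \<le> m" "m \<in> {1..<n}" "b m = b n" using that(1) by auto
    moreover have "b r \<noteq> b n" if "r \<in> {m<..<n}" for r
    proof
      assume "b r = b n"
      then have "r \<le> m" unfolding m_def using that m by (intro Max_ge) auto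
      then show False using that by simp
    qed
    ultimately show ?thesis by blast
  qed
  show "\<exists>r\<in>{p<..<n}. b r = b n - \<sigma>" if p: "p \<in> {1..<n}" "b p = b n" and "\<bar>\<sigma>\<bar> = 1"
  proof (rule ccontr)
    assume no: "\<not> ?thesis"
    obtain p' where "p' \<ge> p" "p' \<in> {1..<n}" "b p' = b n" "\<forall>r\<in>{p'<..<n}. b r \<noteq> b n"
      using ex_last[OF p] by blast
    then show False using last[of p' \<sigma>] \<open>\<bar>\<sigma>\<bar> = 1\<close> no by auto
  qed
  show "\<exists>p\<in>{1..<n}. \<bar>b p - b n\<bar> = 1"
  proof (rule ccontr)
    assume no: "\<not> ?thesis"
    show False
    proof (cases "\<exists>p\<in>{1..<n}. b p = b n")
      case True
      then obtain p where p: "p \<in> {1..<n}" "b p = b n" "\<forall>r\<in>{p<..<n}. b r \<noteq> b n"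
        using ex_last by blast
      have "2 \<le> \<bar>b r - b n\<bar>" if "r \<in> {p<..<n}" for r
        using p no that by (smt (verit, best) atLeastLessThan_iff greaterThanLessThan_iff less_imp_le order_trans)
      then show False using far p by blast
    next
      \<comment> \<open>With neither equal nor neighbouring contents before it, \<open>b n\<close>
        can travel to position 1, where it must be 0; but \<open>b 1\<close> is 0 already.\<close>
      case False
      then have "2 \<le> \<bar>b r - b n\<bar>" if "1 \<le> r" "r < n" for r
        using no that by (smt (verit, best) atLeastLessThan_iff)
      then obtain b' v' where b': "jm_vector n b' v'" "b' 1 = b n"
        using jm_vector_move_down[OF v, of 1 n] n by auto
      have "content_vector 1 b'" using P[OF n jm_vector_mono[OF b'(1)]] n by simp
      then have "b n = 0" using content_vectorD(1)[of 1 b' 1] b' by simp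
      moreover have "b 1 = 0" using content_vectorD(1)[OF C, of 1] n by auto
      ultimately show False using False n by auto
    qed
  qed
qed

lemma jm_vector_content_vector: "jm_vector n b v \<Longrightarrow> content_vector n b"
proof (induction n arbitrary: b v rule: less_induct)
  case (less n)
  consider "n = 0" | "n = 1" | "1 < n" by linarith
  then show ?case
  proof cases
    case 1
    then show ?thesis by (simp add: content_vector_def)
  next
    case 2
    have "v = (t powi b 1) *s v" using jm_vectorD(1)[OF less.prems, of 1] 2 by simp
    then have "(1 - t powi b 1) *s v = 0" by (simp add: scale_left_diff_distrib)
    then have "t powi b 1 = t powi 0" using jm_vectorD(2)[OF less.prems] by simp
    then show ?thesis using 2 by (auto simp: content_vector_def powi_inj simp del: power_int_0_right)
  next
    case 3
    note IH = less.IH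
    have C: "content_vector (n - 1) b" using IH[of "n - 1" b v] jm_vector_mono[OF less.prems] 3 by simp
    show ?thesis unfolding content_vector_def
    proof
      fix q assume q: "q \<in> {1..n}"
      show "(q = 1 \<longrightarrow> b q = 0) \<and> (q > 1 \<longrightarrow> (\<exists>p\<in>{1..<q}. \<bar>b p - b q\<bar> = 1)) \<and>
         (\<forall>p\<in>{1..<q}. b p = b q \<longrightarrow>
            (\<exists>r\<in>{p<..<q}. b r = b q + 1) \<and> (\<exists>r\<in>{p<..<q}. b r = b q - 1))"
      proof (cases "q = n")
        case True
        then show ?thesis
          using content_vector_step_neighbour[OF IH less.prems 3]
            content_vector_step_repeat[OF IH less.prems 3, where \<sigma> = 1]
            content_vector_step_repeat[OF IH less.prems 3, where \<sigma> = "-1"] 3 by auto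
      next
        case False
        then have "q \<in> {1..n - 1}" using q by auto
        then show ?thesis using C unfolding content_vector_def by blast
      qed
    qed
  qed
qed

lemma adjacent_jm_eigen:
  assumes "jm_vector (Suc k) b v" "1 \<le> k"
  shows "b (Suc k) = b k + 1 \<Longrightarrow> s k v = t *s v" and "b (Suc k) = b k - 1 \<Longrightarrow> s k v = - v"
  using adjacent_eigen[OF _ assms] jm_vector_content_vector by blast+

section \<open>Linear independence of Jucys-Murphy eigenvectors\<close>

lemma jm_vector_smul: "jm_vector n b v \<Longrightarrow> a \<noteq> 0 \<Longrightarrow> jm_vector n b (a *s v)"
  by (simp add: jm_vector_def jm_smul mult.commute)

lemma jm_vector_cong: "jm_vector n b v \<Longrightarrow> (\<And>j. 1 \<le> j \<Longrightarrow> j \<le> n \<Longrightarrow> b' j = b j) \<Longrightarrow> jm_vector n b' v"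
  by (simp add: jm_vector_def)

lemma jm_sum: "finite A \<Longrightarrow> jm j (\<Sum>x\<in>A. f x) = (\<Sum>x\<in>A. jm j (f x))"
proof (induction A rule: finite_induct)
  case empty
  show ?case using jm_smul[of j 0 0] by simp
qed (simp add: jm_add)

text \<open>Applying \<open>jm j - t^(b S0 j)\<close> for a position \<open>j\<close> where
  \<open>S\<close> and \<open>S0\<close> differ removes the term of \<open>S0\<close> from the
  relation, and induction applies to the rest.\<close>

lemma jm_vectors_independent_family:
  assumes "finite F" "\<And>S. S \<in> F \<Longrightarrow> jm_vector N (b S) (g S)"
    and "\<And>S S'. S \<in> F \<Longrightarrow> S' \<in> F \<Longrightarrow> S \<noteq> S' \<Longrightarrow> \<exists>j\<in>{1..N}. b S j \<noteq> b S' j"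
    and "(\<Sum>S\<in>F. c S *s g S) = 0" "S \<in> F"
  shows "c S = 0"
  using assms
proof (induction F arbitrary: c S rule: finite_induct)
  case (insert S0 F)
  have F: "c S = 0" if S: "S \<in> F" for S
  proof -
    have "S \<noteq> S0" using insert.hyps(2) S by auto
    then obtain j where j: "j \<in> {1..N}" "b S j \<noteq> b S0 j"
      using insert.prems(2)[of S S0] S by auto
    have e: "jm j (g S') = (t powi b S' j) *s g S'" if "S' \<in> insert S0 F" for S'
      using jm_vectorD(1)[OF insert.prems(1)[OF that]] j by auto
    have "0 = jm j (\<Sum>S'\<in>insert S0 F. c S' *s g S') - (t powi b S0 j) *s (\<Sum>S'\<in>insert S0 F. c S' *s g S')"
      using insert.prems(3) jm_smul[of j 0 0] by simp
    also have "\<dots> = (\<Sum>S'\<in>insert S0 F. (c S' * (t powi b S' j - t powi b S0 j)) *s g S')"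
      using insert.hyps(1)
      by (simp only: jm_sum finite_insert scale_sum_right jm_smul e sum_subtractf[symmetric] scale_scale
          scale_left_diff_distrib[symmetric] right_diff_distrib mult.commute cong: sum.cong)
    also have "\<dots> = (\<Sum>S'\<in>F. (c S' * (t powi b S' j - t powi b S0 j)) *s g S')"
      using insert.hyps by simp
    finally have "c S * (t powi b S j - t powi b S0 j) = 0"
      using insert.IH[of "\<lambda>S'. c S' * (t powi b S' j - t powi b S0 j)" S] insert.prems(1,2) S by simp
    then show ?thesis using j(2) by (simp add: powi_inj)
  qed
  then have "c S0 *s g S0 = 0" using insert.prems(3) insert.hyps by simp
  then have "c S0 = 0" using jm_vectorD(2)[OF insert.prems(1)] by simp
  then show ?case using F insert.prems(4) by auto
qed simp

lemma jm_vectors_independent: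
  assumes "\<And>S. S \<in> A \<Longrightarrow> jm_vector N (b S) (g S)"
    and "\<And>S S'. S \<in> A \<Longrightarrow> S' \<in> A \<Longrightarrow> S \<noteq> S' \<Longrightarrow> \<exists>j\<in>{1..N}. b S j \<noteq> b S' j"
  shows "inj_on g A" "independent (g ` A)"
proof -
  show inj: "inj_on g A"
  proof (rule inj_onI, rule ccontr)
    fix S S' assume *: "S \<in> A" "S' \<in> A" "g S = g S'" "S \<noteq> S'"
    then obtain j where j: "j \<in> {1..N}" "b S j \<noteq> b S' j" using assms(2) by blast
    have "t powi b S j = t powi b S' j"
      using jm_vectorD(2)[OF assms(1)[OF *(1)]] jm_vectorD(1)[OF assms(1)[OF *(1)], of j] jm_vectorD(1)[OF assms(1)[OF *(2)], of j] j * by auto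
    then show False using j(2) by (simp add: powi_inj)
  qed
  show "independent (g ` A)"
    unfolding independent_explicit_finite_subsets
  proof (intro allI impI ballI)
    fix B u v assume B: "B \<subseteq> g ` A" "finite B" "(\<Sum>v\<in>B. u v *s v) = 0" "v \<in> B"
    then obtain F where F: "F \<subseteq> A" "finite F" "B = g ` F"
      by (meson finite_subset_image)
    then have sum: "(\<Sum>S\<in>F. (u \<circ> g) S *s g S) = 0"
      using B(3) inj by (simp add: sum.reindex inj_on_subset)
    obtain S where S: "S \<in> F" "v = g S" using B F by auto
    have "(u \<circ> g) S = 0"
      by (rule jm_vectors_independent_family[OF F(2) _ _ sum S(1), of b]) (use F(1) assms in blast)+
    then show "u v = 0" using S by simp
  qed
qed

end

section \<open>Polynomials\<close>

lemma scale_simps: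
  "scale c (p + q) = scale c p + scale c q" "scale (c + d) p = scale c p + scale d p"
  "scale c (scale d p) = scale (c * d) p" "scale 1 p = p" "scale 0 p = 0" "scale c 0 = 0"
  "scale c p * q = scale c (p * q)" "p * scale c q = scale c (p * q)"
  by (simp_all add: scale_def const_def single_add algebra_simps mult_single flip: mult.assoc)

lemma scale_sum: "scale c (\<Sum>x\<in>A. p x) = (\<Sum>x\<in>A. scale c (p x))"
  by (simp add: scale_def sum_distrib_left)

lemma scale_single: "scale c (Poly_Mapping.single e d) = Poly_Mapping.single e (c * d)"
  by (simp add: scale_def const_def mult_single)

lemma lookup_scale: "Poly_Mapping.lookup (scale c p) e = c * Poly_Mapping.lookup p e"
  unfolding scale_def const_def mult_map_scale_conv_mult[symmetric]
  by (simp add: Poly_Mapping.map.rep_eq when_def)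

lemma poly_mapping_sum_single:
  assumes "finite A" "Poly_Mapping.keys p \<subseteq> A"
  shows "p = (\<Sum>e\<in>A. Poly_Mapping.single e (Poly_Mapping.lookup p e))"
proof (rule poly_mapping_eqI)
  fix e
  have "(\<Sum>x\<in>A. Poly_Mapping.lookup p x when x = e) = Poly_Mapping.lookup p e"
    using assms by (cases "e \<in> A") (auto simp: when_def sum.delta in_keys_iff)
  then show "Poly_Mapping.lookup p e
      = Poly_Mapping.lookup (\<Sum>e\<in>A. Poly_Mapping.single e (Poly_Mapping.lookup p e)) e"
    by (simp add: lookup_sum lookup_single)
qed

lemma mpol_mult_sum:
  fixes p q :: "'a::comm_ring_1 mpol"
  assumes "finite A" "Poly_Mapping.keys p \<subseteq> A" "finite B" "Poly_Mapping.keys q \<subseteq> B"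
  shows "p * q = (\<Sum>e\<in>A. \<Sum>e'\<in>B.
    Poly_Mapping.single (e + e') (Poly_Mapping.lookup p e * Poly_Mapping.lookup q e'))"
proof -
  have "p * q = (\<Sum>e\<in>A. Poly_Mapping.single e (Poly_Mapping.lookup p e)) *
      (\<Sum>e'\<in>B. Poly_Mapping.single e' (Poly_Mapping.lookup q e'))"
    using poly_mapping_sum_single[OF assms(1,2)] poly_mapping_sum_single[OF assms(3,4)] by simp
  then show ?thesis by (simp add: sum_product mult_single)
qed

definition power_prod :: "(nat \<Rightarrow> 'a::comm_ring_1 mpol) \<Rightarrow> composition \<Rightarrow> 'a mpol" where
  "power_prod f e = (\<Prod>k\<in>Poly_Mapping.keys e. f k ^ Poly_Mapping.lookup e k)"

lemma power_prod_superset: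
  "finite A \<Longrightarrow> Poly_Mapping.keys e \<subseteq> A \<Longrightarrow>
    power_prod f e = (\<Prod>k\<in>A. f k ^ Poly_Mapping.lookup e k)"
  unfolding power_prod_def by (rule prod.mono_neutral_left) (auto simp: in_keys_iff)

lemma power_prod_add: "power_prod f (e + e') = power_prod f e * power_prod f e'"
proof -
  let ?A = "Poly_Mapping.keys e \<union> Poly_Mapping.keys e'"
  have "power_prod f (e + e') = (\<Prod>k\<in>?A. f k ^ Poly_Mapping.lookup (e + e') k)"
    by (intro power_prod_superset Poly_Mapping.keys_add) auto
  also have "\<dots> = (\<Prod>k\<in>?A. f k ^ Poly_Mapping.lookup e k) * (\<Prod>k\<in>?A. f k ^ Poly_Mapping.lookup e' k)"
    by (simp add: lookup_add power_add prod.distrib)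
  also have "\<dots> = power_prod f e * power_prod f e'"
    by (simp flip: power_prod_superset)
  finally show ?thesis .
qed

lemma subst_superset:
  assumes "finite A" "Poly_Mapping.keys p \<subseteq> A"
  shows "subst f p = (\<Sum>e\<in>A. scale (Poly_Mapping.lookup p e) (power_prod f e))"
  unfolding subst_def power_prod_def[symmetric] using assms
  by (intro sum.mono_neutral_left) (auto simp: in_keys_iff scale_simps)

lemma subst_single: "subst f (Poly_Mapping.single e c) = scale c (power_prod f e)"
  by (subst subst_superset[of "{e}"]) auto

lemma subst_zero [simp]: "subst f 0 = 0"
  by (simp add: subst_def)

lemma subst_add: "subst f (p + q) = subst f p + subst f q"
proof -
  let ?A = "Poly_Mapping.keys p \<union> Poly_Mapping.keys q"
  have "subst f (p + q) = (\<Sum>e\<in>?A. scale (Poly_Mapping.lookup (p + q) e) (power_prod f e))"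
    by (intro subst_superset Poly_Mapping.keys_add) auto
  then show ?thesis
    by (simp add: lookup_add scale_simps sum.distrib subst_superset[of ?A])
qed

lemma subst_sum: "subst f (\<Sum>x\<in>A. p x) = (\<Sum>x\<in>A. subst f (p x))"
  by (induction A rule: infinite_finite_induct) (simp_all add: subst_add)

lemma subst_scale: "subst f (scale c p) = scale c (subst f p)"
proof -
  have "Poly_Mapping.keys (scale c p) \<subseteq> Poly_Mapping.keys p"
    by (auto simp: in_keys_iff lookup_scale)
  then show ?thesis
    by (subst (1 2) subst_superset[of "Poly_Mapping.keys p"])
      (simp_all add: lookup_scale scale_sum scale_simps)
qed

lemma subst_uminus: "subst f (- p) = - subst f p"
  by (metis add.right_inverse add_eq_0_iff subst_add subst_zero)

lemma subst_diff: "subst f (p - q) = subst f p - subst f q"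
  by (simp add: subst_add subst_uminus flip: add_uminus_conv_diff)

lemma subst_mult: "subst f (p * q) = subst f p * subst f q"
  unfolding mpol_mult_sum[OF finite_keys order_refl finite_keys order_refl, of p q]
    subst_superset[OF finite_keys order_refl, of f p] subst_superset[OF finite_keys order_refl, of f q]
  by (simp add: subst_sum subst_single sum_product power_prod_add scale_simps mult.commute)

lemma subst_one [simp]: "subst f 1 = 1"
  unfolding single_one[symmetric] subst_single by (simp add: power_prod_def scale_simps)

lemma subst_power: "subst f (p ^ n) = subst f p ^ n"
  by (induction n) (simp_all add: subst_mult)

lemma subst_prod: "subst f (\<Prod>x\<in>A. p x) = (\<Prod>x\<in>A. subst f (p x))"
  by (induction A rule: infinite_finite_induct) (simp_all add: subst_mult)

lemma subst_var [simp]: "subst f (var i) = f i"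
  unfolding var_def subst_single by (simp add: power_prod_def scale_simps)

lemmas subst_hom = subst_add subst_diff subst_uminus subst_mult subst_scale

lemma subst_subst: "subst f (subst g p) = subst (\<lambda>k. subst f (g k)) p"
  unfolding subst_def[of g p] subst_def[of _ p]
  by (simp add: subst_sum subst_scale subst_prod subst_power)

lemma power_prod_var: "power_prod var e = Poly_Mapping.single e 1"
proof -
  have v: "(var k :: 'a mpol) ^ n = Poly_Mapping.single (Poly_Mapping.single k n) 1" for k n
    by (induction n) (simp_all add: var_def mult_single flip: single_add)
  have p: "(\<Prod>k\<in>A. Poly_Mapping.single (g k) (1 :: 'a)) = Poly_Mapping.single (\<Sum>k\<in>A. g k) 1"
    for A :: "nat set" and g :: "nat \<Rightarrow> composition"
    by (induction A rule: infinite_finite_induct) (simp_all add: mult_single)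
  show ?thesis
    unfolding power_prod_def v p
    using poly_mapping_sum_single[OF finite_keys order_refl, of e] by simp
qed

lemma subst_var_id [simp]: "subst var p = p"
  unfolding subst_superset[OF finite_keys order_refl] power_prod_var
  using poly_mapping_sum_single[OF finite_keys order_refl, of p] by (simp add: scale_single)

lemma subst_cong:
  assumes "p \<in> polys N" "\<And>k. 1 \<le> k \<Longrightarrow> k \<le> N \<Longrightarrow> f k = g k"
  shows "subst f p = subst g p"
proof -
  have "f k = g k" if "e \<in> Poly_Mapping.keys p" "k \<in> Poly_Mapping.keys e" for e k
    using that assms unfolding polys_def comps_def by (metis (no_types, lifting) atLeastAtMost_iff mem_Collect_eq subsetD)
  then show ?thesis
    unfolding subst_def by (intro sum.cong arg_cong2[where f = scale] prod.cong) auto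
qed

lemma comps_add: "e \<in> comps N \<Longrightarrow> e' \<in> comps N \<Longrightarrow> e + e' \<in> comps N"
  using Poly_Mapping.keys_add unfolding comps_def by fastforce

lemma polys_zero: "0 \<in> polys N"
  by (simp add: polys_def)

lemma polys_add: "p \<in> polys N \<Longrightarrow> q \<in> polys N \<Longrightarrow> p + q \<in> polys N"
  using Poly_Mapping.keys_add unfolding polys_def by fastforce

lemma polys_uminus: "p \<in> polys N \<Longrightarrow> - p \<in> polys N" for p :: "'a::ab_group_add mpol"
  by (auto simp: polys_def in_keys_iff)

lemma polys_diff: "p \<in> polys N \<Longrightarrow> q \<in> polys N \<Longrightarrow> p - q \<in> polys N" for p :: "'a::ab_group_add mpol"
  using polys_add[OF _ polys_uminus, of p N q] by simp

lemma polys_scale: "p \<in> polys N \<Longrightarrow> scale c p \<in> polys N"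
  by (auto simp: polys_def in_keys_iff lookup_scale subset_iff dest: mult_not_zero)

lemma polys_mult: "p \<in> polys N \<Longrightarrow> q \<in> polys N \<Longrightarrow> p * q \<in> polys N"
  using Poly_Mapping.keys_mult[of p q] comps_add unfolding polys_def by fastforce

lemma polys_one: "1 \<in> polys N"
  by (simp add: polys_def comps_def)

lemma polys_power: "p \<in> polys N \<Longrightarrow> p ^ n \<in> polys N"
  by (induction n) (simp_all add: polys_one polys_mult)

lemma polys_sum: "(\<And>x. x \<in> A \<Longrightarrow> p x \<in> polys N) \<Longrightarrow> (\<Sum>x\<in>A. p x) \<in> polys N"
  by (induction A rule: infinite_finite_induct) (simp_all add: polys_zero polys_add)

lemma polys_prod: "(\<And>x. x \<in> A \<Longrightarrow> p x \<in> polys N) \<Longrightarrow> (\<Prod>x\<in>A. p x) \<in> polys N"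
  by (induction A rule: infinite_finite_induct) (simp_all add: polys_one polys_mult)

lemma polys_var: "1 \<le> i \<Longrightarrow> i \<le> N \<Longrightarrow> var i \<in> polys N"
  by (auto simp: polys_def comps_def var_def)

lemma polys_subst:
  assumes "p \<in> polys N" "\<And>k. 1 \<le> k \<Longrightarrow> k \<le> N \<Longrightarrow> f k \<in> polys N'"
  shows "subst f p \<in> polys N'"
proof -
  have "f k \<in> polys N'" if "e \<in> Poly_Mapping.keys p" "k \<in> Poly_Mapping.keys e" for e k
    using that assms unfolding polys_def comps_def by (metis (no_types, lifting) atLeastAtMost_iff mem_Collect_eq subsetD)
  then show ?thesis
    unfolding subst_def by (intro polys_sum polys_scale polys_prod polys_power) auto
qed

lemma exact_quot_mult: "b \<noteq> 0 \<Longrightarrow> exact_quot (b * c) b = c"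
  unfolding exact_quot_def by (rule the_equality) auto

lemma var_neq: "i \<noteq> j \<Longrightarrow> (var i :: 'a::zero_neq_one mpol) \<noteq> var j"
  unfolding var_def by (metis (no_types, lifting) lookup_single_eq lookup_single_not_eq zero_neq_one)

text \<open>
  Specialization is only a partial function on \<open>\<complex>(q,t)\<close>, so it is transported to polynomials as a
  relation; the instance with equality yields the divisibility statements over a single field.
\<close>

locale coeff_rel =
  fixes r :: "'a::field \<Rightarrow> 'b::field \<Rightarrow> bool"
  assumes rel_0: "r 0 0" and rel_1: "r 1 1"
    and rel_add: "r a a' \<Longrightarrow> r b b' \<Longrightarrow> r (a + b) (a' + b')"
    and rel_mult: "r a a' \<Longrightarrow> r b b' \<Longrightarrow> r (a * b) (a' * b')"
    and rel_uminus: "r a a' \<Longrightarrow> r (- a) (- a')"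
begin

lemma rel_diff: "r a a' \<Longrightarrow> r b b' \<Longrightarrow> r (a - b) (a' - b')"
  using rel_add[of a a' "- b" "- b'"] rel_uminus by simp

lemma rel_power: "r a a' \<Longrightarrow> r (a ^ n) (a' ^ n)"
  by (induction n) (simp_all add: rel_1 rel_mult)

definition mrel :: "'a mpol \<Rightarrow> 'b mpol \<Rightarrow> bool" where
  "mrel p p' \<longleftrightarrow> (\<forall>e. r (Poly_Mapping.lookup p e) (Poly_Mapping.lookup p' e))"

lemma mrelD: "mrel p p' \<Longrightarrow> r (Poly_Mapping.lookup p e) (Poly_Mapping.lookup p' e)"
  by (simp add: mrel_def)

lemma mrel_zero: "mrel 0 0" and mrel_add: "mrel p p' \<Longrightarrow> mrel q q' \<Longrightarrow> mrel (p + q) (p' + q')"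
  and mrel_diff: "mrel p p' \<Longrightarrow> mrel q q' \<Longrightarrow> mrel (p - q) (p' - q')"
  and mrel_scale: "r c c' \<Longrightarrow> mrel p p' \<Longrightarrow> mrel (scale c p) (scale c' p')"
  by (auto simp: mrel_def rel_0 rel_diff rel_add rel_mult lookup_add lookup_minus lookup_scale)

lemma mrel_sum: "(\<And>x. x \<in> A \<Longrightarrow> mrel (f x) (f' x)) \<Longrightarrow> mrel (\<Sum>x\<in>A. f x) (\<Sum>x\<in>A. f' x)"
  by (induction A rule: infinite_finite_induct) (simp_all add: mrel_zero mrel_add)

lemma mrel_single: "r c c' \<Longrightarrow> mrel (Poly_Mapping.single e c) (Poly_Mapping.single e c')"
  by (auto simp: mrel_def lookup_single when_def rel_0)

lemma mrel_var: "mrel (var i) (var i)"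
  unfolding var_def by (intro mrel_single rel_1)

lemma mrel_one: "mrel 1 1"
  unfolding single_one[symmetric] by (intro mrel_single rel_1)

lemma mrel_mult:
  assumes "mrel p p'" "mrel q q'"
  shows "mrel (p * q) (p' * q')"
proof -
  let ?A = "Poly_Mapping.keys p \<union> Poly_Mapping.keys p'"
  let ?B = "Poly_Mapping.keys q \<union> Poly_Mapping.keys q'"
  show ?thesis
    using assms
    by (subst (1 2) mpol_mult_sum[of ?A _ ?B])
      (auto intro!: mrel_sum mrel_single rel_mult mrelD)
qed

lemma mrel_power: "mrel p p' \<Longrightarrow> mrel (p ^ n) (p' ^ n)"
  by (induction n) (simp_all add: mrel_one mrel_mult)

lemma mrel_prod: "(\<And>x. x \<in> A \<Longrightarrow> mrel (f x) (f' x)) \<Longrightarrow> mrel (\<Prod>x\<in>A. f x) (\<Prod>x\<in>A. f' x)"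
  by (induction A rule: infinite_finite_induct) (simp_all add: mrel_one mrel_mult)

lemma mrel_power_prod: "(\<And>k. mrel (f k) (f' k)) \<Longrightarrow> mrel (power_prod f e) (power_prod f' e)"
  unfolding power_prod_def by (intro mrel_prod mrel_power)

lemma mrel_subst:
  assumes "\<And>k. mrel (f k) (f' k)" "mrel p p'"
  shows "mrel (subst f p) (subst f' p')"
proof -
  let ?A = "Poly_Mapping.keys p \<union> Poly_Mapping.keys p'"
  show ?thesis
    using assms
    by (subst (1 2) subst_superset[of ?A])
      (auto intro!: mrel_sum mrel_scale mrel_power_prod mrelD)
qed

text \<open>The Hecke operator divides by \<open>x_i - x_(i+1)\<close>, and the quotients have to be
  related again; they are therefore built in parallel on both sides.\<close>

definition rdvd :: "'a mpol \<Rightarrow> 'b mpol \<Rightarrow> 'a mpol \<Rightarrow> 'b mpol \<Rightarrow> bool" where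
  "rdvd d d' p p' \<longleftrightarrow> (\<exists>c c'. mrel c c' \<and> p = d * c \<and> p' = d' * c')"

lemma rdvd_zero: "rdvd d d' 0 0"
  unfolding rdvd_def using mrel_zero by force

lemma rdvd_add: "rdvd d d' p p' \<Longrightarrow> rdvd d d' q q' \<Longrightarrow> rdvd d d' (p + q) (p' + q')"
  unfolding rdvd_def using mrel_add by (metis distrib_left)

lemma rdvd_mult: "rdvd d d' p p' \<Longrightarrow> mrel q q' \<Longrightarrow> rdvd d d' (p * q) (p' * q')"
  unfolding rdvd_def using mrel_mult by (metis mult.assoc)

lemma rdvd_mult_left: "rdvd d d' p p' \<Longrightarrow> mrel q q' \<Longrightarrow> rdvd d d' (q * p) (q' * p')"
  using rdvd_mult by (metis mult.commute)

lemma rdvd_diff_mult: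
  assumes "rdvd d d' (a - b) (a' - b')" "rdvd d d' (p - q) (p' - q')" "mrel p p'" "mrel b b'"
  shows "rdvd d d' (a * p - b * q) (a' * p' - b' * q')"
proof -
  have "rdvd d d' ((a - b) * p + b * (p - q)) ((a' - b') * p' + b' * (p' - q'))"
    using assms by (intro rdvd_add rdvd_mult rdvd_mult_left)
  then show ?thesis by (simp add: algebra_simps)
qed

text \<open>Substitutions that agree modulo \<open>d\<close> on every variable agree modulo
  \<open>d\<close> on powers, products and sums, by
  \<open>a p - b q = (a - b) p + b (p - q)\<close>.\<close>

lemma rdvd_subst_diff:
  assumes f: "\<And>k. mrel (f k) (f' k)" and g: "\<And>k. mrel (g k) (g' k)"
    and d: "\<And>k. rdvd d d' (f k - g k) (f' k - g' k)" and p: "mrel p p'"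
  shows "rdvd d d' (subst f p - subst g p) (subst f' p' - subst g' p')"
proof -
  have pow: "rdvd d d' (f k ^ n - g k ^ n) (f' k ^ n - g' k ^ n)" for k n
  proof (induction n)
    case (Suc n)
    then show ?case by (auto intro!: rdvd_diff_mult d mrel_power f g)
  qed (simp add: rdvd_zero)
  have prod: "rdvd d d' ((\<Prod>k\<in>A. f k ^ h k) - (\<Prod>k\<in>A. g k ^ h k))
      ((\<Prod>k\<in>A. f' k ^ h k) - (\<Prod>k\<in>A. g' k ^ h k))" for A h
    by (induction A rule: infinite_finite_induct)
      (auto intro!: rdvd_zero rdvd_diff_mult pow mrel_power mrel_prod f g)
  have sum: "rdvd d d' (\<Sum>x\<in>A. h x) (\<Sum>x\<in>A. h' x)" if "\<And>x. x \<in> A \<Longrightarrow> rdvd d d' (h x) (h' x)"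
    for A :: "composition set" and h h'
    using that by (induction A rule: infinite_finite_induct) (auto intro!: rdvd_zero rdvd_add)
  let ?A = "Poly_Mapping.keys p \<union> Poly_Mapping.keys p'"
  have e: "scale c a - scale c b = const c * (a - b)" for c :: "'c::comm_ring_1" and a b
    by (simp add: scale_def right_diff_distrib)
  have "rdvd d d' (\<Sum>e\<in>?A. scale (Poly_Mapping.lookup p e) (power_prod f e) - scale (Poly_Mapping.lookup p e) (power_prod g e))
      (\<Sum>e\<in>?A. scale (Poly_Mapping.lookup p' e) (power_prod f' e) - scale (Poly_Mapping.lookup p' e) (power_prod g' e))"
    unfolding e power_prod_superset[OF finite_keys order_refl] using p
    by (intro sum rdvd_mult_left prod) (auto simp: const_def intro!: mrel_single mrelD)
  then show ?thesis
    by (simp add: sum_subtractf subst_superset[of ?A])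
qed

lemma mrel_swap_vars: "mrel p p' \<Longrightarrow> mrel (swap_vars i p) (swap_vars i p')"
  unfolding swap_vars_def by (intro mrel_subst mrel_var)

lemma rdvd_swap_vars:
  assumes "mrel p p'"
  shows "rdvd (var i - var (i + 1)) (var i - var (i + 1)) (p - swap_vars i p) (p' - swap_vars i p')"
proof -
  let ?D = "var i - var (i + 1)"
  have self: "rdvd ?D ?D ?D ?D"
    unfolding rdvd_def using mrel_one by (metis mult.right_neutral)
  have neg: "rdvd ?D ?D (- ?D) (- ?D)"
    using rdvd_mult[OF self mrel_diff[OF mrel_zero mrel_one]] by simp
  have "rdvd ?D ?D (subst var p - subst (\<lambda>k. var (transpose i (i + 1) k)) p)
      (subst var p' - subst (\<lambda>k. var (transpose i (i + 1) k)) p')"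
    using self neg assms
    by (intro rdvd_subst_diff mrel_var) (auto simp: transpose_def rdvd_zero)
  then show ?thesis by (simp add: swap_vars_def)
qed

lemma mrel_hecke:
  assumes "mrel p p'" "r t t'"
  shows "mrel (hecke t i p) (hecke t' i p')"
proof -
  obtain c c' where c: "mrel c c'" "p - swap_vars i p = (var i - var (i + 1)) * c"
      "p' - swap_vars i p' = (var i - var (i + 1)) * c'"
    using rdvd_swap_vars[OF assms(1)] unfolding rdvd_def by blast
  show ?thesis
    unfolding hecke_def c(2,3) using c(1) assms
    by (simp add: exact_quot_mult var_neq)
      (intro mrel_add mrel_scale mrel_mult mrel_var mrel_swap_vars rel_diff rel_1)
qed

end

interpretation coeff_eq: coeff_rel "(=)"
  rewrites "coeff_rel.mrel (=) = (=)"
proof -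
  show *: "coeff_rel (=)" by standard auto
  show "coeff_rel.mrel (=) = (=)"
    unfolding coeff_rel.mrel_def[OF *] by (auto simp: fun_eq_iff intro: poly_mapping_eqI)
qed

lemma var_diff_dvd: "(var i - var (i + 1) :: 'a::field mpol) dvd p - swap_vars i p"
  using coeff_eq.rdvd_swap_vars[of p p i] unfolding coeff_eq.rdvd_def dvd_def by metis

lemma hecke_eq:
  "(var i - var (i + 1)) * hecke t i p =
    scale (1 - t) (var (i + 1) * p) + scale t (var i * swap_vars i p) - var (i + 1) * swap_vars i p"
  for p :: "'a::field mpol"
proof -
  obtain c where c: "p - swap_vars i p = (var i - var (i + 1)) * c"
    using var_diff_dvd dvdE by blast
  have "exact_quot (p - swap_vars i p) (var i - var (i + 1)) = c"
    unfolding c by (rule exact_quot_mult) (simp add: var_neq)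
  then have "(var i - var (i + 1)) * hecke t i p = scale (1 - t) (var (i + 1) * (p - swap_vars i p))
      + scale t ((var i - var (i + 1)) * swap_vars i p)"
    unfolding hecke_def c by (simp add: scale_simps distrib_left mult_ac)
  then show ?thesis
    by (simp add: scale_def algebra_simps const_def single_diff)
qed

section \<open>Hecke operators and singular polynomials\<close>

lemma const_diff: "const (c - d) = const c - const d" and const_one: "const 1 = 1"
  for c d :: "'a::ab_group_add"
  by (simp_all add: const_def single_diff)

lemma swap_vars_hom:
  "swap_vars i (p + q) = swap_vars i p + swap_vars i q"
  "swap_vars i (p - q) = swap_vars i p - swap_vars i q"
  "swap_vars i (p * q) = swap_vars i p * swap_vars i q"
  "swap_vars i (scale c p) = scale c (swap_vars i p)"
  "swap_vars i (var k) = var (transpose i (i + 1) k)"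
  by (simp_all add: swap_vars_def subst_hom)

lemma swap_vars_one: "swap_vars i 1 = 1"
  by (simp add: swap_vars_def)

lemma swap_vars_const: "swap_vars i (const c) = const c"
  using swap_vars_hom(4)[of i c 1] by (simp add: scale_def swap_vars_one)

lemma swap_vars_swap_vars: "swap_vars i (swap_vars i p) = p"
  by (simp add: swap_vars_def subst_subst)

lemma swap_vars_braid:
  "swap_vars i (swap_vars (i + 1) (swap_vars i p)) = swap_vars (i + 1) (swap_vars i (swap_vars (i + 1) p))"
  unfolding swap_vars_def subst_subst subst_var
  by (rule arg_cong2[where f = subst]) (auto simp: transpose_def fun_eq_iff)

lemma swap_vars_far:
  "i + 2 \<le> j \<Longrightarrow> swap_vars i (swap_vars j p) = swap_vars j (swap_vars i p)"
  unfolding swap_vars_def subst_subst subst_var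
  by (rule arg_cong2[where f = subst]) (auto simp: transpose_def fun_eq_iff)

lemma hecke_eq':
  "(var i - var (i + 1)) * hecke t i p =
    (1 - const t) * var (i + 1) * p + (const t * var i - var (i + 1)) * swap_vars i p"
  for p :: "'a::field mpol"
  unfolding hecke_eq by (simp add: scale_def const_diff const_one algebra_simps)

text \<open>As \<open>x_i - x_(i+1)\<close> can be cancelled, a candidate value of
  \<open>hecke\<close> is checked by an identity without division; linearity and the quadratic
  relation are verified this way.\<close>

lemma hecke_unique':
  fixes p :: "'a::field mpol"
  assumes "(var i - var (i + 1)) * h =
    (1 - const t) * var (i + 1) * p + (const t * var i - var (i + 1)) * swap_vars i p"
  shows "hecke t i p = h"
  using assms unfolding hecke_eq'[symmetric] by (simp add: var_neq)

lemma hecke_add: "hecke t i (p + q) = hecke t i p + hecke t i q" for p :: "'a::field mpol"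
  by (rule hecke_unique') (simp only: distrib_left hecke_eq' swap_vars_hom, simp add: algebra_simps)

lemma hecke_scale: "hecke t i (scale c p) = scale c (hecke t i p)" for p :: "'a::field mpol"
  by (rule hecke_unique') (simp only: scale_simps(8) hecke_eq' swap_vars_hom, simp add: scale_simps)

lemma hecke_quad: "hecke t i (hecke t i p) = scale (t - 1) (hecke t i p) + scale t p"
  for p :: "'a::field mpol"
proof (rule hecke_unique')
  let ?x = "var i :: 'a mpol" and ?y = "var (i + 1) :: 'a mpol"
  let ?a = "hecke t i p" and ?s = "swap_vars i" and ?t = "const t"
  note a = hecke_eq'[of i t p]
  have "?s ((?x - ?y) * ?a) = (?y - ?x) * ?s ?a"
    unfolding swap_vars_hom by simp
  then have sa: "(?y - ?x) * ?s ?a = (1 - ?t) * ?x * ?s p + (?t * ?y - ?x) * p"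
    unfolding a swap_vars_hom swap_vars_const swap_vars_one swap_vars_swap_vars by simp
  \<comment> \<open>Stated for free ring elements, so that the values of the operators are atoms of
    a plain polynomial identity.\<close>
  have key: "(x - y) * ((x - y) * ((c - 1) * a + c * p)) = (x - y) * ((1 - c) * y * a + (c * x - y) * a1)"
    if "(x - y) * a = (1 - c) * y * p + (c * x - y) * p1" "(y - x) * a1 = (1 - c) * x * p1 + (c * y - x) * p"
    for x y c a a1 p p1 :: "'a mpol"
  proof -
    have 1: "(x - y) * ((1 - c) * y * a + (c * x - y) * a1)
        = (1 - c) * y * ((x - y) * a) - (c * x - y) * ((y - x) * a1)"
      by (simp add: algebra_simps)
    have 2: "(x - y) * ((x - y) * ((c - 1) * a + c * p))
        = (x - y) * (c - 1) * ((x - y) * a) + (x - y) * (x - y) * c * p"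
      by (simp add: algebra_simps)
    show ?thesis unfolding 1 2 that by (simp add: algebra_simps)
  qed
  from key[OF a sa] show "(?x - ?y) * (scale (t - 1) ?a + scale t p) =
    (1 - ?t) * ?y * ?a + (?t * ?x - ?y) * ?s ?a"
    by (simp add: var_neq scale_def const_diff const_one)
qed

text \<open>The names record the operators: \<open>a, b, c\<close> come from \<open>p\<close> by
  \<open>T_i, T_(i+1), T_i\<close> in turn, the primed ones by \<open>T_(i+1), T_i, T_(i+1)\<close>.
  Digits 1 and 2 stand for \<open>swap_vars i\<close> and \<open>swap_vars (i + 1)\<close>, the last
  digit acting first. With all denominators cleared, an identity linear in the six permuted copies
  of \<open>p\<close> remains.\<close>

lemma braid_identity:
  fixes x y z t :: "'a::idom"
  assumes "(x - y) * a = (1 - t) * y * p + (t * x - y) * p1"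
    and "(y - x) * a1 = (1 - t) * x * p1 + (t * y - x) * p"
    and "(x - z) * a2 = (1 - t) * z * p2 + (t * x - z) * p21"
    and "(y - z) * a12 = (1 - t) * z * p12 + (t * y - z) * p121"
    and "(y - z) * b = (1 - t) * z * a + (t * y - z) * a2"
    and "(x - z) * b1 = (1 - t) * z * a1 + (t * x - z) * a12"
    and "(x - y) * c = (1 - t) * y * b + (t * x - y) * b1"
    and "(y - z) * a' = (1 - t) * z * p + (t * y - z) * p2"
    and "(z - y) * a2' = (1 - t) * y * p2 + (t * z - y) * p"
    and "(x - z) * a1' = (1 - t) * z * p1 + (t * x - z) * p12"
    and "(x - y) * a21' = (1 - t) * y * p21 + (t * x - y) * p121"
    and "(x - y) * b' = (1 - t) * y * a' + (t * x - y) * a1'"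
    and "(x - z) * b2' = (1 - t) * z * a2' + (t * x - z) * a21'"
    and "(y - z) * c' = (1 - t) * z * b' + (t * y - z) * b2'"
    and "x \<noteq> y" "y \<noteq> z" "x \<noteq> z"
  shows "c = c'"
proof -
  have "(x - y) * (x - y) * (y - z) * (x - z) * c
      = (1 - t) * y * ((x - y) * (x - z)) * ((y - z) * b) + (t * x - y) * ((x - y) * (y - z)) * ((x - z) * b1)"
    using arg_cong[OF assms(7), of "\<lambda>u. (x - y) * (y - z) * (x - z) * u"]
    by (simp only: distrib_left mult_ac)
  also have "\<dots> = (1 - t) * y * ((1 - t) * z * (x - z) * ((x - y) * a) + (t * y - z) * (x - y) * ((x - z) * a2))
      + (t * x - y) * ((t * x - z) * (x - y) * ((y - z) * a12) - (1 - t) * z * (y - z) * ((y - x) * a1))"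
    unfolding assms(5,6) by (simp add: algebra_simps)
  finally have c: "(x - y) * (x - y) * (y - z) * (x - z) * c = \<dots>" .
  have "(y - z) * (y - z) * (x - y) * (x - z) * c'
      = (1 - t) * z * ((y - z) * (x - z)) * ((x - y) * b') + (t * y - z) * ((x - y) * (y - z)) * ((x - z) * b2')"
    using arg_cong[OF assms(14), of "\<lambda>u. (x - y) * (y - z) * (x - z) * u"]
    by (simp only: distrib_left mult_ac)
  also have "\<dots> = (1 - t) * z * ((1 - t) * y * (x - z) * ((y - z) * a') + (t * x - y) * (y - z) * ((x - z) * a1'))
      + (t * y - z) * ((t * x - z) * (y - z) * ((x - y) * a21') - (1 - t) * z * (x - y) * ((z - y) * a2'))"
    unfolding assms(12,13) by (simp add: algebra_simps)
  finally have c': "(y - z) * (y - z) * (x - y) * (x - z) * c' = \<dots>" .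
  have "(y - z) * ((x - y) * (x - y) * (y - z) * (x - z) * c)
      = (x - y) * ((y - z) * (y - z) * (x - y) * (x - z) * c')"
    unfolding c c' assms(1-4,8-11) by (simp add: algebra_simps)
  then have "((x - y) * (x - y) * ((y - z) * (y - z)) * (x - z)) * c
      = ((x - y) * (x - y) * ((y - z) * (y - z)) * (x - z)) * c'"
    by (simp add: mult_ac)
  then show ?thesis using assms(15-) by simp
qed

lemma hecke_braid: "hecke t i (hecke t (i + 1) (hecke t i p)) = hecke t (i + 1) (hecke t i (hecke t (i + 1) p))"
  for p :: "'a::field mpol"
proof -
  let ?s = "swap_vars i" and ?s' = "swap_vars (i + 1)"
  let ?T = "hecke t i" and ?T' = "hecke t (i + 1)"
  let ?x = "var i :: 'a mpol" and ?y = "var (i + 1) :: 'a mpol" and ?z = "var (i + 2) :: 'a mpol"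
  have s: "?s ?x = ?y" "?s ?y = ?x" "?s ?z = ?z" "?s' ?x = ?x" "?s' ?y = ?z" "?s' ?z = ?y"
    by (simp_all add: swap_vars_hom transpose_def)
  have T: "(?x - ?y) * ?T w = (1 - const t) * ?y * w + (const t * ?x - ?y) * ?s w"
    "(?y - ?z) * ?T' w = (1 - const t) * ?z * w + (const t * ?y - ?z) * ?s' w" for w
    using hecke_eq'[of i t w] hecke_eq'[of "i + 1" t w] by (simp_all add: numeral_2_eq_2)
  note hom = swap_vars_hom(1-3) swap_vars_const swap_vars_one s swap_vars_swap_vars
  have sT: "(?y - ?x) * ?s (?T w) = (1 - const t) * ?x * ?s w + (const t * ?y - ?x) * w"
    "(?x - ?z) * ?s' (?T w) = (1 - const t) * ?z * ?s' w + (const t * ?x - ?z) * ?s' (?s w)"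
    "(?z - ?y) * ?s' (?T' w) = (1 - const t) * ?y * ?s' w + (const t * ?z - ?y) * w"
    "(?x - ?z) * ?s (?T' w) = (1 - const t) * ?z * ?s w + (const t * ?x - ?z) * ?s (?s' w)" for w
    using arg_cong[OF T(1), of ?s w] arg_cong[OF T(1), of ?s' w] arg_cong[OF T(2), of ?s' w]
      arg_cong[OF T(2), of ?s w]
    by (simp_all only: hom)
  have ssT: "(?y - ?z) * ?s (?s' (?T w)) = (1 - const t) * ?z * ?s (?s' w) + (const t * ?y - ?z) * ?s (?s' (?s w))"
    "(?x - ?y) * ?s' (?s (?T' w)) = (1 - const t) * ?y * ?s' (?s w) + (const t * ?x - ?y) * ?s (?s' (?s w))" for w
    using arg_cong[OF sT(2), of ?s w] arg_cong[OF sT(4), of ?s' w]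
    by (simp_all only: hom swap_vars_braid)
  show ?thesis
    by (rule braid_identity[OF T(1) sT(1) sT(2) ssT(1) T(2) sT(4) T(1) T(2) sT(3) sT(4) ssT(2) T(1) sT(2) T(2)])
      (simp_all add: var_neq)
qed

lemma far_identity:
  fixes x y z w t :: "'a::idom"
  assumes "(x - y) * a = (1 - t) * y * p + (t * x - y) * p1"
    and "(x - y) * a3 = (1 - t) * y * p3 + (t * x - y) * p13"
    and "(z - w) * c = (1 - t) * w * a + (t * z - w) * a3"
    and "(z - w) * a' = (1 - t) * w * p + (t * z - w) * p3"
    and "(z - w) * a1' = (1 - t) * w * p1 + (t * z - w) * p13"
    and "(x - y) * c' = (1 - t) * y * a' + (t * x - y) * a1'"
    and "x \<noteq> y" "z \<noteq> w"
  shows "c = c'"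
proof -
  have 1: "(x - y) * ((z - w) * c) = (1 - t) * w * ((x - y) * a) + (t * z - w) * ((x - y) * a3)"
    unfolding assms(3) by (simp add: algebra_simps)
  have 2: "(z - w) * ((x - y) * c') = (1 - t) * y * ((z - w) * a') + (t * x - y) * ((z - w) * a1')"
    unfolding assms(6) by (simp add: algebra_simps)
  have "(x - y) * ((z - w) * c) = (z - w) * ((x - y) * c')"
    unfolding 1 2 assms(1,2,4,5) by (simp add: algebra_simps)
  then have "((x - y) * (z - w)) * c = ((x - y) * (z - w)) * c'" by (simp only: mult_ac)
  then show ?thesis using assms(7,8) by simp
qed

lemma hecke_far:
  fixes p :: "'a::field mpol"
  assumes "i + 2 \<le> j"
  shows "hecke t i (hecke t j p) = hecke t j (hecke t i p)"
proof -
  let ?s = "swap_vars i" and ?s' = "swap_vars j"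
  let ?x = "var i :: 'a mpol" and ?y = "var (i + 1) :: 'a mpol"
  let ?z = "var j :: 'a mpol" and ?w = "var (j + 1) :: 'a mpol"
  have s: "?s ?z = ?z" "?s ?w = ?w" "?s' ?x = ?x" "?s' ?y = ?y"
    using assms by (simp_all add: swap_vars_hom transpose_def)
  note hom = swap_vars_hom(1-3) swap_vars_const swap_vars_one s swap_vars_swap_vars
  have sT: "(?x - ?y) * ?s' (hecke t i p) = (1 - const t) * ?y * ?s' p + (const t * ?x - ?y) * ?s (?s' p)"
    "(?z - ?w) * ?s (hecke t j p) = (1 - const t) * ?w * ?s p + (const t * ?z - ?w) * ?s (?s' p)"
    using arg_cong[OF hecke_eq'[of i t p], of ?s'] arg_cong[OF hecke_eq'[of j t p], of ?s]
    by (simp_all only: hom swap_vars_far[OF assms])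
  show ?thesis
    by (rule far_identity[symmetric, OF hecke_eq' sT(1) hecke_eq' hecke_eq' sT(2) hecke_eq'])
      (simp_all add: var_neq)
qed

lemma hecke_zero [simp]: "hecke t i 0 = 0"
  using hecke_scale[of t i 0 0] by (simp add: scale_simps)

section \<open>Inverses of the Hecke operators and invariance of \<open>polys N\<close>\<close>

lemma hecke_left_inverse:
  assumes "t \<noteq> 0"
  shows "scale (1 / t) (hecke t i (hecke t i p) + scale (1 - t) (hecke t i p)) = p"
proof -
  have "scale (t - 1) (hecke t i p) + scale (1 - t) (hecke t i p) = 0"
    by (simp flip: scale_simps(2) add: scale_simps(5))
  then have "hecke t i (hecke t i p) + scale (1 - t) (hecke t i p) = scale t p"
    unfolding hecke_quad by (simp add: add_ac add.left_commute)
  then show ?thesis using assms by (simp add: scale_simps)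
qed

lemma hecke_right_inverse:
  assumes "t \<noteq> 0"
  shows "hecke t i (scale (1 / t) (hecke t i p + scale (1 - t) p)) = p"
  using hecke_left_inverse[OF assms, of i p] by (simp add: hecke_scale hecke_add)

text \<open>\<open>cherednik\<close> applies \<open>inv\<close> on the whole type; bijectivity there
  identifies it with the explicit inverse from the quadratic relation.\<close>

lemma bij_hecke: "t \<noteq> 0 \<Longrightarrow> bij (hecke t i)"
  by (rule bijI') (metis hecke_left_inverse, metis hecke_right_inverse)

lemma inv_hecke: "t \<noteq> 0 \<Longrightarrow> inv (hecke t i) p = scale (1 / t) (hecke t i p + scale (1 - t) p)"
  by (metis bij_hecke bij_inv_eq_iff hecke_right_inverse)

lemma inv_hecke_hecke: "t \<noteq> 0 \<Longrightarrow> inv (hecke t i) (hecke t i p) = p"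
  using bij_hecke by (metis bij_inv_eq_iff)

lemma hecke_eq_0_iff: "t \<noteq> 0 \<Longrightarrow> hecke t i p = 0 \<longleftrightarrow> p = 0"
  by (metis inv_hecke_hecke hecke_zero)

lemma subst_in_polys: "(\<And>k. f k \<in> polys N) \<Longrightarrow> subst f p \<in> polys N"
  unfolding subst_def by (intro polys_sum polys_scale polys_prod polys_power) auto

text \<open>Setting the variables outside \<open>1..N\<close> to 0 fixes \<open>d\<close> and
  \<open>d * h\<close>, hence also \<open>h\<close>, because \<open>d\<close> can be
  cancelled.\<close>

lemma polys_cancel:
  fixes h :: "'a::field mpol"
  assumes "d * h \<in> polys N" "d \<in> polys N" "d \<noteq> 0"
  shows "h \<in> polys N"
proof -
  let ?f = "\<lambda>k. if 1 \<le> k \<and> k \<le> N then var k else (0 :: 'a mpol)"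
  have id: "subst ?f p = p" if "p \<in> polys N" for p
    using subst_cong[OF that, of ?f var] by simp
  have "d * subst ?f h = d * h"
    using id[OF assms(1)] id[OF assms(2)] by (simp add: subst_mult)
  then have "subst ?f h = h" using assms(3) by simp
  then show ?thesis
    using subst_in_polys[of ?f N h] by (simp add: polys_var polys_zero split: if_splits)
qed

lemma hecke_in_polys:
  fixes p :: "'a::field mpol"
  assumes "p \<in> polys N" "1 \<le> i" "i < N"
  shows "hecke t i p \<in> polys N"
proof (rule polys_cancel)
  have "swap_vars i p \<in> polys N"
    unfolding swap_vars_def using assms by (intro polys_subst polys_var) (auto simp: transpose_def)
  then show "(var i - var (i + 1)) * hecke t i p \<in> polys N"
    unfolding hecke_eq using assms by (intro polys_add polys_diff polys_scale polys_mult polys_var) auto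
qed (use assms in \<open>auto intro!: polys_diff polys_var simp: var_neq\<close>)

lemma inv_hecke_in_polys:
  "t \<noteq> 0 \<Longrightarrow> p \<in> polys N \<Longrightarrow> 1 \<le> i \<Longrightarrow> i < N \<Longrightarrow> inv (hecke t i) p \<in> polys N"
  by (simp add: inv_hecke polys_scale polys_add hecke_in_polys)

declare dunkl.simps [simp del]

text \<open>
  Since \<open>E\<^sub>i\<^sub>+\<^sub>1 T\<^sub>i = t E\<^sub>i\<close> and \<open>E\<^sub>N \<omega> = E\<^sub>1\<close> for the operators \<open>E\<^sub>j\<close> below, \<open>p - p \<xi>\<^sub>N\<close>
  vanishes at \<open>x\<^sub>N = 0\<close>, so that the quotient in the definition of \<^term>\<open>dunkl\<close> really exists.
\<close>

definition insert_zero :: "nat \<Rightarrow> 'a::field mpol \<Rightarrow> 'a mpol" where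
  "insert_zero j = subst (\<lambda>k. if k < j then var k else if k = j then 0 else var (k - 1))"

lemma insert_zero_scale: "insert_zero j (scale c p) = scale c (insert_zero j p)"
  by (simp add: insert_zero_def subst_scale)

lemma insert_zero_hecke: "insert_zero (i + 1) (hecke t i p) = scale t (insert_zero i p)"
proof -
  let ?E = "insert_zero (i + 1)"
  have s: "?E (swap_vars i p) = insert_zero i p"
    unfolding insert_zero_def swap_vars_def subst_subst subst_var
    by (rule arg_cong2[where f = subst]) (auto simp: transpose_def fun_eq_iff)
  have "?E ((var i - var (i + 1)) * hecke t i p) = var i * ?E (hecke t i p)"
    by (simp add: insert_zero_def subst_hom)
  moreover have "?E ((var i - var (i + 1)) * hecke t i p) = var i * scale t (?E (swap_vars i p))"
    unfolding hecke_eq by (simp add: insert_zero_def subst_hom scale_simps)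
  ultimately show ?thesis
    unfolding s by (simp add: var_def) (metis lookup_single_eq lookup_zero mult_cancel_left zero_neq_one)
qed

lemma insert_zero_fold_inv_hecke:
  assumes "t \<noteq> 0" "1 \<le> k"
  shows "insert_zero 1 (fold (\<lambda>j. inv (hecke t j)) (rev [1..<k]) p) = scale ((1 / t) ^ (k - 1)) (insert_zero k p)"
  using assms(2)
proof (induction k arbitrary: p rule: nat_induct_at_least)
  case base
  then show ?case by (simp add: scale_simps)
next
  case (Suc k)
  have "insert_zero (Suc k) p = scale t (insert_zero k (inv (hecke t k) p))"
    using insert_zero_hecke[of k t "inv (hecke t k) p"] bij_hecke[OF assms(1), of k]
    by (metis Suc_eq_plus1 bij_inv_eq_iff)
  moreover obtain k' where "k = Suc k'" using Suc.hyps by (cases k) auto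
  ultimately show ?case using Suc assms(1) by (simp add: scale_simps)
qed

lemma fold_inv_hecke_in_polys:
  "t \<noteq> 0 \<Longrightarrow> p \<in> polys N \<Longrightarrow> k \<le> N \<Longrightarrow> fold (\<lambda>j. inv (hecke t j)) (rev [1..<k]) p \<in> polys N"
  by (induction k arbitrary: p) (simp_all add: inv_hecke_in_polys)

lemma insert_zero_cherednik:
  assumes "t \<noteq> 0" "1 \<le> N" "p \<in> polys N"
  shows "insert_zero N (cherednik q t N N p) = insert_zero N p"
proof -
  let ?r = "fold (\<lambda>j. inv (hecke t j)) (rev [1..<N]) p"
  have "insert_zero N (omega q N ?r) = insert_zero 1 ?r"
    unfolding insert_zero_def omega_def subst_subst using assms
    by (intro subst_cong[of _ N] fold_inv_hecke_in_polys) (auto simp: subst_scale scale_simps)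
  moreover have "t ^ (N - 1) * (1 / t) ^ (N - 1) = 1"
    using assms(1) by (simp flip: power_mult_distrib)
  ultimately show ?thesis
    using insert_zero_fold_inv_hecke[OF assms(1,2), of p]
    by (simp add: cherednik_def insert_zero_scale scale_simps)
qed

lemma insert_zero_dvd:
  assumes "p \<in> polys N" "insert_zero N p = 0"
  shows "var N dvd p"
proof -
  let ?f = "\<lambda>k. if k = N then 0 else (var k :: 'a mpol)"
  have "coeff_eq.rdvd (var N) (var N) (subst var p - subst ?f p) (subst var p - subst ?f p)"
    by (rule coeff_eq.rdvd_subst_diff)
      (auto simp: coeff_eq.rdvd_zero, auto simp: coeff_eq.rdvd_def intro: exI[of _ 1])
  moreover have "subst ?f p = insert_zero N p"
    unfolding insert_zero_def using assms(1) by (intro subst_cong[of _ N]) auto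
  ultimately show ?thesis using assms(2) by (auto simp: coeff_eq.rdvd_def)
qed

text \<open>\<open>exact_quot\<close> is a definite description, so \<open>dunkl = 0\<close> carries
  information only once the quotient by \<open>x_N\<close> is known to exist.\<close>

lemma dunkl_last_eq_0:
  assumes "t \<noteq> 0" "1 \<le> N" "p \<in> polys N" "cherednik q t N N p \<in> polys N" "dunkl q t N N p = 0"
  shows "cherednik q t N N p = p"
proof -
  let ?d = "p - cherednik q t N N p"
  have "insert_zero N ?d = 0"
    using insert_zero_cherednik[OF assms(1-3)] by (simp add: insert_zero_def subst_diff)
  then obtain c where c: "?d = var N * c"
    using insert_zero_dvd polys_diff[OF assms(3,4)] by (metis dvdE)
  have "(var N :: 'a mpol) \<noteq> 0" by (simp add: var_def) (metis lookup_single_eq lookup_zero zero_neq_one)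
  then have "dunkl q t N N p = c"
    by (subst dunkl.simps) (simp add: c exact_quot_mult)
  then show ?thesis using assms(5) c by simp
qed

lemma omega_in_polys: "1 \<le> N \<Longrightarrow> p \<in> polys N \<Longrightarrow> omega q N p \<in> polys N"
  unfolding omega_def by (rule polys_subst) (auto intro!: polys_scale polys_var)

lemma cherednik_last_in_polys: "t \<noteq> 0 \<Longrightarrow> 1 \<le> N \<Longrightarrow> p \<in> polys N \<Longrightarrow> cherednik q t N N p \<in> polys N"
  using polys_scale[OF omega_in_polys[OF _ fold_inv_hecke_in_polys[of t p N N]]]
  by (simp add: cherednik_def)

text \<open>The recursion \<open>\<xi>_i = t^(-1) T_i \<xi>_(i+1) T_i\<close>; \<open>dunkl\<close>
  obeys the same one, and so does \<open>jm\<close> with reversed index.\<close>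

lemma cherednik_step:
  assumes "t \<noteq> 0" "1 \<le> i" "i < N"
  shows "cherednik q t N i p = scale (1 / t) (hecke t i (cherednik q t N (i + 1) (hecke t i p)))"
proof -
  have "rev [1..<i + 1] = i # rev [1..<i]" using assms by simp
  moreover have "rev [i..<N] = rev [i + 1..<N] @ [i]" using assms by (simp add: upt_conv_Cons)
  moreover have "t ^ i = t * t ^ (i - 1)" using assms(2) by (cases i) auto
  ultimately show ?thesis
    using assms(1) by (simp add: cherednik_def inv_hecke_hecke hecke_scale scale_simps)
qed

lemma hecke_module_mpol:
  fixes t :: "'a::field"
  assumes "t \<noteq> 0" "\<And>k::nat. 0 < k \<Longrightarrow> t ^ k \<noteq> 1"
  shows "hecke_module scale t (\<lambda>k. hecke t (N - k)) N"
proof -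
  have "hecke t (N - k) (hecke t (N - Suc k) (hecke t (N - k) v))
      = hecke t (N - Suc k) (hecke t (N - k) (hecke t (N - Suc k) v))" if "Suc k < N" for k and v :: "'a mpol"
  proof -
    have "N - k = (N - Suc k) + 1" using that by simp
    then show ?thesis using hecke_braid[of t "N - Suc k" v] by simp
  qed
  then show ?thesis
    using assms mpol.vector_space_axioms
    by (intro hecke_module.intro hecke_module_axioms.intro)
      (auto simp: hecke_add hecke_scale hecke_quad intro: hecke_far[symmetric])
qed

text \<open>Descending induction on \<open>i\<close>: as \<open>T_i\<close> is injective,
  \<open>p D_i = 0\<close> gives \<open>(p T_i) D_(i+1) = 0\<close>, and \<open>\<xi>\<close> and
  \<open>jm\<close> obey the same recursion. One \<open>i\<close> and arbitrary \<open>p\<close> are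
  considered because the induction passes from \<open>p\<close> to \<open>p T_i\<close>.\<close>

lemma dunkl_eq_0_cherednik:
  fixes t :: "'a::field"
  assumes t: "t \<noteq> 0" "\<And>k::nat. 0 < k \<Longrightarrow> t ^ k \<noteq> 1"
    and "p \<in> polys N" "1 \<le> i" "i \<le> N" "dunkl q t N i p = 0"
  shows "cherednik q t N i p = hecke_module.jm scale t (\<lambda>k. hecke t (N - k)) (N + 1 - i) p"
proof -
  interpret H: hecke_module scale t "\<lambda>k. hecke t (N - k)" N
    by (rule hecke_module_mpol[OF t])
  show ?thesis using assms(5,3,4,6)
  proof (induction i arbitrary: p rule: inc_induct)
    case base
    then show ?case
      using dunkl_last_eq_0[OF t(1)] cherednik_last_in_polys[OF t(1)] by simp
  next
    case (step i)
    have "dunkl q t N i p = scale (1 / t) (hecke t i (dunkl q t N (Suc i) (hecke t i p)))"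
      using step.hyps by (subst dunkl.simps) simp
    then have "dunkl q t N (Suc i) (hecke t i p) = 0"
      using step.prems(3) t(1) hecke_eq_0_iff[OF t(1)] by (metis mpol.scale_eq_0_iff divide_eq_0_iff zero_neq_one)
    then have "cherednik q t N (Suc i) (hecke t i p) = H.jm (N - i) (hecke t i p)"
      using step.IH[of "hecke t i p"] step.hyps hecke_in_polys[OF step.prems(1,2)] by simp
    then show ?case
      using cherednik_step[OF t(1) step.prems(2) step.hyps(2), of q p] step.hyps H.jm_Suc[of "N - i" p]
      by (simp add: Suc_diff_le)
  qed
qed

section \<open>Specialization\<close>

definition is_hom :: "('a::comm_ring_1 \<Rightarrow> 'b::comm_ring_1) \<Rightarrow> bool" where
  "is_hom h \<longleftrightarrow> h 0 = 0 \<and> h 1 = 1 \<and> (\<forall>a b. h (a + b) = h a + h b) \<and> (\<forall>a b. h (a * b) = h a * h b)"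

lemma is_homD:
  assumes "is_hom h"
  shows "h 0 = 0" "h 1 = 1" "h (a + b) = h a + h b" "h (a * b) = h a * h b"
  using assms by (auto simp: is_hom_def)

lemma is_hom_uminus: "is_hom h \<Longrightarrow> h (- a) = - h a"
  by (metis add.right_inverse add_eq_0_iff is_homD(1,3))

lemma is_hom_sum: "is_hom h \<Longrightarrow> h (\<Sum>x\<in>A. f x) = (\<Sum>x\<in>A. h (f x))"
  by (induction A rule: infinite_finite_induct) (simp_all add: is_homD)

lemma is_hom_poly_map_poly:
  assumes h: "is_hom h"
  shows "is_hom (\<lambda>p. poly (map_poly h p) x)"
proof -
  note [simp] = is_homD[OF h]
  have "map_poly h (p + q) = map_poly h p + map_poly h q" for p q
    by (rule poly_eqI) (simp add: coeff_map_poly)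
  moreover have "map_poly h (p * q) = map_poly h p * map_poly h q" for p q
    by (rule poly_eqI) (simp add: coeff_map_poly coeff_mult is_hom_sum[OF h])
  moreover have "map_poly h 1 = 1"
    by (rule poly_eqI) (simp add: coeff_map_poly)
  ultimately show ?thesis by (simp add: is_hom_def)
qed

lemma extends_C_u_is_hom: "extends_C_u \<iota> u \<Longrightarrow> is_hom \<iota>"
  unfolding extends_C_u_def is_hom_def by (metis add_0 add_cancel_right_left)

lemma is_hom_eval_qt: "is_hom \<iota> \<Longrightarrow> is_hom (eval_qt \<iota> q t)"
  unfolding eval_qt_def[abs_def] by (intro is_hom_poly_map_poly)

locale specialization =
  fixes \<iota> :: "complex \<Rightarrow> 'a::field" and q t :: 'a
  assumes hom: "is_hom \<iota>"
begin

abbreviation "ev \<equiv> eval_qt \<iota> q t"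

lemmas ev = is_homD[OF is_hom_eval_qt[OF hom, of q t]] is_hom_uminus[OF is_hom_eval_qt[OF hom, of q t]]

lemma coeff_specializesI:
  "c = Fract P Q \<Longrightarrow> ev Q \<noteq> 0 \<Longrightarrow> v = ev P / ev Q \<Longrightarrow> coeff_specializes \<iota> q t c v"
  unfolding coeff_specializes_def by blast

lemma coeff_specializesE:
  assumes "coeff_specializes \<iota> q t c v"
  obtains P Q where "c = Fract P Q" "ev Q \<noteq> 0" "Q \<noteq> 0" "v = ev P / ev Q"
  using assms ev(1) unfolding coeff_specializes_def by metis

sublocale coeff_rel "coeff_specializes \<iota> q t"
proof
  show "coeff_specializes \<iota> q t 0 0"
    by (rule coeff_specializesI[of _ 0 1]) (simp_all add: ev Zero_fract_def)
  show "coeff_specializes \<iota> q t 1 1"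
    by (rule coeff_specializesI[of _ 1 1]) (simp_all add: ev One_fract_def)
  fix a a' b b'
  assume "coeff_specializes \<iota> q t a a'"
  then obtain P Q where a: "a = Fract P Q" "ev Q \<noteq> 0" "Q \<noteq> 0" "a' = ev P / ev Q"
    by (rule coeff_specializesE)
  show "coeff_specializes \<iota> q t (- a) (- a')"
    by (rule coeff_specializesI[of _ "- P" Q]) (simp_all add: a ev)
  assume "coeff_specializes \<iota> q t b b'"
  then obtain P' Q' where b: "b = Fract P' Q'" "ev Q' \<noteq> 0" "Q' \<noteq> 0" "b' = ev P' / ev Q'"
    by (rule coeff_specializesE)
  show "coeff_specializes \<iota> q t (a + b) (a' + b')"
    by (rule coeff_specializesI[of _ "P * Q' + P' * Q" "Q * Q'"])
      (use a b in \<open>simp_all add: ev add_frac_eq\<close>)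
  show "coeff_specializes \<iota> q t (a * b) (a' * b')"
    by (rule coeff_specializesI[of _ "P * P'" "Q * Q'"]) (use a b in \<open>simp_all add: ev\<close>)
qed

lemma rel_divide:
  assumes "coeff_specializes \<iota> q t a a'" "coeff_specializes \<iota> q t b b'" "b' \<noteq> 0"
  shows "coeff_specializes \<iota> q t (a / b) (a' / b')"
proof -
  obtain P Q where b: "b = Fract P Q" "ev Q \<noteq> 0" "Q \<noteq> 0" "b' = ev P / ev Q"
    using assms(2) by (rule coeff_specializesE)
  have "coeff_specializes \<iota> q t (inverse b) (inverse b')"
    by (rule coeff_specializesI[of _ Q P]) (use b assms(3) in \<open>auto simp: ev\<close>)
  then show ?thesis using rel_mult[OF assms(1)] by (simp add: divide_inverse)
qed

text \<open>Two representations of one fraction agree after cross-multiplication, which evaluation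
  preserves. This gives the \<open>THE\<close> in \<open>specialize\<close> its meaning.\<close>

lemma rel_unique:
  assumes "coeff_specializes \<iota> q t a v" "coeff_specializes \<iota> q t a w"
  shows "v = w"
proof -
  obtain P Q where a: "a = Fract P Q" "ev Q \<noteq> 0" "Q \<noteq> 0" "v = ev P / ev Q"
    using assms(1) by (rule coeff_specializesE)
  obtain P' Q' where a': "a = Fract P' Q'" "ev Q' \<noteq> 0" "Q' \<noteq> 0" "w = ev P' / ev Q'"
    using assms(2) by (rule coeff_specializesE)
  have "P * Q' = P' * Q" using a a' by (simp add: eq_fract)
  then have "ev P * ev Q' = ev P' * ev Q" by (metis ev(4))
  then show ?thesis using a a' by (simp add: frac_eq_eq)
qed

lemma rel_gen_q: "coeff_specializes \<iota> q t gen_q q"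
  by (rule coeff_specializesI[of _ "[:0, 1:]" 1])
    (use is_homD[OF hom] in \<open>auto simp: gen_q_def ev, auto simp: eval_qt_def map_poly_pCons\<close>)

lemma rel_gen_t: "coeff_specializes \<iota> q t gen_t t"
  by (rule coeff_specializesI[of _ "[:[:0, 1:]:]" 1])
    (use is_homD[OF hom] in \<open>auto simp: gen_t_def ev, auto simp: eval_qt_def map_poly_pCons\<close>)

lemma rel_spectral: "coeff_specializes \<iota> q t (spectral gen_q gen_t N \<alpha> i) (spectral q t N \<alpha> i)"
  unfolding spectral_def by (intro rel_mult rel_power rel_gen_q rel_gen_t)

lemma rel_powi: "t \<noteq> 0 \<Longrightarrow> coeff_specializes \<iota> q t (gen_t powi k) (t powi k)"
  unfolding power_int_def using rel_power[OF rel_gen_t] rel_divide[OF rel_1 rel_power[OF rel_gen_t]]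
  by (auto simp: divide_inverse power_inverse)

lemma mrel_imp_specialize:
  assumes "mrel p p'"
  shows "no_pole \<iota> q t p" "specialize \<iota> q t p = p'"
proof -
  show "no_pole \<iota> q t p" using assms unfolding no_pole_def mrel_def by blast
  have the: "(THE v. coeff_specializes \<iota> q t c v) = v" if "coeff_specializes \<iota> q t c v" for c v
    using that rel_unique by blast
  show "specialize \<iota> q t p = p'"
    unfolding specialize_def
    using the[OF rel_0] the[OF mrelD[OF assms]]
    by (intro poly_mapping_eqI) (auto simp: Poly_Mapping.map.rep_eq when_def, metis)
qed

lemma no_pole_mrel: "no_pole \<iota> q t p \<Longrightarrow> mrel p (specialize \<iota> q t p)"
proof -
  assume "no_pole \<iota> q t p"
  then have v: "\<exists>v. coeff_specializes \<iota> q t (Poly_Mapping.lookup p e) v" for e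
    by (simp add: no_pole_def)
  have the: "(THE v. coeff_specializes \<iota> q t c v) = v" if "coeff_specializes \<iota> q t c v" for c v
    using that rel_unique by blast
  show ?thesis
    unfolding mrel_def specialize_def using v the rel_0
    by (auto simp: Poly_Mapping.map.rep_eq when_def)
qed

lemma mrel_inv_hecke:
  assumes "mrel p p'" "t \<noteq> 0" "gen_t \<noteq> (0 :: ratfun)"
  shows "mrel (scale (1 / gen_t) (hecke gen_t i p + scale (1 - gen_t) p))
    (scale (1 / t) (hecke t i p' + scale (1 - t) p'))"
  using assms by (intro mrel_scale mrel_add mrel_hecke rel_divide rel_diff rel_1 rel_gen_t)

lemma mrel_unique: "mrel p p' \<Longrightarrow> mrel p p'' \<Longrightarrow> p' = p''"
  using rel_unique unfolding mrel_def by (intro poly_mapping_eqI) blast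

lemma mrel_polys: "mrel p p' \<Longrightarrow> p \<in> polys N \<Longrightarrow> p' \<in> polys N"
  unfolding polys_def mrel_def using rel_unique rel_0 by (auto simp: in_keys_iff subset_iff) metis

lemma gen_t_nonzero: "t \<noteq> 0 \<Longrightarrow> gen_t \<noteq> 0"
  using rel_gen_t rel_0 rel_unique by metis

lemma mrel_cherednik:
  assumes "mrel p p'" "t \<noteq> 0"
  shows "mrel (cherednik gen_q gen_t N i p) (cherednik q t N i p')"
proof -
  \<comment> \<open>The relation cannot be pushed through \<open>inv\<close> as such; the explicit
    inverse divides only by the parameter, whose specialization \<open>t\<close> is nonzero.\<close>
  have inv: "mrel (fold (\<lambda>j. inv (hecke gen_t j)) js p) (fold (\<lambda>j. inv (hecke t j)) js p')"
    if "mrel p p'" for js p p'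
    using that
    by (induction js arbitrary: p p')
      (simp_all add: inv_hecke assms(2) gen_t_nonzero mrel_inv_hecke)
  have fold: "mrel (fold (hecke gen_t) js p) (fold (hecke t) js p')" if "mrel p p'" for js p p'
    using that by (induction js arbitrary: p p') (simp_all add: mrel_hecke rel_gen_t)
  have omega: "mrel (omega gen_q N p) (omega q N p')" if "mrel p p'" for p p'
    unfolding omega_def using that by (intro mrel_subst) (auto intro: mrel_scale rel_gen_q mrel_var)
  show ?thesis
    unfolding cherednik_def
    by (intro mrel_scale rel_power rel_gen_t fold omega inv assms(1))
qed

end

section \<open>Reverse standard tableaux\<close>

lemma diagram_Sigma: "diagram \<tau> = Sigma {1..length \<tau>} (\<lambda>r. {1..\<tau> ! (r - 1)})"
  by (auto simp: diagram_def)

lemma sum_nth_take: "(\<Sum>r = 1..<Suc k. \<tau> ! (r - 1)) = sum_list (take k \<tau>)" if "k \<le> length \<tau>"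
  for \<tau> :: "nat list"
  using that by (induction k) (auto simp: take_Suc_conv_app_nth)

lemma card_diagram: "card (diagram \<tau>) = sum_list \<tau>"
  using sum_nth_take[of "length \<tau>" \<tau>] unfolding diagram_Sigma
  by (subst card_SigmaI) (auto simp: atLeastLessThanSuc_atLeastAtMost simp del: One_nat_def)

locale tableau =
  fixes \<tau> :: "nat list" and S :: "nat \<times> nat \<Rightarrow> nat" and N :: nat
  assumes S_Tab: "S \<in> Tab \<tau>" and N: "N = sum_list \<tau>"
    and partition: "\<And>i j. i \<le> j \<Longrightarrow> j < length \<tau> \<Longrightarrow> \<tau> ! j \<le> \<tau> ! i"
begin

lemma bij: "bij_betw S (diagram \<tau>) {1..N}"
  and outside: "b \<notin> diagram \<tau> \<Longrightarrow> S b = 0"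
  and row_less: "(i, j) \<in> diagram \<tau> \<Longrightarrow> (i, j') \<in> diagram \<tau> \<Longrightarrow> j < j' \<Longrightarrow> S (i, j') < S (i, j)"
  and col_less: "(i, j) \<in> diagram \<tau> \<Longrightarrow> (i', j) \<in> diagram \<tau> \<Longrightarrow> i < i' \<Longrightarrow> S (i', j) < S (i, j)"
  using S_Tab unfolding Tab_def N by blast+

lemma box_of_entry:
  assumes "b \<in> diagram \<tau>"
  shows "row S (S b) = fst b" "col S (S b) = snd b"
proof -
  have "S b > 0" using bij_betwE[OF bij] assms by force
  have "(THE b'. S b' = S b) = b"
  proof (rule the_equality)
    fix b' assume "S b' = S b"
    then have "b' \<in> diagram \<tau>" using outside \<open>S b > 0\<close> by (metis less_irrefl)
    then show "b' = b" using bij \<open>S b' = S b\<close> assms by (auto simp: bij_betw_def inj_on_def)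
  qed simp
  then show "row S (S b) = fst b" "col S (S b) = snd b" by (simp_all add: row_def col_def)
qed

lemma entry:
  assumes "1 \<le> k" "k \<le> N"
  shows "(row S k, col S k) \<in> diagram \<tau>" "S (row S k, col S k) = k"
proof -
  obtain b where b: "b \<in> diagram \<tau>" "S b = k"
    using bij assms unfolding bij_betw_def by (metis atLeastAtMost_iff imageE)
  then show "(row S k, col S k) \<in> diagram \<tau>" "S (row S k, col S k) = k"
    using box_of_entry[OF b(1)] by simp_all
qed

lemma row_range: "1 \<le> k \<Longrightarrow> k \<le> N \<Longrightarrow> 1 \<le> row S k \<and> row S k \<le> length \<tau>"
  using entry(1) by (auto simp: diagram_def)

lemma diagram_down: "(i, j) \<in> diagram \<tau> \<Longrightarrow> 1 \<le> i' \<Longrightarrow> i' \<le> i \<Longrightarrow> 1 \<le> j' \<Longrightarrow> j' \<le> j \<Longrightarrow> (i', j') \<in> diagram \<tau>"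
proof -
  assume *: "(i, j) \<in> diagram \<tau>" "1 \<le> i'" "i' \<le> i" "1 \<le> j'" "j' \<le> j"
  then have "i' - 1 \<le> i - 1" "i - 1 < length \<tau>" by (auto simp: diagram_def)
  from partition[OF this] show "(i', j') \<in> diagram \<tau>" using * by (simp add: diagram_def)
qed

lemma weakly_decreasing:
  assumes "(i, j) \<in> diagram \<tau>" "1 \<le> i'" "i' \<le> i" "1 \<le> j'" "j' \<le> j"
  shows "S (i, j) \<le> S (i', j')"
proof -
  have "S (i, j) \<le> S (i', j)"
    using col_less[of i' j i] diagram_down[OF assms(1-3), of j] assms
    by (cases "i' = i") (auto simp: diagram_def)
  also have "\<dots> \<le> S (i', j')"
    using row_less[of i' j' j] diagram_down[OF assms(1-3), of j] diagram_down[OF assms] assms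
    by (cases "j' = j") (auto simp: diagram_def)
  finally show ?thesis .
qed

lemma strictly_decreasing:
  assumes "(i, j) \<in> diagram \<tau>" "1 \<le> i'" "i' < i" "1 \<le> j'" "j' \<le> j"
  shows "S (i, j) < S (i', j')"
proof -
  have d: "(i', j) \<in> diagram \<tau>" using assms by (intro diagram_down[OF assms(1)]) auto
  have "S (i, j) < S (i', j)" using col_less[OF d assms(1,3)] .
  also have "\<dots> \<le> S (i', j')" using assms by (intro weakly_decreasing[OF d]) auto
  finally show ?thesis .
qed

text \<open>A box strictly between the two in the row would hold an entry strictly between
  \<open>k\<close> and \<open>Suc k\<close>.\<close>

lemma same_row_consecutive:
  assumes k: "1 \<le> k" "k < N" and "row S k = row S (Suc k)"
  shows "col S k = Suc (col S (Suc k))"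
proof -
  note e = entry[of k] entry[of "Suc k"]
  define r c c' where "r = row S k" and "c = col S k" and "c' = col S (Suc k)"
  have 1: "(r, c) \<in> diagram \<tau>" "(r, c') \<in> diagram \<tau>" "S (r, c) = k" "S (r, c') = Suc k"
    using e assms by (auto simp: r_def c_def c'_def)
  have "c' < c" using 1 row_less[of r c c'] by (metis Suc_n_not_le_n less_or_eq_imp_le linorder_neqE_nat n_not_Suc_n)
  moreover have False if "Suc c' < c"
    using row_less[of r c' "Suc c'"] row_less[of r "Suc c'" c] diagram_down[OF 1(1), of r "Suc c'"] 1 that
    by (auto simp: diagram_def)
  ultimately show ?thesis unfolding c_def c'_def by force
qed

lemma same_col_consecutive:
  assumes k: "1 \<le> k" "k < N" and "col S k = col S (Suc k)"
  shows "row S k = Suc (row S (Suc k))"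
proof -
  note e = entry[of k] entry[of "Suc k"]
  define c r r' where "c = col S k" and "r = row S k" and "r' = row S (Suc k)"
  have 1: "(r, c) \<in> diagram \<tau>" "(r', c) \<in> diagram \<tau>" "S (r, c) = k" "S (r', c) = Suc k"
    using e assms by (auto simp: c_def r_def r'_def)
  have "r' < r" using 1 col_less[of r c r'] by (metis Suc_n_not_le_n less_or_eq_imp_le linorder_neqE_nat n_not_Suc_n)
  moreover have False if "Suc r' < r"
    using col_less[of r' c "Suc r'"] col_less[of "Suc r'" c r] diagram_down[OF 1(1), of "Suc r'" c] 1 that
    by (auto simp: diagram_def)
  ultimately show ?thesis unfolding r_def r'_def by force
qed

lemma consecutive_row_less:
  assumes k: "1 \<le> k" "k < N" and "row S k < row S (Suc k)"
  shows "col S (Suc k) < col S k"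
proof (rule ccontr)
  assume "\<not> ?thesis"
  then have "S (row S (Suc k), col S (Suc k)) \<le> S (row S k, col S k)"
    using assms entry(1)[of k] entry(1)[of "Suc k"]
    by (intro weakly_decreasing) (auto simp: diagram_def)
  then show False using entry(2)[of k] entry(2)[of "Suc k"] k by simp
qed

text \<open>If \<open>k\<close> stood strictly below and to the right of \<open>Suc k\<close>, the
  box in the row of \<open>Suc k\<close> and the column of \<open>k\<close> would hold an entry
  strictly between them.\<close>

lemma consecutive_row_greater:
  assumes k: "1 \<le> k" "k < N" and "row S (Suc k) < row S k" "col S k \<noteq> col S (Suc k)"
  shows "col S k < col S (Suc k)"
proof (rule ccontr)
  assume "\<not> ?thesis"
  then have 1: "row S (Suc k) < row S k" "col S (Suc k) < col S k" using assms by auto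
  note e = entry[of k] entry[of "Suc k"]
  have d: "(row S (Suc k), col S k) \<in> diagram \<tau>"
    using diagram_down[OF e(1), of "row S (Suc k)" "col S k"] e 1 k by (auto simp: diagram_def)
  have "S (row S (Suc k), col S k) < Suc k"
    using row_less[of "row S (Suc k)" "col S (Suc k)" "col S k"] e d 1 k by auto
  moreover have "k < S (row S (Suc k), col S k)"
    using col_less[of "row S (Suc k)" "col S k" "row S k"] e d 1 k by auto
  ultimately show False by simp
qed

lemma swap_entries_row_col:
  "row (swap_entries k S) j = row S (transpose k (k + 1) j)"
  "col (swap_entries k S) j = col S (transpose k (k + 1) j)"
proof -
  have "swap_entries k S b = j \<longleftrightarrow> S b = transpose k (k + 1) j" for b
    unfolding swap_entries_def by (auto simp: transpose_def split: if_splits)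
  then show "row (swap_entries k S) j = row S (transpose k (k + 1) j)"
    "col (swap_entries k S) j = col S (transpose k (k + 1) j)"
    by (simp_all add: row_def col_def)
qed

text \<open>The exchange reverses only the comparison between \<open>k\<close> and
  \<open>Suc k\<close>, and no row or column condition compares these two entries.\<close>

lemma swap_entries_Tab:
  assumes k: "1 \<le> k" "k < N" and ne: "row S k \<noteq> row S (Suc k)" "col S k \<noteq> col S (Suc k)"
  shows "swap_entries k S \<in> Tab \<tau>"
proof -
  have "bij_betw (transpose k (k + 1)) {1..N} {1..N}"
    using k by (intro bij_betw_byWitness[where f' = "transpose k (k + 1)"]) (auto simp: transpose_def)
  then have "bij_betw (swap_entries k S) (diagram \<tau>) {1..N}"
    unfolding swap_entries_def using bij bij_betw_trans by blast
  moreover have "swap_entries k S b = 0" if "b \<notin> diagram \<tau>" for b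
    using outside[OF that] k by (simp add: swap_entries_def transpose_def)
  moreover have less: "swap_entries k S b' < swap_entries k S b"
    if "S b' < S b" "b \<in> diagram \<tau>" "b' \<in> diagram \<tau>" "fst b = fst b' \<or> snd b = snd b'" for b b'
  proof -
    have "\<not> (S b' = k \<and> S b = Suc k)"
      using box_of_entry[OF that(2)] box_of_entry[OF that(3)] that(4) ne by auto
    then show ?thesis using that(1) by (auto simp: swap_entries_def transpose_def)
  qed
  ultimately show ?thesis
    unfolding Tab_def N[symmetric] using row_less col_less by auto
qed

lemma card_entries: "card {k\<in>{1..N}. P k} = card {b \<in> diagram \<tau>. P (S b)}"
proof -
  have "bij_betw S {b \<in> diagram \<tau>. P (S b)} {k\<in>{1..N}. P k}"
    using bij by (auto simp: bij_betw_def inj_on_def)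
  then show ?thesis by (metis bij_betw_same_card)
qed

lemma card_entries_row:
  assumes "1 \<le> r" "r \<le> length \<tau>"
  shows "card {k\<in>{1..N}. row S k = r} = \<tau> ! (r - 1)"
proof -
  have "card {k\<in>{1..N}. row S k = r} = card {b \<in> diagram \<tau>. row S (S b) = r}"
    by (rule card_entries)
  also have "{b \<in> diagram \<tau>. row S (S b) = r} = {r} \<times> {1..\<tau> ! (r - 1)}"
    using assms box_of_entry by (auto simp: diagram_def)
  finally show ?thesis by (simp add: card_cartesian_product)
qed

text \<open>These entries fill the rows above that of \<open>k\<close> and the boxes to its left in
  its own row. For \<open>\<alpha>(S)\<close> their number is \<open>N\<close> minus the rank at
  \<open>k\<close>.\<close>

lemma card_entries_before:
  assumes "1 \<le> k" "k \<le> N"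
  shows "card {j\<in>{1..N}. row S j < row S k \<or> row S j = row S k \<and> k < j}
    = sum_list (take (row S k - 1) \<tau>) + (col S k - 1)"
proof -
  note e = entry[OF assms]
  let ?r = "row S k" and ?c = "col S k"
  have r: "1 \<le> ?r" "?r \<le> length \<tau>" using row_range[OF assms] by auto
  have iff: "k < S (?r, c') \<longleftrightarrow> c' < ?c" if "(?r, c') \<in> diagram \<tau>" for c'
    using row_less[OF that e(1)] row_less[OF e(1) that] e(2) by (metis less_asym linorder_neqE_nat less_irrefl)
  have "card {j\<in>{1..N}. row S j < ?r \<or> row S j = ?r \<and> k < j}
      = card {b \<in> diagram \<tau>. row S (S b) < ?r \<or> row S (S b) = ?r \<and> k < S b}"
    by (rule card_entries)
  also have "{b \<in> diagram \<tau>. row S (S b) < ?r \<or> row S (S b) = ?r \<and> k < S b}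
      = Sigma {1..<?r} (\<lambda>r. {1..\<tau> ! (r - 1)}) \<union> {?r} \<times> {1..<?c}"
  proof -
    have "b \<in> diagram \<tau> \<and> (row S (S b) < ?r \<or> row S (S b) = ?r \<and> k < S b) \<longleftrightarrow>
        b \<in> Sigma {1..<?r} (\<lambda>r. {1..\<tau> ! (r - 1)}) \<union> {?r} \<times> {1..<?c}" for b
    proof (cases b)
      case (Pair i j)
      show ?thesis
        unfolding Pair using box_of_entry[of "(i, j)"] iff[of j] r e(1)
        by (cases "i = ?r") (auto simp: diagram_def)
    qed
    then show ?thesis by blast
  qed
  also have "card \<dots> = (\<Sum>r = 1..<?r. \<tau> ! (r - 1)) + (?c - 1)"
    by (subst card_Un_disjoint) (auto simp: card_cartesian_product)
  finally show ?thesis using sum_nth_take[of "?r - 1" \<tau>] r by simp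
qed

text \<open>Both lists are weakly decreasing and contain each row number equally often, and a sorted
  list is determined by its multiset.\<close>

lemma row_word_decreasing:
  assumes "\<And>k. 1 \<le> k \<Longrightarrow> k < N \<Longrightarrow> row S (Suc k) \<le> row S k"
  shows "map (row S) [1..<N + 1] = concat (map (\<lambda>r. replicate (\<tau> ! (r - 1)) r) (rev [1..<length \<tau> + 1]))"
    (is "?xs = ?ys")
proof -
  have count: "count (mset ?ys) r = (if 1 \<le> r \<and> r \<le> length \<tau> then \<tau> ! (r - 1) else 0)" for r
  proof -
    have "count (mset (concat (map (\<lambda>r. replicate (f r) r) (rev [1..<L + 1])))) r
        = (if 1 \<le> r \<and> r \<le> L then f r else 0)" for f and L
      by (induction L) auto
    then show ?thesis .
  qed
  have "count (mset ?xs) r = card {k\<in>{1..N}. row S k = r}" for r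
  proof -
    have "count (mset ?xs) r = length (filter (\<lambda>k. r = row S k) [1..<N + 1])"
      by (simp only: count_mset count_list_eq_length_filter filter_map length_map o_def)
    also have "\<dots> = card (set (filter (\<lambda>k. r = row S k) [1..<N + 1]))"
      by (intro distinct_card[symmetric] distinct_filter) auto
    also have "set (filter (\<lambda>k. r = row S k) [1..<N + 1]) = {k\<in>{1..N}. row S k = r}" by auto
    finally show ?thesis .
  qed
  moreover have "card {k\<in>{1..N}. row S k = r} = (if 1 \<le> r \<and> r \<le> length \<tau> then \<tau> ! (r - 1) else 0)" for r
    using card_entries_row[of r] row_range by (auto simp: card_eq_0_iff)
  ultimately have "mset (rev ?xs) = mset (rev ?ys)"
    by (intro multiset_eqI) (simp only: count mset_rev)
  moreover have "sorted (rev ?xs)"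
  proof -
    have "row S j \<le> row S i" if "i \<le> j" "1 \<le> i" "j \<le> N" for i j
      using that
    proof (induction j rule: dec_induct)
      case (step j)
      then show ?case using assms[of j] by simp
    qed simp
    then show ?thesis
      unfolding sorted_rev_iff_nth_mono by (auto simp del: upt_Suc)
  qed
  moreover have "sorted (rev ?ys)"
  proof -
    have "sorted (concat (map (\<lambda>r. replicate (f r) r) [1..<L + 1]))" for f :: "nat \<Rightarrow> nat" and L
      by (induction L) (auto simp: sorted_append)
    then show ?thesis by (simp add: rev_concat rev_map o_def del: upt_Suc)
  qed
  ultimately have "rev ?xs = rev ?ys" by (metis sorted_sort_id properties_for_sort)
  then show ?thesis by (simp only: rev_is_rev_conv)
qed

end

lemma Tab_nonempty: "Tab \<tau> \<noteq> {}"
proof -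
  let ?N = "sum_list \<tau>"
  \<comment> \<open>\<open>f\<close> numbers the boxes row by row from the top left; reversing the
    numbers gives a reverse standard filling.\<close>
  define f where "f = (\<lambda>(r, c). sum_list (take (r - 1) \<tau>) + c)"
  define S where "S = (\<lambda>b. if b \<in> diagram \<tau> then ?N + 1 - f b else 0)"
  have step: "sum_list (take (r - 1) \<tau>) + \<tau> ! (r - 1) = sum_list (take r \<tau>)"
    if "1 \<le> r" "r \<le> length \<tau>" for r
    using that take_Suc_conv_app_nth[of "r - 1" \<tau>] by simp
  have mono: "sum_list (take r \<tau>) \<le> sum_list (take r' \<tau>)" if "r \<le> r'" for r r'
    using that by (metis append_take_drop_id le_add1 min.absorb1 sum_list_append take_take)
  have f_bound: "1 \<le> f b \<and> f b \<le> ?N" if "b \<in> diagram \<tau>" for b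
    using that step[of "fst b"] mono[of "fst b" "length \<tau>"]
    by (auto simp: diagram_def f_def split: prod.splits)
  have f_row: "f (r, c) < f (r', c')" if "r < r'" "(r, c) \<in> diagram \<tau>" "(r', c') \<in> diagram \<tau>" for r c r' c'
  proof -
    have "r \<le> r' - 1" using that(1) by simp
    from mono[OF this] show ?thesis using that step[of r] by (simp add: diagram_def f_def)
  qed
  have f_col: "f (r, c) < f (r, c')" if "c < c'" for r c c'
    using that by (simp add: f_def)
  have less: "S b' < S b" if "f b < f b'" "b \<in> diagram \<tau>" "b' \<in> diagram \<tau>" for b b'
    using that f_bound[of b] f_bound[of b'] by (simp add: S_def)
  have "inj_on S (diagram \<tau>)"
  proof (rule inj_onI, clarify)
    fix r c r' c' assume *: "(r, c) \<in> diagram \<tau>" "(r', c') \<in> diagram \<tau>" "S (r, c) = S (r', c')"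
    show "r = r' \<and> c = c'"
      using less[OF _ *(1,2)] less[OF _ *(2,1)] f_row[of r r' c c'] f_row[of r' r c' c]
        f_col[of c c' r] f_col[of c' c r] * by (metis less_irrefl linorder_neqE_nat)
  qed
  moreover have "S ` diagram \<tau> \<subseteq> {1..?N}"
    using f_bound by (force simp: S_def)
  ultimately have "bij_betw S (diagram \<tau>) {1..?N}"
    unfolding bij_betw_def by (metis card_atLeastAtMost card_diagram card_image card_subset_eq diff_Suc_1 finite_atLeastAtMost)
  then have "S \<in> Tab \<tau>"
    unfolding Tab_def using less f_row f_col by (auto simp: S_def)
  then show ?thesis by blast
qed

text \<open>Boxes are recovered from the largest entry down. If all entries above \<open>k\<close>
  agree but the boxes of \<open>k\<close> differ, equal content puts one box strictly above and to
  the left of the other; in one tableau that box then holds an entry greater than \<open>k\<close>,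
  hence in both, although the other has \<open>k\<close> there.\<close>

lemma tableau_eqI:
  assumes "tableau \<tau> S N" "tableau \<tau> S' N"
    and c: "\<And>k. 1 \<le> k \<Longrightarrow> k \<le> N \<Longrightarrow> tab_content S k = tab_content S' k"
  shows "S = S'"
proof -
  interpret S: tableau \<tau> S N by fact
  interpret S': tableau \<tau> S' N by fact
  have "row S k = row S' k \<and> col S k = col S' k" if "1 \<le> k" "k \<le> N" for k
    using that
  proof (induction "N - k" arbitrary: k rule: less_induct)
    case less
    note e = S.entry[OF less.prems] and e' = S'.entry[OF less.prems]
    have agree: "row S j = row S' j" "col S j = col S' j" if "k < j" "j \<le> N" for j
    proof -
      have "N - j < N - k" "1 \<le> j" using that by auto
      from less.hyps[OF this that(2)] show "row S j = row S' j" "col S j = col S' j" by auto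
    qed
    have IH: "S b = S' b" if b: "b \<in> diagram \<tau>" "k < S b \<or> k < S' b" for b
      using b(2)
    proof
      assume k: "k < S b"
      have "S b \<le> N" using bij_betwE[OF S.bij] b(1) by auto
      then have "(row S' (S b), col S' (S b)) = b"
        using agree[OF k] S.box_of_entry[OF b(1)] by (metis prod.collapse)
      then show ?thesis using S'.entry(2)[of "S b"] k \<open>S b \<le> N\<close> by simp
    next
      assume k: "k < S' b"
      have "S' b \<le> N" using bij_betwE[OF S'.bij] b(1) by auto
      then have "(row S (S' b), col S (S' b)) = b"
        using agree[OF k] S'.box_of_entry[OF b(1)] by (metis prod.collapse)
      then show ?thesis using S.entry(2)[of "S' b"] k \<open>S' b \<le> N\<close> by simp
    qed
    have content: "int (col S k) - int (row S k) = int (col S' k) - int (row S' k)"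
      using c[OF less.prems] by (simp add: tab_content_def)
    have "\<not> row S k < row S' k"
    proof
      assume *: "row S k < row S' k"
      then have "col S k < col S' k" using content by linarith
      then have "S' (row S' k, col S' k) < S' (row S k, col S k)"
        using * e(1) by (intro S'.strictly_decreasing[OF e'(1)]) (auto simp: diagram_def)
      then show False using IH[OF e(1)] e(2) e'(2) by simp
    qed
    moreover have "\<not> row S' k < row S k"
    proof
      assume *: "row S' k < row S k"
      then have "col S' k < col S k" using content by linarith
      then have "S (row S k, col S k) < S (row S' k, col S' k)"
        using * e'(1) by (intro S.strictly_decreasing[OF e(1)]) (auto simp: diagram_def)
      then show False using IH[OF e'(1)] e(2) e'(2) by simp
    qed
    ultimately show ?case using content by linarith
  qed
  then have "S b = S' b" if "b \<in> diagram \<tau>" for b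
    using S.box_of_entry[OF that] S'.entry(2)[of "S b"] bij_betwE[OF S.bij] that by force
  then show ?thesis using S.outside S'.outside by (metis ext)
qed

section \<open>Reverse lattice permutations\<close>

lemma lookup_comp_of: "Poly_Mapping.lookup (comp_of N f) i = (if 1 \<le> i \<and> i \<le> N then f i else 0)"
  unfolding comp_of_def lookup_sum by (simp add: lookup_single when_def sum.delta)

lemma comp_of_in_comps: "comp_of N f \<in> comps N"
  by (auto simp: comps_def in_keys_iff lookup_comp_of split: if_splits)

definition row_value :: "nat \<Rightarrow> nat \<Rightarrow> nat \<Rightarrow> nat" where
  "row_value m m0 r = (if r = 1 then 0 else m + (r - 2) * m0)"

lemma lookup_reverse_lattice_perm:
  "1 \<le> k \<Longrightarrow> k \<le> N \<Longrightarrow> Poly_Mapping.lookup (reverse_lattice_perm N m m0 S) k = row_value m m0 (row S k)"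
  by (simp add: reverse_lattice_perm_def lookup_comp_of row_value_def)

lemma row_value_less_iff:
  assumes "1 \<le> m" "1 \<le> m0" "1 \<le> r" "1 \<le> r'"
  shows "row_value m m0 r < row_value m m0 r' \<longleftrightarrow> r < r'"
    and "row_value m m0 r = row_value m m0 r' \<longleftrightarrow> r = r'"
proof -
  have less: "row_value m m0 r < row_value m m0 r'" if "1 \<le> r" "r < r'" for r r'
    using that assms by (auto simp: row_value_def)
  show "row_value m m0 r < row_value m m0 r' \<longleftrightarrow> r < r'"
    "row_value m m0 r = row_value m m0 r' \<longleftrightarrow> r = r'"
    using less[of r r'] less[of r' r] assms by (metis less_asym linorder_neqE_nat less_irrefl)+
qed

locale quasistaircase = specialization \<iota> q t
  for \<iota> :: "complex \<Rightarrow> 'a::field" and q t :: 'a +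
  fixes m m0 n n0 l \<tau>l N :: nat and \<tau> :: "nat list" and \<mu> :: composition
    and M :: "composition \<Rightarrow> ratfun mpol"
  assumes pos: "1 \<le> m" "1 \<le> m0" "2 \<le> n0" "n0 \<le> n" "2 \<le> l" "1 \<le> \<tau>l" "\<tau>l \<le> n0 - 1"
    and \<tau>: "\<tau> = (n - 1) # replicate (l - 2) (n0 - 1) @ [\<tau>l]"
    and N: "N = sum_list \<tau>"
    and \<mu>: "\<mu> = comp_of_list (replicate \<tau>l (m + (l - 2) * m0)
               @ concat (map (\<lambda>k. replicate (n0 - 1) (m + k * m0)) (rev [0..<l - 2]))
               @ replicate (n - 1) 0)"
    and t: "t \<noteq> 0" "\<And>k::nat. 0 < k \<Longrightarrow> t ^ k \<noteq> 1"
    and qt: "q ^ m * t ^ n = 1" "q ^ m0 * t ^ n0 = 1"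
    and M: "macdonald_family N M"
    and no_pole_\<mu>: "no_pole \<iota> q t (M \<mu>)"
    and singular_\<mu>: "singular q t N (specialize \<iota> q t (M \<mu>))"
begin

lemma length_\<tau>: "length \<tau> = l"
  using pos by (simp add: \<tau>)

lemma tableauI: "S \<in> Tab \<tau> \<Longrightarrow> tableau \<tau> S N"
proof
  show "\<tau> ! j \<le> \<tau> ! i" if "i \<le> j" "j < length \<tau>" for i j
    using that pos by (auto simp: \<tau> nth_Cons nth_append split: nat.splits)
qed (simp_all add: N)

sublocale H: hecke_module scale t "\<lambda>k. hecke t (N - k)" N
  by (rule hecke_module_mpol[OF t])

abbreviation "\<alpha> \<equiv> reverse_lattice_perm N m m0"

lemma sum_take_\<tau>: "1 \<le> r \<Longrightarrow> r \<le> l \<Longrightarrow> sum_list (take (r - 1) \<tau>) = (if r = 1 then 0 else (n - 1) + (r - 2) * (n0 - 1))"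
proof -
  assume r: "1 \<le> r" "r \<le> l"
  show ?thesis
  proof (cases "r = 1")
    case False
    then obtain k where k: "r = k + 2" using r by (metis One_nat_def add.commute add_2_eq_Suc le_neq_implies_less less_eq_Suc_le le_Suc_ex numeral_2_eq_2)
    then have "take (r - 1) \<tau> = (n - 1) # replicate k (n0 - 1)"
      using r pos by (simp add: \<tau>)
    then show ?thesis using k by (simp add: sum_list_replicate)
  qed simp
qed

text \<open>\<open>N\<close> minus the rank counts the boxes in the rows above and to the left. The
  relation for \<open>m, n\<close> absorbs the first row, the one for \<open>m0, n0\<close> each
  further row above, and \<open>t^(col - row)\<close> is left.\<close>

lemma spectral_content:
  assumes S: "S \<in> Tab \<tau>" and k: "1 \<le> k" "k \<le> N"
  shows "spectral q t N (\<alpha> S) k = t powi tab_content S k"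
proof -
  interpret tableau \<tau> S N by (rule tableauI[OF S])
  note row1 = row_range[unfolded length_\<tau>]
  let ?r = "row S k" and ?c = "col S k"
  have c: "1 \<le> ?c" using entry(1)[OF k] by (auto simp: diagram_def)
  note v = lookup_reverse_lattice_perm[of _ N m m0 S]
  note iff = row_value_less_iff[OF pos(1,2)]
  let ?A = "{j\<in>{1..N}. ?r < row S j}" and ?B = "{j\<in>{1..k}. row S j = ?r}"
    and ?C = "{j\<in>{1..N}. row S j < ?r \<or> row S j = ?r \<and> k < j}"
  have "{j\<in>{1..N}. Poly_Mapping.lookup (\<alpha> S) j > Poly_Mapping.lookup (\<alpha> S) k} = ?A"
    using v iff row1 k by auto
  moreover have "{j\<in>{1..k}. Poly_Mapping.lookup (\<alpha> S) j = Poly_Mapping.lookup (\<alpha> S) k} = ?B"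
    using v iff row1 k by auto
  ultimately have rank: "rank (\<alpha> S) N k = card ?A + card ?B" by (simp add: rank_def)
  have "{1..N} = (?A \<union> ?B) \<union> ?C" using k by auto
  then have "N = card ((?A \<union> ?B) \<union> ?C)" by (metis card_atLeastAtMost diff_Suc_1)
  also have "\<dots> = card (?A \<union> ?B) + card ?C" by (rule card_Un_disjoint) auto
  also have "card (?A \<union> ?B) = card ?A + card ?B" by (rule card_Un_disjoint) auto
  finally have rank: "N - rank (\<alpha> S) N k = sum_list (take (?r - 1) \<tau>) + (?c - 1)"
    using card_entries_before[OF k] rank by simp
  show ?thesis
  proof (cases "?r = 1")
    case True
    then have "spectral q t N (\<alpha> S) k = t ^ (?c - 1)"
      using rank v[OF k] by (simp add: spectral_def row_value_def)
    also have "\<dots> = t powi int (?c - 1)" by simp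
    also have "int (?c - 1) = tab_content S k" using True c by (simp add: tab_content_def)
    finally show ?thesis .
  next
    case False
    then obtain j where j: "?r = j + 2" using row1[OF k] by (metis One_nat_def add.commute add_2_eq_Suc le_neq_implies_less less_eq_Suc_le le_Suc_ex numeral_2_eq_2)
    have "spectral q t N (\<alpha> S) k = q ^ (m + j * m0) * t ^ ((n - 1) + j * (n0 - 1) + (?c - 1))"
      using rank v[OF k] j sum_take_\<tau>[of ?r] row1[OF k] False by (simp add: spectral_def row_value_def)
    \<comment> \<open>Each of the \<open>?r - 1\<close> rows above has one box less than
      \<open>n\<close> or \<open>n0\<close>, and the columns contribute \<open>?c - 1\<close>; the
      factor \<open>t ^ ?r\<close> supplies these \<open>?r\<close> missing units.\<close>
    then have "spectral q t N (\<alpha> S) k * t ^ ?r = q ^ (m + j * m0) * t ^ ((n - 1) + j * (n0 - 1) + (?c - 1) + ?r)"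
      by (simp add: power_add)
    also have "(n - 1) + j * (n0 - 1) + (?c - 1) + ?r = n + j * n0 + ?c"
    proof -
      obtain a b e where "n0 = Suc a" "n = Suc b" "?c = Suc e" using pos c by (metis Suc_le_D one_le_numeral order_trans One_nat_def)
      then show ?thesis using j by simp
    qed
    also have "q ^ (m + j * m0) * t ^ (n + j * n0 + ?c) = (q ^ m * t ^ n) * (q ^ m0 * t ^ n0) ^ j * t ^ ?c"
      by (simp add: power_add power_mult power_mult_distrib mult_ac flip: power_mult)
    finally have "spectral q t N (\<alpha> S) k = t ^ ?c / t ^ ?r"
      using t(1) qt by (simp add: eq_divide_eq)
    then show ?thesis using t(1) by (simp add: tab_content_def power_int_diff)
  qed
qed

lemma swap_comp_\<alpha>:
  assumes S: "S \<in> Tab \<tau>" and k: "1 \<le> k" "k < N"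
  shows "swap_comp N k (\<alpha> S) = \<alpha> (swap_entries k S)"
proof -
  interpret tableau \<tau> S N by (rule tableauI[OF S])
  show ?thesis
    using k by (intro poly_mapping_eqI)
      (auto simp: swap_comp_def reverse_lattice_perm_def lookup_comp_of swap_entries_row_col transpose_def)
qed

lemma \<alpha>_eq_\<mu>:
  assumes S: "S \<in> Tab \<tau>" and "\<And>k. 1 \<le> k \<Longrightarrow> k < N \<Longrightarrow> row S (Suc k) \<le> row S k"
  shows "\<alpha> S = \<mu>"
proof -
  interpret tableau \<tau> S N by (rule tableauI[OF S])
  let ?L = "replicate \<tau>l (m + (l - 2) * m0)
    @ concat (map (\<lambda>k. replicate (n0 - 1) (m + k * m0)) (rev [0..<l - 2])) @ replicate (n - 1) 0"
  have "rev [1..<length \<tau> + 1] = l # map (\<lambda>k. k + 2) (rev [0..<l - 2]) @ [1]"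
  proof -
    have "[1..<length \<tau> + 1] = 1 # [2..<l] @ [l]"
      using pos by (simp add: length_\<tau> upt_conv_Cons numeral_2_eq_2)
    also have "[2..<l] = map (\<lambda>k. k + 2) [0..<l - 2]"
      by (rule nth_equalityI) auto
    finally show ?thesis by (simp add: rev_map)
  qed
  moreover have "\<tau> ! (l - 1) = \<tau>l" "\<tau> ! (1 - 1) = n - 1"
    using pos by (auto simp: \<tau> nth_Cons nth_append split: nat.splits)
  moreover have "map ((\<lambda>r. replicate (\<tau> ! (r - 1)) r) \<circ> (\<lambda>k. k + 2)) (rev [0..<l - 2])
      = map (\<lambda>k. replicate (n0 - 1) (k + 2)) (rev [0..<l - 2])"
    by (rule map_cong) (auto simp: \<tau> nth_append)
  ultimately have "map (row S) [1..<N + 1] = replicate \<tau>l l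
      @ concat (map (\<lambda>k. replicate (n0 - 1) (k + 2)) (rev [0..<l - 2])) @ replicate (n - 1) 1"
    using row_word_decreasing[OF assms(2)]
    by (simp only: list.map map_append map_map concat.simps concat_append append_Nil2)
  then have "map (row_value m m0) (map (row S) [1..<N + 1]) = ?L"
    using pos by (simp add: map_concat o_def row_value_def)
  then have L: "?L = map (\<lambda>k. row_value m m0 (row S k)) [1..<N + 1]" by (simp add: o_def)
  show ?thesis
    unfolding \<mu> comp_of_list_def L
    by (intro poly_mapping_eqI) (auto simp: lookup_comp_of reverse_lattice_perm_def row_value_def simp del: upt_Suc)
qed

text \<open>A larger row for \<open>Suc k\<close> forces a smaller column, so both coordinates
  contribute at least 1. This keeps every intertwiner step invertible.\<close>

lemma content_gap:
  assumes S: "S \<in> Tab \<tau>" and k: "1 \<le> k" "k < N" and less: "row S k < row S (Suc k)"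
  shows "swap_entries k S \<in> Tab \<tau>" "2 \<le> tab_content S k - tab_content S (Suc k)"
proof -
  interpret tableau \<tau> S N by (rule tableauI[OF S])
  have c: "col S (Suc k) < col S k" by (rule consecutive_row_less[OF k less])
  then show "swap_entries k S \<in> Tab \<tau>" using less by (intro swap_entries_Tab[OF k]) auto
  show "2 \<le> tab_content S k - tab_content S (Suc k)" using c less by (simp add: tab_content_def)
qed

text \<open>The intertwiner coefficient \<open>(1 - t) y / (y - x)\<close> with \<open>y\<close> at
  \<open>k\<close> and \<open>x\<close> at \<open>Suc k\<close>, since reversed counting puts
  \<open>Suc k\<close> first. \<open>gen_coeff\<close> is its counterpart over C(q,t);
  \<open>step_norm\<close> and \<open>gen_norm\<close> are the scalars of
  \<open>intertwine_inverse\<close>.\<close>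

definition step_coeff :: "(nat \<times> nat \<Rightarrow> nat) \<Rightarrow> nat \<Rightarrow> 'a" where
  "step_coeff S k = (1 - t) * t powi tab_content S k / (t powi tab_content S k - t powi tab_content S (Suc k))"

definition gen_coeff :: "(nat \<times> nat \<Rightarrow> nat) \<Rightarrow> nat \<Rightarrow> ratfun" where
  "gen_coeff S k = (1 - gen_t) * spectral gen_q gen_t N (\<alpha> S) k
     / (spectral gen_q gen_t N (\<alpha> S) k - spectral gen_q gen_t N (\<alpha> S) (Suc k))"

definition step_norm :: "(nat \<times> nat \<Rightarrow> nat) \<Rightarrow> nat \<Rightarrow> 'a" where
  "step_norm S k = (t * t powi tab_content S k - t powi tab_content S (Suc k))
     * (t powi tab_content S k - t * t powi tab_content S (Suc k))
     / (t powi tab_content S k - t powi tab_content S (Suc k))\<^sup>2"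

definition gen_norm :: "(nat \<times> nat \<Rightarrow> nat) \<Rightarrow> nat \<Rightarrow> ratfun" where
  "gen_norm S k = (gen_t * spectral gen_q gen_t N (\<alpha> S) k - spectral gen_q gen_t N (\<alpha> S) (Suc k))
     * (spectral gen_q gen_t N (\<alpha> S) k - gen_t * spectral gen_q gen_t N (\<alpha> S) (Suc k))
     / (spectral gen_q gen_t N (\<alpha> S) k - spectral gen_q gen_t N (\<alpha> S) (Suc k))\<^sup>2"

lemma step_specializes:
  assumes S: "S \<in> Tab \<tau>" and k: "1 \<le> k" "k < N" and less: "row S k < row S (Suc k)"
  shows "t powi tab_content S k \<noteq> t powi tab_content S (Suc k)" "step_norm S k \<noteq> 0"
    and "spectral gen_q gen_t N (\<alpha> S) k \<noteq> spectral gen_q gen_t N (\<alpha> S) (Suc k)"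
    and "coeff_specializes \<iota> q t (gen_coeff S k) (step_coeff S k)"
    and "coeff_specializes \<iota> q t (gen_norm S k) (step_norm S k)"
    and "hecke gen_t k (M (\<alpha> S)) + scale (gen_coeff S k) (M (\<alpha> S)) = M (\<alpha> (swap_entries k S))"
proof -
  interpret tableau \<tau> S N by (rule tableauI[OF S])
  let ?x = "spectral gen_q gen_t N (\<alpha> S) (Suc k)" and ?y = "spectral gen_q gen_t N (\<alpha> S) k"
  let ?x' = "t powi tab_content S (Suc k)" and ?y' = "t powi tab_content S k"
  have x: "coeff_specializes \<iota> q t ?x ?x'" and y: "coeff_specializes \<iota> q t ?y ?y'"
    using rel_spectral[of N "\<alpha> S"] spectral_content[OF S, of k] spectral_content[OF S, of "Suc k"] k
    by (metis Suc_leI le_SucI less_imp_le)+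
  note gap = content_gap(2)[OF assms]
  then show ne: "?y' \<noteq> ?x'" by (auto simp: H.powi_inj)
  \<comment> \<open>Equality over C(q,t) would survive specialization.\<close>
  then show ne': "?y \<noteq> ?x" using rel_unique x y by metis
  have "t * ?y' = t powi (tab_content S k + 1)" "t * ?x' = t powi (tab_content S (Suc k) + 1)"
    using t(1) by (simp_all add: power_int_add)
  then show "step_norm S k \<noteq> 0" using gap ne by (auto simp: step_norm_def H.powi_inj)
  show "coeff_specializes \<iota> q t (gen_coeff S k) (step_coeff S k)"
    unfolding step_coeff_def gen_coeff_def using ne
    by (intro rel_divide rel_mult rel_diff rel_1 rel_gen_t x y) auto
  show "coeff_specializes \<iota> q t (gen_norm S k) (step_norm S k)"
    unfolding step_norm_def gen_norm_def using ne
    by (intro rel_divide rel_mult rel_diff rel_power rel_gen_t x y) auto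
  have "Poly_Mapping.lookup (\<alpha> S) k < Poly_Mapping.lookup (\<alpha> S) (k + 1)"
    using lookup_reverse_lattice_perm[of k N m m0 S] lookup_reverse_lattice_perm[of "Suc k" N m m0 S]
      row_value_less_iff(1)[OF pos(1,2), of "row S k" "row S (Suc k)"] row_range[of k] row_range[of "Suc k"]
      k less by simp
  then have "hecke gen_t k (M (\<alpha> S)) = M (swap_comp N k (\<alpha> S))
      - scale ((1 - gen_t) / (1 - ?x / ?y)) (M (\<alpha> S))"
    using M comp_of_in_comps k unfolding macdonald_family_def reverse_lattice_perm_def[symmetric]
    by (simp add: reverse_lattice_perm_def)
  moreover have "(1 - gen_t) / (1 - ?x / ?y) = gen_coeff S k"
  proof -
    have "?y \<noteq> 0" using rel_unique[OF y, of 0] rel_0 t(1) by auto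
    then show ?thesis using ne' by (simp add: gen_coeff_def field_simps)
  qed
  ultimately show "hecke gen_t k (M (\<alpha> S)) + scale (gen_coeff S k) (M (\<alpha> S)) = M (\<alpha> (swap_entries k S))"
    using swap_comp_\<alpha>[OF S k] by simp
qed

text \<open>Pulled back from \<open>t\<close>: equal elements of C(q,t) have equal
  specializations.\<close>

lemma gen_t: "gen_t \<noteq> (0 :: ratfun)" "0 < k \<Longrightarrow> gen_t ^ k \<noteq> (1 :: ratfun)"
  using gen_t_nonzero t rel_unique[OF rel_power[OF rel_gen_t, of k]] rel_1 by metis+

text \<open>The Macdonald relation leads from \<open>S\<close> to \<open>swap_entries k S\<close>
  only, while regularity is known at the end of the chain, at \<open>\<mu>\<close>.
  \<open>intertwine_inverse\<close> over C(q,t) reverses the step.\<close>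

lemma step_inverse:
  assumes S: "S \<in> Tab \<tau>" and k: "1 \<le> k" "k < N" and less: "row S k < row S (Suc k)"
  shows "M (\<alpha> S) = scale (1 / gen_norm S k) (hecke gen_t k (M (\<alpha> (swap_entries k S)))
    + scale (1 - gen_t - gen_coeff S k) (M (\<alpha> (swap_entries k S))))"
proof -
  interpret G: hecke_module scale gen_t "\<lambda>k. hecke gen_t (N - k)" N
    by (rule hecke_module_mpol) (use gen_t in auto)
  note st = step_specializes[OF assms]
  have "gen_norm S k \<noteq> 0" using st(2) rel_unique[OF st(5)] rel_0 by metis
  moreover have "hecke gen_t k (M (\<alpha> (swap_entries k S)))
      + scale (1 - gen_t - gen_coeff S k) (M (\<alpha> (swap_entries k S))) = scale (gen_norm S k) (M (\<alpha> S))"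
    using G.intertwine_inverse[OF st(3)[symmetric], of "gen_coeff S k" "N - k" "M (\<alpha> S)"] st(6) k
    by (simp add: gen_coeff_def gen_norm_def)
  ultimately show ?thesis by (simp add: scale_simps)
qed

definition spec_M :: "(nat \<times> nat \<Rightarrow> nat) \<Rightarrow> 'a mpol" where
  "spec_M S = specialize \<iota> q t (M (\<alpha> S))"

text \<open>
  The Jucys-Murphy elements are counted from \<open>N\<close> downwards, with \<open>s\<^sub>k = T\<^sub>N\<^sub>-\<^sub>k\<close>, as the tableaux are
  reverse standard.
\<close>

definition contents :: "(nat \<times> nat \<Rightarrow> nat) \<Rightarrow> nat \<Rightarrow> int" where
  "contents S j = tab_content S (N + 1 - j)"

text \<open>The \<open>mrel\<close> part says that \<open>M (\<alpha> S)\<close> has no pole;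
  \<open>specialize\<close> is total and meaningful only in that case.\<close>

definition regular :: "(nat \<times> nat \<Rightarrow> nat) \<Rightarrow> bool" where
  "regular S \<longleftrightarrow> mrel (M (\<alpha> S)) (spec_M S) \<and> H.jm_vector N (contents S) (spec_M S)"

lemma regular_step:
  assumes S: "S \<in> Tab \<tau>" and k: "1 \<le> k" "k < N" and less: "row S k < row S (Suc k)"
    and regular: "regular (swap_entries k S)"
  shows "regular S"
proof -
  interpret tableau \<tau> S N by (rule tableauI[OF S])
  note st = step_specializes[OF S k less]
  let ?S = "swap_entries k S"
  let ?w = "hecke t k (spec_M ?S) + scale (1 - t - step_coeff S k) (spec_M ?S)"
  have r: "mrel (M (\<alpha> ?S)) (spec_M ?S)" and v: "H.jm_vector N (contents ?S) (spec_M ?S)"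
    using regular by (auto simp: regular_def)
  have "mrel (M (\<alpha> S)) (scale (1 / step_norm S k) ?w)"
    unfolding step_inverse[OF S k less] using st(2)
    by (intro mrel_scale mrel_add mrel_hecke rel_divide rel_diff rel_1 rel_gen_t st r)
  note mrel_imp_specialize(2)[OF this] this
  then have spec_M: "spec_M S = scale (1 / step_norm S k) ?w" and r': "mrel (M (\<alpha> S)) (spec_M S)"
    by (simp_all add: spec_M_def)
  have c: "contents ?S (N - k) = tab_content S k" "contents ?S (Suc (N - k)) = tab_content S (Suc k)"
    using k by (simp_all add: contents_def tab_content_def swap_entries_row_col Suc_diff_le)
  have co: "1 - t - step_coeff S k = H.swap_coeff (contents ?S (N - k)) (contents ?S (Suc (N - k)))"
    unfolding c step_coeff_def H.swap_coeff_def using st(1) by (simp add: field_simps)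
  have w: "?w = hecke t (N - (N - k)) (spec_M ?S)
      + scale (H.swap_coeff (contents ?S (N - k)) (contents ?S (Suc (N - k)))) (spec_M ?S)"
    unfolding co using k by simp
  have "H.jm_vector N (contents ?S \<circ> transpose (N - k) (Suc (N - k))) ?w"
    unfolding w using content_gap(2)[OF S k less] k H.jm_vectorD(2)[OF v]
    by (intro H.jm_vector_swap[OF v] H.swap_nonzero) (auto simp: c)
  then have "H.jm_vector N (contents ?S \<circ> transpose (N - k) (Suc (N - k))) (spec_M S)"
    unfolding spec_M using st(2) by (intro H.jm_vector_smul) auto
  then have "H.jm_vector N (contents S) (spec_M S)"
  proof (rule H.jm_vector_cong)
    fix j assume j: "1 \<le> j" "j \<le> N"
    have "N + 1 - transpose (N - k) (Suc (N - k)) j = transpose k (k + 1) (N + 1 - j)"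
      using j k by (auto simp: transpose_def)
    then show "contents S j = (contents ?S \<circ> transpose (N - k) (Suc (N - k))) j"
      by (simp add: contents_def tab_content_def swap_entries_row_col)
  qed
  with r' show ?thesis by (simp add: regular_def)
qed

text \<open>Here singularity enters: it turns the Cherednik equations of \<open>M \<mu>\<close>,
  once specialized, into Jucys-Murphy equations whose eigenvalues are powers of \<open>t\<close>
  with the contents as exponents.\<close>

lemma regular_base:
  assumes S: "S \<in> Tab \<tau>" and dec: "\<And>k. 1 \<le> k \<Longrightarrow> k < N \<Longrightarrow> row S (Suc k) \<le> row S k"
  shows "regular S"
proof -
  interpret tableau \<tau> S N by (rule tableauI[OF S])
  have \<alpha>: "\<alpha> S = \<mu>" by (rule \<alpha>_eq_\<mu>[OF S dec])
  have r: "mrel (M (\<alpha> S)) (spec_M S)" unfolding spec_M_def \<alpha> by (rule no_pole_mrel[OF no_pole_\<mu>])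
  have comps: "\<alpha> S \<in> comps N" by (simp add: reverse_lattice_perm_def comp_of_in_comps)
  have p: "M (\<alpha> S) \<in> polys N" using M comps by (simp add: macdonald_family_def)
  have "H.jm j (spec_M S) = scale (t powi contents S j) (spec_M S)" if j: "1 \<le> j" "j \<le> N" for j
  proof -
    define i where "i = N + 1 - j"
    have i: "1 \<le> i" "i \<le> N" "N + 1 - i = j" using j by (auto simp: i_def)
    have "dunkl q t N i (spec_M S) = 0"
      using singular_\<mu> i unfolding singular_def spec_M_def \<alpha> by simp
    then have "cherednik q t N i (spec_M S) = H.jm j (spec_M S)"
      using dunkl_eq_0_cherednik[OF t mrel_polys[OF r p] i(1,2)] i(3) by simp
    moreover have "cherednik gen_q gen_t N i (M (\<alpha> S)) = scale (spectral gen_q gen_t N (\<alpha> S) i) (M (\<alpha> S))"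
      using M comps i by (simp add: macdonald_family_def)
    then have "cherednik q t N i (spec_M S) = scale (spectral q t N (\<alpha> S) i) (spec_M S)"
      using mrel_cherednik[OF r t(1), of N i] mrel_scale[OF rel_spectral r, of N "\<alpha> S" i] mrel_unique by metis
    ultimately show ?thesis
      using spectral_content[OF S i(1,2)] by (simp add: contents_def i_def)
  qed
  \<comment> \<open>The leading coefficient is a power of \<open>gen_t\<close>, which specializes to
    a power of \<open>t\<close> and so does not vanish.\<close>
  moreover have "spec_M S \<noteq> 0"
  proof
    assume "spec_M S = 0"
    then have "coeff_specializes \<iota> q t (Poly_Mapping.lookup (M (\<alpha> S)) (\<alpha> S)) 0"
      using mrelD[OF r, of "\<alpha> S"] by simp
    moreover obtain e where "Poly_Mapping.lookup (M (\<alpha> S)) (\<alpha> S) = gen_t powi e"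
      using M comps unfolding macdonald_family_def by blast
    ultimately show False using rel_powi[OF t(1), of e] rel_unique t(1) by (metis power_int_not_zero)
  qed
  ultimately show ?thesis using r by (simp add: regular_def H.jm_vector_def)
qed

text \<open>The exchange brings the larger row number to the smaller position. The weight is the
  measure for the induction over tableaux, and a minimizer has a weakly decreasing row word.\<close>

lemma weight_decreases:
  assumes S: "S \<in> Tab \<tau>" and k: "1 \<le> k" "k < N" and less: "row S k < row S (Suc k)"
  shows "(\<Sum>j = 1..N. j * row (swap_entries k S) j) < (\<Sum>j = 1..N. j * row S j)"
proof -
  interpret tableau \<tau> S N by (rule tableauI[OF S])
  have split: "(\<Sum>j = 1..N. f j) = (\<Sum>j\<in>{1..N} - {k, Suc k}. f j) + (f k + f (Suc k))" for f :: "nat \<Rightarrow> nat"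
    using k sum.subset_diff[of "{k, Suc k}" "{1..N}" f] by simp
  have "(\<Sum>j\<in>{1..N} - {k, Suc k}. j * row (swap_entries k S) j) = (\<Sum>j\<in>{1..N} - {k, Suc k}. j * row S j)"
    by (rule sum.cong) (auto simp: swap_entries_row_col transpose_def)
  moreover have "k * row S (Suc k) + Suc k * row S k < k * row S k + Suc k * row S (Suc k)"
    using less by simp
  ultimately show ?thesis
    unfolding split by (simp add: swap_entries_row_col)
qed

lemma regular_Tab: "S \<in> Tab \<tau> \<Longrightarrow> regular S"
proof (induction "\<Sum>j = 1..N. j * row S j" arbitrary: S rule: less_induct)
  case less
  show ?case
  proof (cases "\<exists>k. 1 \<le> k \<and> k < N \<and> row S k < row S (Suc k)")
    case True
    then obtain k where k: "1 \<le> k" "k < N" "row S k < row S (Suc k)" by blast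
    show ?thesis
      using less.hyps[OF weight_decreases[OF less.prems k] content_gap(1)[OF less.prems k]]
      by (rule regular_step[OF less.prems k])
  next
    case False
    then show ?thesis using regular_base[OF less.prems] by (meson not_le)
  qed
qed

lemma exists_\<mu>: "\<exists>S\<in>Tab \<tau>. \<alpha> S = \<mu>"
proof -
  obtain S0 where "S0 \<in> Tab \<tau>" using Tab_nonempty by blast
  then obtain S where S: "S \<in> Tab \<tau>"
    and min: "\<And>S'. S' \<in> Tab \<tau> \<Longrightarrow> (\<Sum>j = 1..N. j * row S j) \<le> (\<Sum>j = 1..N. j * row S' j)"
    using ex_has_least_nat[of "\<lambda>S. S \<in> Tab \<tau>" S0 "\<lambda>S. \<Sum>j = 1..N. j * row S j"] by blast
  have "row S (Suc k) \<le> row S k" if k: "1 \<le> k" "k < N" for k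
  proof (rule ccontr)
    assume "\<not> ?thesis"
    then have "row S k < row S (Suc k)" by simp
    from weight_decreases[OF S k this] min[OF content_gap(1)[OF S k this]] show False by simp
  qed
  then show ?thesis using \<alpha>_eq_\<mu>[OF S] S by blast
qed

section \<open>Action of the Hecke operators on the specialized polynomials\<close>

lemma hecke_step:
  assumes S: "S \<in> Tab \<tau>" and k: "1 \<le> k" "k < N" and less: "row S k < row S (Suc k)"
  shows "spec_M (swap_entries k S) = hecke t k (spec_M S) + scale (step_coeff S k) (spec_M S)"
    and "scale (step_norm S k) (spec_M S) = hecke t k (spec_M (swap_entries k S)) + scale (1 - t - step_coeff S k) (spec_M (swap_entries k S))"
proof -
  note st = step_specializes[OF S k less]
  have "mrel (M (\<alpha> S)) (spec_M S)" using regular_Tab[OF S] by (simp add: regular_def)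
  then have "mrel (M (\<alpha> (swap_entries k S))) (hecke t k (spec_M S) + scale (step_coeff S k) (spec_M S))"
    unfolding st(6)[symmetric] by (intro mrel_add mrel_scale mrel_hecke rel_gen_t st)
  then show 1: "spec_M (swap_entries k S) = hecke t k (spec_M S) + scale (step_coeff S k) (spec_M S)"
    using mrel_imp_specialize(2) by (simp add: spec_M_def)
  show "scale (step_norm S k) (spec_M S) = hecke t k (spec_M (swap_entries k S)) + scale (1 - t - step_coeff S k) (spec_M (swap_entries k S))"
    using H.intertwine_inverse[OF st(1)[symmetric], of "step_coeff S k" "N - k" "spec_M S"] k
    by (simp add: 1 step_coeff_def step_norm_def)
qed

lemma hecke_same_row:
  assumes S: "S \<in> Tab \<tau>" and k: "1 \<le> k" "k < N" and eq: "row S k = row S (Suc k)"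
  shows "hecke t k (spec_M S) = scale t (spec_M S)"
proof -
  interpret tableau \<tau> S N by (rule tableauI[OF S])
  have v: "H.jm_vector (Suc (N - k)) (contents S) (spec_M S)"
    by (rule H.jm_vector_mono[of N]) (use regular_Tab[OF S] k in \<open>auto simp: regular_def\<close>)
  \<comment> \<open>Entries decrease along rows, so \<open>Suc k\<close> stands directly to the left
    of \<open>k\<close>; in reversed counting the content goes up by 1.\<close>
  have "contents S (Suc (N - k)) = contents S (N - k) + 1"
    using same_row_consecutive[OF k eq] eq k by (simp add: contents_def tab_content_def Suc_diff_le)
  from H.adjacent_jm_eigen(1)[OF v _ this] show ?thesis using k by simp
qed

lemma hecke_same_col:
  assumes S: "S \<in> Tab \<tau>" and k: "1 \<le> k" "k < N" and eq: "col S k = col S (Suc k)"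
  shows "hecke t k (spec_M S) = - spec_M S"
proof -
  interpret tableau \<tau> S N by (rule tableauI[OF S])
  have v: "H.jm_vector (Suc (N - k)) (contents S) (spec_M S)"
    by (rule H.jm_vector_mono[of N]) (use regular_Tab[OF S] k in \<open>auto simp: regular_def\<close>)
  have "contents S (Suc (N - k)) = contents S (N - k) - 1"
    using same_col_consecutive[OF k eq] eq k by (simp add: contents_def tab_content_def Suc_diff_le)
  from H.adjacent_jm_eigen(2)[OF v _ this] show ?thesis using k by simp
qed

lemma contents_distinct:
  assumes "S \<in> Tab \<tau>" "S' \<in> Tab \<tau>" "S \<noteq> S'"
  shows "\<exists>j\<in>{1..N}. contents S j \<noteq> contents S' j"
proof -
  obtain k where k: "1 \<le> k" "k \<le> N" "tab_content S k \<noteq> tab_content S' k"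
    using tableau_eqI[OF tableauI[OF assms(1)] tableauI[OF assms(2)]] assms(3) by blast
  then show ?thesis by (intro bexI[of _ "N + 1 - k"]) (auto simp: contents_def)
qed

text \<open>\<open>swap_entries k S\<close> has an ascent at \<open>k\<close> that leads back to
  \<open>S\<close>, so this is the second identity of \<open>hecke_step\<close> for that tableau.
  The rest rewrites its constants in terms of \<open>t powi b\<close>.\<close>

lemma hecke_steep:
  assumes S: "S \<in> Tab \<tau>" and k: "1 \<le> k" "k < N"
    and b: "b = tab_content S k - tab_content S (Suc k)" "b \<le> - 2"
  shows "hecke t k (spec_M S)
    = scale (t * (t powi (b + 1) - 1) * (t powi (b - 1) - 1) / (t powi b - 1)\<^sup>2) (spec_M (swap_entries k S))
      + scale (t powi b * (t - 1) / (t powi b - 1)) (spec_M S)"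
    and "swap_entries k S \<in> Tab \<tau>"
proof -
  interpret tableau \<tau> S N by (rule tableauI[OF S])
  let ?S = "swap_entries k S"
  have "row S k \<noteq> row S (Suc k)"
    using same_row_consecutive[OF k] b by (auto simp: tab_content_def)
  moreover have "\<not> row S k < row S (Suc k)"
    using consecutive_row_less[OF k] b by (auto simp: tab_content_def)
  moreover have col: "col S k \<noteq> col S (Suc k)"
    using same_col_consecutive[OF k] b by (auto simp: tab_content_def)
  ultimately have row: "row S (Suc k) < row S k" by simp
  show S': "?S \<in> Tab \<tau>" using row col by (intro swap_entries_Tab[OF k]) auto
  have less: "row ?S k < row ?S (Suc k)" using row by (simp add: swap_entries_row_col)
  have SS: "swap_entries k ?S = S"
    unfolding swap_entries_def by (simp add: fun_eq_iff)
  have c: "tab_content ?S k = tab_content S (Suc k)" "tab_content ?S (Suc k) = tab_content S k"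
    by (simp_all add: tab_content_def swap_entries_row_col)
  define x y where "x = t powi tab_content S k" and "y = t powi tab_content S (Suc k)"
  have xy: "x \<noteq> 0" "y \<noteq> 0" "x \<noteq> y"
    using t(1) b by (auto simp: x_def y_def H.powi_inj)
  have p: "t powi b = x / y" "t powi (b + 1) = t * x / y" "t powi (b - 1) = x / (t * y)"
    using t(1) b(1) by (simp_all add: x_def y_def power_int_add power_int_diff)
  have n: "step_norm ?S k = t * (t powi (b + 1) - 1) * (t powi (b - 1) - 1) / (t powi b - 1)\<^sup>2"
  proof -
    have "t * (t * x / y - 1) * (x / (t * y) - 1) = (t * x - y) * (x - t * y) / y\<^sup>2"
      using t(1) xy by (simp add: field_simps power2_eq_square)
    moreover have "(x / y - 1)\<^sup>2 = (y - x)\<^sup>2 / y\<^sup>2"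
      using xy by (simp add: field_simps power2_eq_square)
    ultimately have "t * (t * x / y - 1) * (x / (t * y) - 1) / (x / y - 1)\<^sup>2
        = (t * x - y) * (x - t * y) / (y - x)\<^sup>2"
      using xy by simp
    also have "(t * x - y) * (x - t * y) = (t * y - x) * (y - t * x)" by (simp add: algebra_simps)
    finally show ?thesis
      by (simp only: p step_norm_def c flip: x_def y_def)
  qed
  have co: "- (1 - t - step_coeff ?S k) = t powi b * (t - 1) / (t powi b - 1)"
  proof -
    have "- (1 - t - (1 - t) * y / (y - x)) = (t - 1) * x / (x - y)"
      using xy by (simp add: field_simps)
    also have "\<dots> = (x / y) * (t - 1) / (x / y - 1)"
      using xy by (simp add: field_simps)
    finally show ?thesis by (simp only: p step_coeff_def c flip: x_def y_def)
  qed
  have "hecke t k (spec_M S) = scale (step_norm ?S k) (spec_M ?S) + scale (- (1 - t - step_coeff ?S k)) (spec_M S)"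
    using hecke_step(2)[OF S' k less] unfolding SS by (simp only: mpol.scale_minus_left) simp
  then show "hecke t k (spec_M S)
    = scale (t * (t powi (b + 1) - 1) * (t powi (b - 1) - 1) / (t powi b - 1)\<^sup>2) (spec_M (swap_entries k S))
      + scale (t powi b * (t - 1) / (t powi b - 1)) (spec_M S)"
    unfolding n co .
qed

lemma hecke_ascent:
  assumes S: "S \<in> Tab \<tau>" and k: "1 \<le> k" "k < N" and less: "row S k < row S (Suc k)"
    and b: "b = tab_content S k - tab_content S (Suc k)"
  shows "hecke t k (spec_M S) = spec_M (swap_entries k S) + scale ((t - 1) / (1 - t powi (- b))) (spec_M S)"
proof -
  note st = step_specializes(1)[OF S k less]
  have "t powi (- b) = t powi tab_content S (Suc k) / t powi tab_content S k"
    using t(1) b by (simp flip: power_int_diff)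
  moreover have "(t - 1) / (1 - x / y) = - ((1 - t) * y / (y - x))" if "y \<noteq> 0" "y \<noteq> x" for x y
    using that by (simp add: field_simps)
  ultimately have "(t - 1) / (1 - t powi (- b)) = - step_coeff S k"
    using st t(1) by (simp add: step_coeff_def)
  then show ?thesis
    using hecke_step(1)[OF S k less] by (simp add: mpol.scale_minus_left)
qed

lemma hecke_in_span:
  assumes S: "S \<in> Tab \<tau>" and k: "1 \<le> k" "k < N"
  shows "hecke t k (spec_M S) \<in> mpol.span (spec_M ` Tab \<tau>)"
proof -
  interpret tableau \<tau> S N by (rule tableauI[OF S])
  note span = mpol.span_add mpol.span_scale mpol.span_neg mpol.span_base imageI
  consider "row S k = row S (Suc k)" | "row S k < row S (Suc k)" | "col S k = col S (Suc k)"
    | "row S (Suc k) < row S k" "col S k \<noteq> col S (Suc k)"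
    by linarith
  then show ?thesis
  proof cases
    case 1
    then show ?thesis using S by (simp add: hecke_same_row[OF S k] span)
  next
    case 2
    then show ?thesis
      using S content_gap(1)[OF S k 2] by (simp add: hecke_ascent[OF S k 2 refl] span)
  next
    case 3
    then show ?thesis using S by (simp add: hecke_same_col[OF S k] span)
  next
    case 4
    then have "tab_content S k - tab_content S (Suc k) \<le> - 2"
      using consecutive_row_greater[OF k] by (simp add: tab_content_def)
    note steep = hecke_steep[OF S k refl this]
    show ?thesis unfolding steep(1) using S steep(2) by (intro span)
  qed
qed

lemma isotype_basis_spec_M: "isotype_basis t N \<tau> spec_M"
proof -
  have regular: "regular S" if "S \<in> Tab \<tau>" for S using regular_Tab[OF that] .
  have polys: "spec_M S \<in> polys N" if "S \<in> Tab \<tau>" for S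
  proof -
    have "M (\<alpha> S) \<in> polys N"
      using M comp_of_in_comps by (simp add: macdonald_family_def reverse_lattice_perm_def)
    then show ?thesis using mrel_polys regular[OF that] by (auto simp: regular_def)
  qed
  have "inj_on spec_M (Tab \<tau>)" "mpol.independent (spec_M ` Tab \<tau>)"
    using regular contents_distinct
    by (intro H.jm_vectors_independent[of _ contents]; simp add: regular_def)+
  moreover have "hecke t i p \<in> mpol.span (spec_M ` Tab \<tau>)"
    if "i \<in> {1..<N}" "p \<in> mpol.span (spec_M ` Tab \<tau>)" for i p
  proof (rule mpol.span_induct[OF that(2)])
    show "mpol.subspace {p. hecke t i p \<in> mpol.span (spec_M ` Tab \<tau>)}"
      by (auto simp: mpol.subspace_def hecke_add hecke_scale mpol.span_zero mpol.span_add mpol.span_scale)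
  qed (use hecke_in_span that(1) in auto)
  moreover have "let b = tab_content S i - tab_content S (i + 1) in
        (row S i = row S (i + 1) \<longrightarrow> hecke t i (spec_M S) = scale t (spec_M S)) \<and>
        (col S i = col S (i + 1) \<longrightarrow> hecke t i (spec_M S) = - spec_M S) \<and>
        (row S i < row S (i + 1) \<and> col S i > col S (i + 1) \<longrightarrow>
           hecke t i (spec_M S) =
             spec_M (swap_entries i S) + scale ((t - 1) / (1 - t powi (- b))) (spec_M S)) \<and>
        (b \<le> - 2 \<longrightarrow>
           hecke t i (spec_M S) =
             scale (t * (t powi (b + 1) - 1) * (t powi (b - 1) - 1) / (t powi b - 1)\<^sup>2)
               (spec_M (swap_entries i S))
             + scale (t powi b * (t - 1) / (t powi b - 1)) (spec_M S))"
    if S: "S \<in> Tab \<tau>" and i: "i \<in> {1..<N}" for S i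
  proof -
    have k: "1 \<le> i" "i < N" using i by auto
    show ?thesis
      using hecke_same_row[OF S k] hecke_same_col[OF S k] hecke_ascent[OF S k _ refl] hecke_steep(1)[OF S k refl]
      by (simp add: Let_def)
  qed
  ultimately show ?thesis
    unfolding isotype_basis_def using polys by blast
qed

lemma isotype_\<mu>:
  "of_isotype t N \<tau> (specialize \<iota> q t (M \<mu>)) \<and>
    (\<forall>S\<in>Tab \<tau>. no_pole \<iota> q t (M (\<alpha> S))) \<and>
    isotype_basis t N \<tau> (\<lambda>S. specialize \<iota> q t (M (\<alpha> S)))"
proof (intro conjI ballI)
  obtain S where S: "S \<in> Tab \<tau>" "\<alpha> S = \<mu>" using exists_\<mu> by blast
  then have "specialize \<iota> q t (M \<mu>) \<in> mpol.span (spec_M ` Tab \<tau>)"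
    by (intro mpol.span_base) (auto simp: spec_M_def)
  then show "of_isotype t N \<tau> (specialize \<iota> q t (M \<mu>))"
    unfolding of_isotype_def using isotype_basis_spec_M by blast
  show "no_pole \<iota> q t (M (\<alpha> S))" if "S \<in> Tab \<tau>" for S
    using regular_Tab[OF that] mrel_imp_specialize(1) by (auto simp: regular_def)
  show "isotype_basis t N \<tau> (\<lambda>S. specialize \<iota> q t (M (\<alpha> S)))"
    using isotype_basis_spec_M by (simp add: spec_M_def[abs_def])
qed

end

theorem theorem5p10:
  fixes m0 n0 d l \<tau>l m n g N :: nat
    and \<tau> :: "nat list" and \<mu> :: composition
    and \<iota> :: "complex \<Rightarrow> 'a::field" and u q t :: 'a and z :: complex
    and M :: "composition \<Rightarrow> ratfun mpol"
  assumes "m0 \<ge> 1" and "n0 \<ge> 2" and "d \<ge> 1" and "l \<ge> 2"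
    and "m = d * m0" and "n = d * n0" and "g = gcd m0 n0"
    and "1 \<le> \<tau>l" and "\<tau>l \<le> n0 - 1"
    and "\<tau> = (n - 1) # replicate (l - 2) (n0 - 1) @ [\<tau>l]"
    and "N = sum_list \<tau>"
    and "\<mu> = comp_of_list (replicate \<tau>l (m + (l - 2) * m0)
               @ concat (map (\<lambda>k. replicate (n0 - 1) (m + k * m0)) (rev [0..<l - 2]))
               @ replicate (n - 1) 0)"
    and "extends_C_u \<iota> u"
    and "(z ^ (m0 div g)) ^ g = 1" and "\<forall>k. 0 < k \<and> k < g \<longrightarrow> (z ^ (m0 div g)) ^ k \<noteq> 1"
    and "q = \<iota> z * u powi (- int (n0 div g))" and "t = u ^ (m0 div g)"
    and "macdonald_family N M"
    and "no_pole \<iota> q t (M \<mu>)" and "singular q t N (specialize \<iota> q t (M \<mu>))"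
  shows "of_isotype t N \<tau> (specialize \<iota> q t (M \<mu>)) \<and>
    (\<forall>S\<in>Tab \<tau>. no_pole \<iota> q t (M (reverse_lattice_perm N m m0 S))) \<and>
    isotype_basis t N \<tau> (\<lambda>S. specialize \<iota> q t (M (reverse_lattice_perm N m m0 S)))"
proof -
  have hom: "is_hom \<iota>" by (rule extends_C_u_is_hom) fact
  note [simp] = is_homD[OF hom] is_hom_uminus[OF hom]
  have g: "g > 0" "g dvd m0" "g dvd n0" using assms(1,7) by auto
  have transcendental: "poly (map_poly \<iota> p) u \<noteq> 0" if "p \<noteq> 0" for p
    using assms(13) that by (auto simp: extends_C_u_def)
  have u: "u \<noteq> 0" using transcendental[of "[:0, 1:]"] by (simp add: map_poly_pCons)
  have u_not_root: "u ^ k \<noteq> 1" if "0 < k" for k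
  proof
    assume "u ^ k = 1"
    have "monom 1 k - 1 \<noteq> (0 :: complex poly)"
      using that by (metis degree_1 degree_monom_eq eq_iff_diff_eq_0 less_irrefl zero_neq_one)
    moreover have "poly (map_poly \<iota> (monom 1 k - 1)) u = u ^ k - 1"
    proof -
      have "map_poly \<iota> (monom 1 k - 1) = monom 1 k - 1"
        by (rule poly_eqI) (simp add: coeff_map_poly coeff_1)
      then show ?thesis by (simp add: poly_monom)
    qed
    ultimately show False using transcendental \<open>u ^ k = 1\<close> by (metis right_minus_eq)
  qed
  have md: "0 < m0 div g" using g assms(1) by (simp add: div_greater_zero_iff dvd_imp_le)
  have t: "t \<noteq> 0" "t ^ k \<noteq> 1" if "0 < k" for k
    using u u_not_root[of "(m0 div g) * k"] md that by (auto simp: assms(17) power_mult)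
  have pow: "\<iota> (z ^ k) = \<iota> z ^ k" for k by (induction k) auto
  \<comment> \<open>\<open>z ^ m0\<close> is \<open>(z ^ (m0 div g)) ^ g = 1\<close>, and the powers
    of \<open>u\<close> cancel because \<open>(n0 div g) * m0 = (m0 div g) * n0\<close>.\<close>
  have base: "q ^ m0 * t ^ n0 = 1"
  proof -
    have "z ^ m0 = 1" using assms(14) g(2) by (simp flip: power_mult)
    then have "\<iota> z ^ m0 = 1" using pow[of m0] by simp
    moreover have "u powi (- int (n0 div g)) = inverse (u ^ (n0 div g))"
      by (simp add: power_int_minus)
    moreover have "(n0 div g) * m0 = (m0 div g) * n0" using g by (metis div_mult_swap dvd_mult_div_cancel mult.commute)
    ultimately show ?thesis
      using u by (simp add: assms(16,17) power_mult_distrib power_inverse flip: power_mult)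
  qed
  have "q ^ m * t ^ n = (q ^ m0 * t ^ n0) ^ d"
    by (simp add: assms(5,6) power_mult_distrib mult.commute flip: power_mult)
  then have "q ^ m * t ^ n = 1" using base by simp
  have "n0 \<le> n" "1 \<le> m" using assms by auto
  interpret quasistaircase \<iota> q t m m0 n n0 l \<tau>l N \<tau> \<mu> M
    by unfold_locales (fact | use t[of 1] t in simp)+
  show ?thesis by (rule isotype_\<mu>)
qed

end
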